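(* Let $G=\mathbb{Z}_{p^2}\times\mathbb{Z}_q\times\mathbb{Z}_r$ for distinct primes $p$, $q$ and $r$, let $S$ be a proper subset of $G\setminus\{0\}$ that generates $G$, and let $S_0=S\cup\{0\}$. Let $0\in C\subseteq G$ be such that $|C|$ is not relatively prime to $|S_0|$. Then $C$ is a perfect code in $\mathrm{Cay}(G,S)$ if and only if, for some integer parameters, $(S_0,C)$ is one of the following pairs: (1) $S_0=\{(i+\alpha_ip,\alpha_i,\alpha_i)\mid i\in[p]\}$, $C=\{(ip,j,k)\mid i\in[p],j\in[q],k\in[r]\}$; (2) $S_0=\{(\alpha_i+jp,i,\beta_i)\mid i\in[q],j\in[p]\}$, $C=\{(i+\lambda_{ij}p,0,j)\mid i\in[p],j\in[r]\}$; (3) $S_0=\{(i+\alpha_ip,j,\alpha_i)\mid i\in[p],j\in[q]\}$, $C=\{(ip,\lambda_{ij},j)\mid i\in[p],j\in[r]\}$; (4) $S_0=\{(j+\alpha_{ij}p,i,\alpha_i)\mid i\in[q],j\in[p]\}$, $C=\{(\lambda_i+jp,0,i)\mid i\in[r],j\in[p]\}$; (5) $S_0=\{(i+\alpha_{ij}p,j,\alpha_i)\mid i\in[p],j\in[q]\}$, $C=\{(jp,\lambda_i,i)\mid i\in[r],j\in[p]\}$; (6) $S_0=\{(i+\alpha_ip,j,\alpha_{ij})\mid i\in[p],j\in[q]\}$, $C=\{(ip,\lambda_i,j)\mid i\in[p],j\in[r]\}$; (7) $S_0=\{(\alpha_i+jp,i,\alpha_{ij})\mid i\in[q],j\in[p]\}$,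 $C=\{(i+\lambda_ip,0,j)\mid i\in[p],j\in[r]\}$; (8) $S_0=\{(i+\alpha_{ij}p,j,\beta_{ij})\mid i\in[p],j\in[q]\}$, $C=\{(ip,0,j)\mid i\in[p],j\in[r]\}$; (9) $S_0=\{(\alpha_i+jp,\beta_i,i)\mid i\in[r],j\in[p]\}$, $C=\{(i+\lambda_{ij}p,j,0)\mid i\in[p],j\in[q]\}$; (10) $S_0=\{(i+\alpha_ip,\alpha_i,j)\mid i\in[p],j\in[r]\}$, $C=\{(ip,j,\lambda_{ij})\mid i\in[p],j\in[q]\}$; (11) $S_0=\{(j+\alpha_{ij}p,\alpha_i,i)\mid i\in[r],j\in[p]\}$, $C=\{(\lambda_i+jp,i,0)\mid i\in[q],j\in[p]\}$; (12) $S_0=\{(i+\alpha_{ij}p,\alpha_i,j)\mid i\in[p],j\in[r]\}$, $C=\{(jp,i,\lambda_i)\mid i\in[q],j\in[p]\}$; (13) $S_0=\{(i+\alpha_ip,\alpha_{ij},j)\mid i\in[p],j\in[r]\}$, $C=\{(ip,j,\lambda_i)\mid i\in[p],j\in[q]\}$; (14) $S_0=\{(\alpha_i+jp,\alpha_{ij},i)\mid i\in[r],j\in[p]\}$, $C=\{(i+\lambda_ip,j,0)\mid i\in[p],j\in[q]\}$; (15) $S_0=\{(i+\alpha_{ij}p,\beta_{ij},j)\mid i\in[p],j\in[r]\}$, $C=\{(ip,j,0)\mid i\in[p],j\in[q]\}$; (16) $S_0=\{(\alpha_{ij}+kp,i,j)\mid i\in[q],j\in[r],k\in[p]\}$, $C=\{(i+\lambda_ip,0,0)\mid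 i\in[p]\}$; (17) $S_0=\{(i+\alpha_{ij}p,k,j)\mid i\in[p],j\in[r],k\in[q]\}$, $C=\{(ip,\lambda_i,0)\mid i\in[p]\}$; (18) $S_0=\{(i+\alpha_{ij}p,j,k)\mid i\in[p],j\in[q],k\in[r]\}$, $C=\{(ip,0,\lambda_i)\mid i\in[p]\}$; (19) $S_0=\{(\alpha_i+jp,k,i)\mid i\in[r],j\in[p],k\in[q]\}$, $C=\{(i+\lambda_ip,\lambda_i,0)\mid i\in[p]\}$; (20) $S_0=\{(\alpha_i+jp,i,k)\mid i\in[q],j\in[p],k\in[r]\}$, $C=\{(i+\lambda_ip,0,\lambda_i)\mid i\in[p]\}$; (21) $S_0=\{(i+\alpha_ip,j,k)\mid i\in[p],j\in[q],k\in[r]\}$, $C=\{(ip,\lambda_i,\lambda_i)\mid i\in[p]\}$; (22) $S_0=\{(i+\alpha_{ijk}p,j,k)\mid i\in[p],j\in[q],k\in[r]\}$, $C=\{(ip,0,0)\mid i\in[p]\}$.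
   Context: Groups are finite abelian, written additively; $\mathbb{Z}_n$ is the group of integers modulo $n$ and $[n]=\{0,1,\dots,n-1\}$; integers in coordinates are read modulo the relevant modulus. For $S\subseteq G\setminus\{0\}$, $\mathrm{Cay}(G,S)$ is the directed graph with vertex set $G$ and an arc from $x$ to $y$ if and only if $y-x\in S$ ($S$ is not assumed to be inverse-closed). A subset $C\subseteq G$ is a perfect code in $\mathrm{Cay}(G,S)$ if the sets $\{c\}\cup\{v:\text{there is an arc from } c \text{ to } v\}$, $c\in C$, form a partition of $G$. Greek letters with subscripts denote arbitrary integers, one for each value of the displayed indices, subject only to being $0$ when all subscripts are $0$; different letters (or index patterns) denote independent families, and an integer occurring several times in one element is the same integer each time. *)

theory Defs
  imports
    "HOL-Algebra.Elementary_Groups"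
    "HOL-Algebra.Generated_Groups"
    "HOL-Computational_Algebra.Primes"
    "HOL-Library.Disjoint_Sets"
    "Graph_Theory.Pair_Digraph"
begin

text \<open>The library writes groups multiplicatively: the difference of two elements y and x of an
  additive group is the product of y and the inverse of x.\<close>

definition cayley_digraph :: "('a, 'b) monoid_scheme \<Rightarrow> 'a set \<Rightarrow> 'a pair_pre_digraph" where
  "cayley_digraph G S =
     \<lparr> pverts = carrier G,
       parcs = {(x, y). x \<in> carrier G \<and> y \<in> carrier G \<and> y \<otimes>\<^bsub>G\<^esub> inv\<^bsub>G\<^esub> x \<in> S} \<rparr>"

definition closed_out_neighbourhood :: "('a, 'b) pre_digraph \<Rightarrow> 'a \<Rightarrow> 'a set" where
  "closed_out_neighbourhood D c = {c} \<union> {v. c \<rightarrow>\<^bsub>D\<^esub> v}"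

text \<open>The partition is one of the indexed family: distinct members of a perfect code have disjoint
  closed out-neighbourhoods, hence every vertex lies in the neighbourhood of exactly one of them.\<close>

definition perfect_code :: "('a, 'b) pre_digraph \<Rightarrow> 'a set \<Rightarrow> bool" where
  "perfect_code D C \<longleftrightarrow>
     C \<subseteq> verts D \<and>
     disjoint_family_on (closed_out_neighbourhood D) C \<and>
     (\<Union>c\<in>C. closed_out_neighbourhood D c) = verts D"

definition Zppqr :: "nat \<Rightarrow> nat \<Rightarrow> nat \<Rightarrow> (int \<times> int \<times> int) monoid" where
  "Zppqr p q r = integer_mod_group (p\<^sup>2) \<times>\<times> integer_mod_group q \<times>\<times> integer_mod_group r"

text \<open>The carrier of \<^const>\<open>integer_mod_group\<close> consists of the least nonnegative residues, so a
  triple of arbitrary integers denotes the following group element.\<close>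

definition elt :: "nat \<Rightarrow> nat \<Rightarrow> nat \<Rightarrow> int \<Rightarrow> int \<Rightarrow> int \<Rightarrow> int \<times> int \<times> int" where
  "elt p q r x y z = (x mod int (p\<^sup>2), y mod int q, z mod int r)"

end

theory Submission
  imports Defs "HOL-Number_Theory.Cong"
begin

text \<open>
  Translating a connection set by a vertex gives its closed out-neighbourhood, so \<open>C\<close> is a perfect
  code exactly when every element of the group \<open>G\<close> is uniquely a sum of an element of \<open>S \<union> {0}\<close> and
  an element of \<open>C\<close>. Such a decomposition of \<open>G\<close> is called a factorization below, and the two factors
  are called \<open>A\<close> (the connection set with zero) and \<open>B\<close> (the code).

  The main tool is a theorem of Sands and Tijdeman: if \<open>A + B = G\<close> is a factorization and \<open>m\<close> is
  coprime to \<open>|A|\<close>, then \<open>m A + B = G\<close> is again one. For a prime \<open>m\<close> it follows from counting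
  the \<open>m\<close>-tuples over \<open>A\<close> whose sum differs from a given element by an element of \<open>B\<close>: there are
  \<open>|A| ^ (m - 1)\<close> of them, a number not divisible by \<open>m\<close>, the cyclic group of
  order \<open>m\<close> permutes them by rotation, and the constant tuples are the fixed points, so there is a constant one (\<open>factorization_prime_power\<close>).
  Applied to both factors, it says that for nonzero differences \<open>d\<close> of \<open>A\<close> and \<open>e\<close> of \<open>B\<close> the
  multiples \<open>m d\<close> and \<open>n e\<close> never agree when \<open>m\<close> is coprime to \<open>|A|\<close> and \<open>n\<close> to \<open>|B|\<close>.
  By the Chinese remainder theorem such multipliers can be chosen in each primary component
  separately. In the component of \<open>p\<close> any two elements of equal order can be matched; in the component
  of \<open>q\<close>, if \<open>q\<close> divides \<open>|A|\<close>, then \<open>e\<close> may be annihilated but \<open>d\<close> only rescaled, and if \<open>q\<close> divides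
  \<open>|B|\<close> the roles are exchanged; similarly for \<open>r\<close>. This turns the factorization property into a purely
  combinatorial condition on which coordinates of two differences vanish
  (\<open>factorization_collision\<close>).

  Since the two orders have a common prime and multiply to \<open>p\<^sup>2 q r\<close>, both are divisible by \<open>p\<close> exactly
  once. Let \<open>P\<close> be the subgroup of order \<open>p\<close>. Fibre \<open>A\<close> over those of the components of orders
  \<open>q\<close> and \<open>r\<close> whose primes divide \<open>|A|\<close>, and \<open>B\<close> likewise. Differences inside the
  fibres cannot have the same order in the component of \<open>p\<close>, which forces one factor to have fibres lying in cosets of \<open>P\<close> and the other one to have
  fibres that are transversals of \<open>P\<close> (\<open>dichotomy\<close>). What remains is to decide, in each of the two
  alternatives and for each possible order of \<open>A\<close>, which coordinates depend on which; the combinatorial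
  condition and the fact that \<open>A\<close> generates \<open>G\<close> leave only the listed families. Conversely, in each
  listed pair the indices can be read off from a sum one after the other, so the sums are distinct.

  Exchanging \<open>q\<close> and \<open>r\<close> maps the list to itself, so only thirteen of the twenty-two families are
  treated explicitly.
\<close>

section \<open>Fixed points of a permutation of prime order\<close>

text \<open>Points that are not fixed fall into orbits with exactly \<open>l\<close> elements. The induction removes one
  such orbit at a time.\<close>

lemma card_cong_card_fixpoints:
  assumes "prime l" "finite X" "f ` X \<subseteq> X" "\<And>x. x \<in> X \<Longrightarrow> (f ^^ l) x = x"
  shows "[card X = card {x \<in> X. f x = x}] (mod l)"
  using assms(2-)
proof (induction X rule: finite_psubset_induct)
  case (psubset X)
  show ?case
  proof (cases "\<forall>x\<in>X. f x = x")
    case True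
    then have "{x \<in> X. f x = x} = X" by auto
    then show ?thesis by simp
  next
    case False
    then obtain x where x: "x \<in> X" "f x \<noteq> x" by auto
    define O' where "O' = range (\<lambda>k. (f ^^ k) x)"
    have l0: "l > 0" using assms(1) prime_gt_0_nat by blast
    have inX: "(f ^^ k) y \<in> X" if "y \<in> X" for k y
      using that psubset.prems(1) by (induction k) auto
    have per: "(f ^^ (l * v + k)) x = (f ^^ k) x" for v k
    proof (induction v)
      case (Suc v)
      have "(f ^^ (l * Suc v + k)) x = (f ^^ l) ((f ^^ (l * v + k)) x)"
      proof -
        have "l * Suc v + k = l + (l * v + k)" by simp
        then show ?thesis by (simp only: funpow_add[of l "l * v + k"] o_apply)
      qed
      also have "\<dots> = (f ^^ (l * v + k)) x" using psubset.prems(2) inX x(1) by blast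
      finally show ?case using Suc by simp
    qed simp
    have OX: "O' \<subseteq> X" using inX x(1) unfolding O'_def by auto
    have O_eq: "O' = (\<lambda>k. (f ^^ k) x) ` {..<l}"
    proof -
      have "(f ^^ k) x \<in> (\<lambda>k. (f ^^ k) x) ` {..<l}" for k
        using per[of "k div l" "k mod l"] l0
        by (intro image_eqI[of _ _ "k mod l"]) auto
      then show ?thesis unfolding O'_def by auto
    qed
    (* A return after d < l steps gives, since d is invertible modulo l, a return after one step. *)
    have no_short: False if d: "(f ^^ d) x = x" "0 < d" "d < l" for d
    proof -
      have "coprime d l" using d assms(1)
        by (metis coprime_commute nat_dvd_not_less prime_imp_coprime)
      then obtain u where u: "[d * u = 1] (mod l)" using cong_solve_coprime_nat by auto
      have "d * u \<ge> 1"
      proof (rule ccontr)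
        assume "\<not> 1 \<le> d * u"
        then have "[0 = 1] (mod l)" using u by (metis less_one linorder_not_le)
        then show False using assms(1) by (simp add: cong_def prime_nat_iff)
      qed
      then obtain v where v: "d * u = l * v + 1"
        using u by (metis cong_le_nat cong_sym mult.commute)
      have "(f ^^ (d * u)) x = x"
      proof (induction u)
        case (Suc u)
        have "(f ^^ (d * Suc u)) x = (f ^^ (d * u + d)) x" by (simp add: algebra_simps)
        also have "\<dots> = (f ^^ (d * u)) ((f ^^ d) x)" by (simp only: funpow_add o_apply)
        finally show ?case using Suc d(1) by simp
      qed simp
      then show False using per[of v 1] v x(2) by simp
    qed
    have "inj_on (\<lambda>k. (f ^^ k) x) {..<l}"
    proof (rule linorder_inj_onI)
      fix i j assume ij: "i < j" "i \<in> {..<l}" "j \<in> {..<l}"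
      show "(f ^^ i) x \<noteq> (f ^^ j) x"
      proof
        assume "(f ^^ i) x = (f ^^ j) x"
        then have "(f ^^ (l - j)) ((f ^^ i) x) = (f ^^ (l - j)) ((f ^^ j) x)" by simp
        then have "(f ^^ (l - j + i)) x = (f ^^ (l - j + j)) x" by (simp only: funpow_add o_apply)
        then have "(f ^^ (l - j + i)) x = x" using ij psubset.prems(2) x(1) by simp
        moreover have "0 < l - j + i" "l - j + i < l" using ij(1,3) unfolding lessThan_iff by linarith+
        ultimately show False by (rule no_short)
      qed
    qed auto
    then have cardO: "card O' = l" unfolding O_eq by (simp add: card_image)
    have fO: "f y \<in> O'" if "y \<in> O'" for y
      using that unfolding O'_def by (auto simp flip: funpow.simps(2)[unfolded o_def] intro: range_eqI[of _ _ "Suc _"])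
    have fkO: "(f ^^ k) y \<in> O'" if "y \<in> O'" for y k
      using that by (induction k) (auto intro: fO)
    (* The orbit can also be traversed backwards, as f (l - 1 times) undoes f. *)
    have sub: "f ` (X - O') \<subseteq> X - O'"
    proof
      fix z assume "z \<in> f ` (X - O')"
      then obtain y where y: "y \<in> X" "y \<notin> O'" "z = f y" by auto
      have "(f ^^ (l - 1)) (f y) = (f ^^ l) y"
        using l0 by (metis Suc_diff_1 comp_apply funpow_Suc_right)
      then have "(f ^^ (l - 1)) (f y) = y" using psubset.prems(2) y(1) by simp
      then have "f y \<notin> O'" using fkO y(2) by metis
      then show "z \<in> X - O'" using y psubset.prems(1) by auto
    qed
    have "x \<in> O'" unfolding O'_def by (rule range_eqI[of _ _ 0]) simp
    then have "X - O' \<subset> X" using x(1) by auto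
    then have IH: "[card (X - O') = card {x \<in> X - O'. f x = x}] (mod l)"
      using psubset.IH sub psubset.prems(2) by blast
    have nofix: "f y \<noteq> y" if y: "y \<in> O'" for y
    proof
      assume fy: "f y = y"
      obtain k where k: "k < l" "y = (f ^^ k) x" using y unfolding O_eq by auto
      have iter: "(f ^^ j) y = y" for j using fy by (induction j) auto
      have "(f ^^ (l - k)) y = (f ^^ (l - k + k)) x" unfolding k(2) by (simp only: funpow_add o_apply)
      then have "y = x" using iter k psubset.prems(2) x(1) by simp
      then show False using fy x(2) by simp
    qed
    have "{x \<in> X - O'. f x = x} = {x \<in> X. f x = x}" using nofix by auto
    moreover have "card X = card (X - O') + l"
      using cardO OX psubset.hyps by (metis card_Diff_subset card_mono finite_subset le_add_diff_inverse2)
    ultimately show ?thesis using IH by (simp add: cong_def)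
  qed
qed


section \<open>Factorizations of finite abelian groups\<close>

definition factorization :: "('a, 'b) monoid_scheme \<Rightarrow> 'a set \<Rightarrow> 'a set \<Rightarrow> bool" where
  "factorization G A B \<longleftrightarrow> A \<subseteq> carrier G \<and> B \<subseteq> carrier G \<and>
     bij_betw (\<lambda>(a, b). a \<otimes>\<^bsub>G\<^esub> b) (A \<times> B) (carrier G)"

lemma factorization_card:
  "factorization G A B \<Longrightarrow> card A * card B = order G"
  unfolding factorization_def order_def by (metis bij_betw_same_card card_cartesian_product)

lemma factorization_unique:
  assumes "factorization G A B" "a \<in> A" "a' \<in> A" "b \<in> B" "b' \<in> B" "a \<otimes>\<^bsub>G\<^esub> b = a' \<otimes>\<^bsub>G\<^esub> b'"
  shows "a = a' \<and> b = b'"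
  using assms unfolding factorization_def bij_betw_def inj_on_def by fastforce

lemma factorization_exists:
  assumes "factorization G A B" "g \<in> carrier G"
  shows "\<exists>a\<in>A. \<exists>b\<in>B. a \<otimes>\<^bsub>G\<^esub> b = g"
proof -
  have "g \<in> (\<lambda>(a, b). a \<otimes>\<^bsub>G\<^esub> b) ` (A \<times> B)"
    using assms unfolding factorization_def bij_betw_def by simp
  then show ?thesis by auto
qed

text \<open>A surjection from a set that is at most as large as the finite group is a bijection.\<close>

lemma factorizationI_surj:
  assumes "A \<subseteq> carrier G" "B \<subseteq> carrier G" "finite (carrier G)" "card A * card B \<le> order G"
    and "\<And>g. g \<in> carrier G \<Longrightarrow> \<exists>a\<in>A. \<exists>b\<in>B. a \<otimes>\<^bsub>G\<^esub> b = g"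
    and "monoid G"
  shows "factorization G A B"
proof -
  have fin: "finite (A \<times> B)" using assms(1-3) by (auto intro: finite_subset)
  have img: "(\<lambda>(a, b). a \<otimes>\<^bsub>G\<^esub> b) ` (A \<times> B) = carrier G"
  proof (intro equalityI subsetI)
    fix g assume "g \<in> carrier G"
    then obtain a b where "a \<in> A" "b \<in> B" "a \<otimes>\<^bsub>G\<^esub> b = g" using assms(5) by blast
    then show "g \<in> (\<lambda>(a, b). a \<otimes>\<^bsub>G\<^esub> b) ` (A \<times> B)" by force
  next
    fix g assume "g \<in> (\<lambda>(a, b). a \<otimes>\<^bsub>G\<^esub> b) ` (A \<times> B)"
    then show "g \<in> carrier G" using assms(1,2) monoid.m_closed[OF assms(6)] by auto
  qed
  have "card (A \<times> B) \<le> card ((\<lambda>(a, b). a \<otimes>\<^bsub>G\<^esub> b) ` (A \<times> B))"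
    using assms(4) unfolding img order_def by (simp add: card_cartesian_product)
  then have "inj_on (\<lambda>(a, b). a \<otimes>\<^bsub>G\<^esub> b) (A \<times> B)"
    using fin card_image_le eq_card_imp_inj_on le_antisym by blast
  then show ?thesis using assms(1,2) img unfolding factorization_def bij_betw_def by simp
qed

lemma (in comm_group) factorization_commute: "factorization G A B \<Longrightarrow> factorization G B A"
proof -
  assume f: "factorization G A B"
  then have sub: "A \<subseteq> carrier G" "B \<subseteq> carrier G" unfolding factorization_def by auto
  have "bij_betw ((\<lambda>(a, b). a \<otimes> b) \<circ> prod.swap) (B \<times> A) (carrier G)"
    using f unfolding factorization_def
    by (intro bij_betw_trans[of prod.swap _ "A \<times> B"]) (auto intro!: bij_betw_byWitness[of _ prod.swap])
  then have "bij_betw (\<lambda>(a, b). a \<otimes> b) (B \<times> A) (carrier G)"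
    using sub by (subst bij_betw_cong[of _ _ "(\<lambda>(a, b). a \<otimes> b) \<circ> prod.swap"]) (auto intro!: m_comm)
  then show ?thesis using sub unfolding factorization_def by simp
qed

lemma rotate1_fix_imp_replicate:
  assumes "rotate1 xs = xs" "length xs = n" "n > 0"
  shows "xs = replicate n (hd xs)"
proof -
  have "rotate k xs = xs" for k by (induction k) (auto simp: assms(1))
  then have "xs ! k = xs ! 0" if "k < n" for k
    using nth_rotate[of 0 xs k] that assms by auto
  then have nth: "\<forall>k<n. xs ! k = hd xs" using assms by (metis hd_conv_nth length_greater_0_conv)
  show ?thesis by (rule nth_equalityI) (use nth assms(2) in simp_all)
qed

context comm_group begin

lemma foldr_mult_closed: "set xs \<subseteq> carrier G \<Longrightarrow> foldr (\<otimes>) xs \<one> \<in> carrier G"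
  by (induction xs) auto

lemma foldr_mult_append_single:
  "set xs \<subseteq> carrier G \<Longrightarrow> x \<in> carrier G \<Longrightarrow> foldr (\<otimes>) (xs @ [x]) \<one> = x \<otimes> foldr (\<otimes>) xs \<one>"
proof (induction xs)
  case (Cons a xs)
  then show ?case by (simp add: m_lcomm foldr_mult_closed)
qed simp

lemma foldr_mult_rotate1: "set xs \<subseteq> carrier G \<Longrightarrow> foldr (\<otimes>) (rotate1 xs) \<one> = foldr (\<otimes>) xs \<one>"
  by (cases xs) (auto simp: foldr_mult_append_single simp del: foldr_append)

lemma foldr_mult_replicate: "x \<in> carrier G \<Longrightarrow> foldr (\<otimes>) (replicate n x) \<one> = x [^] n"
  by (induction n) (auto simp: m_comm)

text \<open>For \<open>g\<close> in the group let \<open>X\<close> be the set of \<open>l\<close>-tuples over \<open>A\<close> whose product is \<open>g b\<^sup>-\<^sup>1\<close> for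
  some \<open>b \<in> B\<close>. All entries but the first can be chosen freely, and then the factorization determines the
  first one, so \<open>X\<close> has \<open>|A| ^ (l - 1)\<close> elements, a number that \<open>l\<close> does not divide. Rotation acts on
  \<open>X\<close> because the group is commutative; it must have a fixed point, that is, a constant tuple, and this
  writes \<open>g\<close> as an \<open>l\<close>-th power of an element of \<open>A\<close> times an element of \<open>B\<close>.\<close>

lemma factorization_prime_power:
  assumes fin: "finite (carrier G)" and f: "factorization G A B"
    and l: "prime l" "\<not> l dvd card A"
  shows "factorization G ((\<lambda>a. a [^] l) ` A) B"
proof -
  have sub: "A \<subseteq> carrier G" "B \<subseteq> carrier G" using f unfolding factorization_def by auto
  have finA: "finite A" using fin sub finite_subset by blast
  obtain k where k: "l = Suc k" using l(1) by (metis not0_implies_Suc not_prime_0)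
  have surj: "\<exists>a\<in>A. \<exists>b\<in>B. a [^] l \<otimes> b = g" if g: "g \<in> carrier G" for g
  proof -
    define X where "X = {xs. set xs \<subseteq> A \<and> length xs = l \<and> (\<exists>b\<in>B. foldr (\<otimes>) xs \<one> \<otimes> b = g)}"
    have XL: "X \<subseteq> {xs. set xs \<subseteq> A \<and> length xs = l}" unfolding X_def by auto
    have finX: "finite X" using finite_subset[OF XL] finite_lists_length_eq[OF finA] by blast
    have "bij_betw tl X {ys. set ys \<subseteq> A \<and> length ys = k}"
    proof (rule bij_betw_imageI)
      show "inj_on tl X"
      proof (rule inj_onI)
        fix xs ys assume xy: "xs \<in> X" "ys \<in> X" "tl xs = tl ys"
        obtain x zs where xs: "xs = x # zs" using xy(1) k unfolding X_def by (cases xs) auto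
        obtain y where ys: "ys = y # zs" using xy xs k unfolding X_def by (cases ys) auto
        obtain b where b: "b \<in> B" "foldr (\<otimes>) xs \<one> \<otimes> b = g" using xy(1) unfolding X_def by auto
        obtain c where c: "c \<in> B" "foldr (\<otimes>) ys \<one> \<otimes> c = g" using xy(2) unfolding X_def by auto
        have in_A: "x \<in> A" "y \<in> A" "set zs \<subseteq> A" using xy xs ys unfolding X_def by auto
        define P where "P = foldr (\<otimes>) zs \<one>"
        have P: "P \<in> carrier G" unfolding P_def using foldr_mult_closed in_A(3) sub by blast
        have "P \<otimes> (x \<otimes> b) = P \<otimes> (y \<otimes> c)"
          using b c in_A P sub unfolding xs ys P_def by (auto simp: m_assoc m_lcomm subset_iff)
        then have "x \<otimes> b = y \<otimes> c" 
          using Units_l_cancel[of P "x \<otimes> b" "y \<otimes> c"] P in_A b c sub by auto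
        then show "xs = ys" using factorization_unique[OF f in_A(1,2) b(1) c(1)] xs ys by simp
      qed
      show "tl ` X = {ys. set ys \<subseteq> A \<and> length ys = k}"
      proof (intro equalityI subsetI)
        fix ys assume "ys \<in> tl ` X"
        then show "ys \<in> {ys. set ys \<subseteq> A \<and> length ys = k}"
          using k unfolding X_def by (auto dest: list.set_sel(2)[rotated])
      next
        fix ys assume ys: "ys \<in> {ys. set ys \<subseteq> A \<and> length ys = k}"
        define P where "P = foldr (\<otimes>) ys \<one>"
        have P: "P \<in> carrier G" unfolding P_def using foldr_mult_closed ys sub by blast
        obtain a b where ab: "a \<in> A" "b \<in> B" "a \<otimes> b = inv P \<otimes> g"
          using factorization_exists[OF f, of "inv P \<otimes> g"] P g by auto
        have "a \<otimes> P \<otimes> b = P \<otimes> (a \<otimes> b)" using ab P sub by (auto simp: m_assoc m_lcomm subset_iff)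
        also have "\<dots> = g" unfolding ab(3) using P g by (simp add: m_assoc[symmetric])
        finally have "a # ys \<in> X" unfolding X_def using ab ys k unfolding P_def by auto
        then show "ys \<in> tl ` X" by (metis image_eqI list.sel(3))
      qed
    qed
    then have cardX: "card X = card A ^ k"
      using bij_betw_same_card card_lists_length_eq[OF finA] by metis
    have "[card X = card {xs \<in> X. rotate1 xs = xs}] (mod l)"
    proof (rule card_cong_card_fixpoints[OF l(1) finX])
      show "rotate1 ` X \<subseteq> X"
        unfolding X_def using sub by (auto simp: foldr_mult_rotate1)
      show "(rotate1 ^^ l) xs = xs" if "xs \<in> X" for xs
        using that rotate_id[of l xs] unfolding X_def rotate_def by simp
    qed
    moreover have "\<not> l dvd card X" unfolding cardX using l prime_dvd_power by blast
    ultimately have "{xs \<in> X. rotate1 xs = xs} \<noteq> {}"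
      by (metis card.empty cong_0_iff)
    then obtain xs where xs: "xs \<in> X" "rotate1 xs = xs" by auto
    then have rep: "xs = replicate l (hd xs)" and "hd xs \<in> A"
      using rotate1_fix_imp_replicate[of xs l] k unfolding X_def by (cases xs; auto)+
    moreover have "foldr (\<otimes>) xs \<one> = hd xs [^] l"
      using calculation sub foldr_mult_replicate by (metis subsetD)
    ultimately show ?thesis using xs(1) unfolding X_def by auto
  qed
  show ?thesis
  proof (rule factorizationI_surj)
    have "card ((\<lambda>a. a [^] l) ` A) \<le> card A" by (rule card_image_le[OF finA])
    then show "card ((\<lambda>a. a [^] l) ` A) * card B \<le> order G"
      using factorization_card[OF f] by (metis mult_le_mono1)
  qed (use sub surj fin in \<open>auto simp: monoid_axioms\<close>)
qed

text \<open>The prime factors of \<open>m\<close> are treated one by one. The induction can continue because the order of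
  the first factor does not change.\<close>

lemma factorization_coprime_power:
  assumes "finite (carrier G)" "factorization G A B" "coprime m (card A)" "m > 0"
  shows "factorization G ((\<lambda>a. a [^] m) ` A) B"
  using assms(2-4)
proof (induction m arbitrary: A rule: less_induct)
  case (less m)
  have sub: "A \<subseteq> carrier G" using less.prems(1) unfolding factorization_def by auto
  show ?case
  proof (cases "m = 1")
    case True
    then have "(\<lambda>a. a [^] m) ` A = A" using sub by (force simp: image_iff)
    then show ?thesis using less.prems by simp
  next
    case False
    then obtain l n where l: "prime l" "m = l * n" by (metis prime_factor_nat dvdE)
    have n: "n > 0" "n < m" using l less.prems(3) prime_gt_1_nat[OF l(1)] by auto
    define A' where "A' = (\<lambda>a. a [^] l) ` A"
    have "\<not> l dvd card A"
      using less.prems(2) l by (metis coprime_mult_left_iff coprime_absorb_left not_prime_unit)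
    then have f': "factorization G A' B"
      unfolding A'_def using factorization_prime_power[OF assms(1) less.prems(1) l(1)] by blast
    have "order G > 0" using assms(1) order_gt_0_iff_finite by blast
    then have "card A' = card A"
      using factorization_card[OF f'] factorization_card[OF less.prems(1)]
      by (metis mult_cancel2 mult_is_0 not_gr_zero)
    then have "factorization G ((\<lambda>a. a [^] n) ` A') B"
      using less.IH[OF n(2) f'] less.prems(2) l n by simp
    moreover have "(\<lambda>a. a [^] n) ` A' = (\<lambda>a. a [^] m) ` A"
      unfolding A'_def l(2) image_image using sub by (intro image_cong) (auto simp: nat_pow_pow)
    ultimately show ?thesis by simp
  qed
qed

text \<open>Both factors are replaced by powers. As their orders are unchanged, the two power maps are
  injective on them, which carries uniqueness back to the original factors.\<close>

lemma factorization_powers_unique: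
  assumes fin: "finite (carrier G)" and f: "factorization G A B"
    and cop: "coprime m (card A)" "m > 0" "coprime n (card B)" "n > 0"
    and el: "a \<in> A" "a' \<in> A" "b \<in> B" "b' \<in> B"
    and eq: "a [^] m \<otimes> b [^] n = a' [^] m \<otimes> b' [^] n"
  shows "a = a' \<and> b = b'"
proof -
  have ord: "order G > 0" using fin order_gt_0_iff_finite by blast
  have fA: "factorization G ((\<lambda>a. a [^] m) ` A) B"
    by (rule factorization_coprime_power[OF fin f cop(1,2)])
  have fB: "factorization G ((\<lambda>b. b [^] n) ` B) ((\<lambda>a. a [^] m) ` A)"
    by (rule factorization_coprime_power[OF fin factorization_commute[OF fA] cop(3,4)])
  have cA: "card ((\<lambda>a. a [^] m) ` A) = card A"
    using factorization_card[OF f] factorization_card[OF fA] ord by (metis mult_cancel2 mult_is_0 not_gr_zero)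
  have cB: "card ((\<lambda>b. b [^] n) ` B) = card B"
    using factorization_card[OF f] factorization_card[OF fB] cA ord
    by (metis mult.commute mult_cancel2 mult_is_0 not_gr_zero)
  have "finite A" "finite B" using f fin unfolding factorization_def by (auto intro: finite_subset)
  then have inj: "inj_on (\<lambda>a. a [^] m) A" "inj_on (\<lambda>b. b [^] n) B"
    using cA cB by (auto intro: eq_card_imp_inj_on)
  have "a [^] m = a' [^] m \<and> b [^] n = b' [^] n"
    using factorization_unique[OF factorization_commute[OF fB]] el eq by blast
  then show ?thesis using inj el by (metis inj_onD)
qed

end

section \<open>Perfect codes and generating sets in Cayley digraphs\<close>

text \<open>The closed out-neighbourhood of \<open>c\<close> is the translate of \<open>S \<union> {1}\<close> by \<open>c\<close>.\<close>

lemma perfect_code_iff_factorization: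
  fixes G (structure)
  assumes "group G" "S \<subseteq> carrier G" "C \<subseteq> carrier G"
  shows "perfect_code (with_proj (cayley_digraph G S)) C \<longleftrightarrow> factorization G (insert \<one> S) C"
proof -
  interpret group G by fact
  define N where "N = closed_out_neighbourhood (with_proj (cayley_digraph G S))"
  have N: "N c = (\<lambda>s. s \<otimes> c) ` insert \<one> S" if c: "c \<in> carrier G" for c
  proof -
    have "v \<in> (\<lambda>s. s \<otimes> c) ` S" if "v \<in> carrier G" "v \<otimes> inv c \<in> S" for v
      using that c by (intro image_eqI[of _ _ "v \<otimes> inv c"]) (auto simp: m_assoc)
    moreover have "s \<otimes> c \<in> carrier G \<and> s \<otimes> c \<otimes> inv c \<in> S" if "s \<in> S" for s
      using that c assms(2) by (auto simp: m_assoc)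
    ultimately show ?thesis
      using c unfolding N_def closed_out_neighbourhood_def by (auto simp: cayley_digraph_def)
  qed
  have "perfect_code (with_proj (cayley_digraph G S)) C \<longleftrightarrow>
      disjoint_family_on N C \<and> (\<Union>c\<in>C. N c) = carrier G"
    unfolding perfect_code_def N_def using assms(3) by (simp add: cayley_digraph_def)
  also have "(\<Union>c\<in>C. N c) = (\<lambda>(s, c). s \<otimes> c) ` (insert \<one> S \<times> C)"
  proof -
    have "(\<Union>c\<in>C. N c) = (\<Union>c\<in>C. (\<lambda>s. s \<otimes> c) ` insert \<one> S)" using N assms(3) by (intro SUP_cong) auto
    also have "(\<Union>c\<in>C. (\<lambda>s. h s c) ` A) = (\<lambda>(s, c). h s c) ` (A \<times> C)" for h :: "'a \<Rightarrow> 'a \<Rightarrow> 'a" and A by force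
    finally show ?thesis .
  qed
  also have "disjoint_family_on N C \<longleftrightarrow> inj_on (\<lambda>(s, c). s \<otimes> c) (insert \<one> S \<times> C)"
  proof
    assume dis: "disjoint_family_on N C"
    show "inj_on (\<lambda>(s, c). s \<otimes> c) (insert \<one> S \<times> C)"
    proof (rule inj_onI, clarify)
      fix s c s' c' assume el: "s \<in> insert \<one> S" "c \<in> C" "s' \<in> insert \<one> S" "c' \<in> C" and eq: "s \<otimes> c = s' \<otimes> c'"
      have car: "s \<in> carrier G" "s' \<in> carrier G" "c \<in> carrier G" "c' \<in> carrier G" using el assms by auto
      have "s \<otimes> c \<in> N c" unfolding N[OF car(3)] using el(1) by (rule imageI)
      moreover have "s \<otimes> c \<in> N c'" unfolding N[OF car(4)] eq using el(3) by (rule imageI)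
      ultimately have "s \<otimes> c \<in> N c \<inter> N c'" by blast
      then have "c = c'" using dis el(2,4) unfolding disjoint_family_on_def by blast
      then show "s = s' \<and> c = c'" using eq car by simp
    qed
  next
    assume inj: "inj_on (\<lambda>(s, c). s \<otimes> c) (insert \<one> S \<times> C)"
    show "disjoint_family_on N C"
      unfolding disjoint_family_on_def
    proof (intro ballI impI equals0I)
      fix c c' x assume c: "c \<in> C" "c' \<in> C" "c \<noteq> c'" and x: "x \<in> N c \<inter> N c'"
      have car: "c \<in> carrier G" "c' \<in> carrier G" using c assms(3) by auto
      from x obtain s s' where s: "s \<in> insert \<one> S" "s' \<in> insert \<one> S" "x = s \<otimes> c" "x = s' \<otimes> c'"
        unfolding N[OF car(1)] N[OF car(2)] by blast
      show False using inj_onD[OF inj, of "(s, c)" "(s', c')"] s c by auto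
    qed
  qed
  finally show ?thesis
    using assms(2,3) unfolding factorization_def bij_betw_def by auto
qed

text \<open>The elements on which \<open>f\<close> vanishes modulo \<open>n\<close> form a subgroup, and it is proper because of \<open>g\<close>.\<close>

lemma generating_set_not_in_kernel:
  fixes f :: "'a \<Rightarrow> int" and G (structure)
  assumes "group G" "S \<subseteq> carrier G" "generate G S = carrier G"
    and hom: "\<And>a b. a \<in> carrier G \<Longrightarrow> b \<in> carrier G \<Longrightarrow> [f (a \<otimes> b) = f a + f b] (mod n)"
    and g: "g \<in> carrier G" "\<not> n dvd f g"
  shows "\<exists>s\<in>S. \<not> n dvd f s"
proof (rule ccontr)
  assume neg: "\<not> (\<exists>s\<in>S. \<not> n dvd f s)"
  interpret group G by fact
  have one: "n dvd f \<one>" using hom[of \<one> \<one>] by (simp add: cong_iff_dvd_diff)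
  have hom': "n dvd f (a \<otimes> b) \<longleftrightarrow> n dvd f a + f b" if "a \<in> carrier G" "b \<in> carrier G" for a b
    using hom[OF that] cong_dvd_iff by blast
  have "subgroup {a \<in> carrier G. n dvd f a} G"
  proof (rule subgroupI)
    fix a assume "a \<in> {a \<in> carrier G. n dvd f a}"
    then show "inv a \<in> {a \<in> carrier G. n dvd f a}"
      using hom'[of a "inv a"] one by (simp add: dvd_add_right_iff)
  qed (use one hom' in auto)
  then have "generate G S \<subseteq> {a \<in> carrier G. n dvd f a}"
    by (rule generate_subgroup_incl[rotated]) (use neg assms(2) in auto)
  then show False using g assms(3) by auto
qed


section \<open>Arithmetic in the group of order p^2 q r\<close>

lemma exists_multiplier_mod_prime:
  fixes s d e :: int
  assumes "prime s" "s dvd e \<Longrightarrow> s dvd d"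
  shows "\<exists>v. [v * e = d] (mod s)"
proof (cases "s dvd e")
  case True
  then show ?thesis using assms(2) by (intro exI[of _ 0]) (auto simp: cong_def)
next
  case False
  then have "coprime e s" using assms(1) by (metis coprime_commute prime_imp_coprime)
  then obtain v where "[e * v = 1] (mod s)" using cong_solve_coprime_int by auto
  then have "[(d * v) * e = d] (mod s)"
    by (metis cong_scalar_left mult.assoc mult.commute mult.right_neutral)
  then show ?thesis by blast
qed

text \<open>The units modulo \<open>p\<^sup>2\<close> act transitively on the elements of each additive order; these orders are
  distinguished by divisibility by \<open>p\<close> and by \<open>p\<^sup>2\<close>.\<close>

lemma exists_unit_multiplier_mod_prime_square:
  fixes p d e :: int
  assumes p: "prime p" and 1: "p dvd d \<longleftrightarrow> p dvd e" and 2: "p\<^sup>2 dvd d \<longleftrightarrow> p\<^sup>2 dvd e"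
  shows "\<exists>u. \<not> p dvd u \<and> [u * d = e] (mod p\<^sup>2)"
proof (cases "p dvd d")
  case False
  then have "coprime d (p\<^sup>2)" using p by (metis coprime_commute coprime_power_left_iff prime_imp_coprime)
  then obtain v where "[d * v = 1] (mod p\<^sup>2)" using cong_solve_coprime_int by blast
  then have *: "[(e * v) * d = e] (mod p\<^sup>2)"
    by (metis cong_scalar_left mult.assoc mult.commute mult.right_neutral)
  then have "[(e * v) * d = e] (mod p)" by (rule cong_dvd_modulus) (simp add: power2_eq_square)
  then have "\<not> p dvd e * v" using False 1 by (metis cong_dvd_iff dvd_mult2)
  then show ?thesis using * by blast
next
  case True
  show ?thesis
  proof (cases "p\<^sup>2 dvd d")
    case True
    then have "[1 * d = e] (mod p\<^sup>2)" using 2 by (simp add: cong_def mod_eq_0_iff_dvd[THEN iffD2])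
    then show ?thesis using p not_prime_unit by blast
  next
    case False
    obtain d' e' where de: "d = p * d'" "e = p * e'" using True 1 by (auto elim!: dvdE)
    have p0: "p \<noteq> 0" using p by auto
    have nd: "\<not> p dvd d'" "\<not> p dvd e'" using False 2 p0 unfolding de power2_eq_square by auto
    have "coprime d' p" using p nd(1) by (metis coprime_commute prime_imp_coprime)
    then obtain v where "[d' * v = 1] (mod p)" using cong_solve_coprime_int by auto
    then have *: "[(e' * v) * d' = e'] (mod p)"
      by (metis cong_scalar_left mult.assoc mult.commute mult.right_neutral)
    then have "\<not> p dvd e' * v" using nd by (metis cong_dvd_iff dvd_mult2)
    moreover have "[(e' * v) * d = e] (mod p\<^sup>2)"
      using * p0 unfolding de power2_eq_square cong_iff_dvd_diff
      by (simp add: mult.left_commute[of _ p] flip: right_diff_distrib)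
    ultimately show ?thesis by blast
  qed
qed

lemma carrier_Zppqr:
  assumes "p > 0" "q > 0" "r > 0"
  shows "carrier (Zppqr p q r) = {0..<int (p\<^sup>2)} \<times> {0..<int q} \<times> {0..<int r}"
  using assms by (simp add: Zppqr_def carrier_integer_mod_group)

lemma one_Zppqr [simp]: "\<one>\<^bsub>Zppqr p q r\<^esub> = (0, 0, 0)"
  by (simp add: Zppqr_def)

lemma comm_group_Zppqr: "comm_group (Zppqr p q r)"
proof -
  have "group (Zppqr p q r)" unfolding Zppqr_def by (intro DirProd_group group_integer_mod_group)
  then show ?thesis
    by (rule group.group_comm_groupI) (auto simp: Zppqr_def add.commute)
qed

lemma mult_elt: "elt p q r x y z \<otimes>\<^bsub>Zppqr p q r\<^esub> elt p q r x' y' z' = elt p q r (x + x') (y + y') (z + z')"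
  by (simp add: Zppqr_def elt_def mod_add_eq)

lemma mult_Zppqr: "a \<otimes>\<^bsub>Zppqr p q r\<^esub> b = elt p q r (fst a + fst b) (fst (snd a) + fst (snd b)) (snd (snd a) + snd (snd b))"
  by (simp add: Zppqr_def elt_def mult_DirProd')

lemma pow_Zppqr: "a [^]\<^bsub>Zppqr p q r\<^esub> m = elt p q r (int m * fst a) (int m * fst (snd a)) (int m * snd (snd a))"
proof (induction m)
  case 0
  then show ?case by (simp add: elt_def)
next
  case (Suc m)
  then show ?case by (simp add: mult_Zppqr elt_def mod_simps algebra_simps)
qed

lemma elt_eq_iff:
  "elt p q r x y z = elt p q r x' y' z' \<longleftrightarrow>
     [x = x'] (mod int (p\<^sup>2)) \<and> [y = y'] (mod int q) \<and> [z = z'] (mod int r)"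
  by (simp add: elt_def cong_def)

lemma elt_in_carrier:
  "p > 0 \<Longrightarrow> q > 0 \<Longrightarrow> r > 0 \<Longrightarrow> elt p q r x y z \<in> carrier (Zppqr p q r)"
  by (simp add: carrier_Zppqr elt_def)

lemma order_Zppqr: "p > 0 \<Longrightarrow> q > 0 \<Longrightarrow> r > 0 \<Longrightarrow> order (Zppqr p q r) = p\<^sup>2 * q * r"
  by (simp add: order_def carrier_Zppqr card_cartesian_product nat_power_eq)

locale distinct_primes =
  fixes p q r :: nat
  assumes primes: "prime p" "prime q" "prime r"
    and distinct: "p \<noteq> q" "p \<noteq> r" "q \<noteq> r"
begin

abbreviation G where "G \<equiv> Zppqr p q r"

lemma pos: "p > 0" "q > 0" "r > 0"
  using primes prime_gt_0_nat by auto

lemma coprimes: "coprime p q" "coprime p r" "coprime q r"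
  using primes distinct primes_coprime by auto

lemma finite_carrier: "finite (carrier G)"
  using pos by (simp add: carrier_Zppqr)

text \<open>The solution is taken positive because it is going to be the exponent of a power map.\<close>

lemma chinese_remainder_pqr:
  assumes "coprime m1 q" "coprime m1 r" "m1 > 0"
  shows "\<exists>x::nat. x > 0 \<and> [int x = u] (mod int m1) \<and> [int x = v] (mod int q) \<and> [int x = w] (mod int r)"
proof -
  have "coprime (int q) (int r)" using coprimes by simp
  then obtain y where y: "[y = v] (mod int q)" "[y = w] (mod int r)" using binary_chinese_remainder_int by blast
  have "coprime (int m1) (int (q * r))" using assms by simp
  then obtain x where x: "[x = u] (mod int m1)" "[x = y] (mod int (q * r))" using binary_chinese_remainder_int by blast
  define N where "N = int (m1 * q * r)"
  have N: "N > 0" unfolding N_def using assms pos by simp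
  define n where "n = nat (x mod N + N)"
  have n0: "x mod N + N > 0" using N by (simp add: add_nonneg_pos)
  have "[int n = x] (mod N)" unfolding n_def using n0 by (simp add: cong_def)
  then have "[int n = x] (mod int m1)" "[int n = x] (mod int (q * r))"
    by (rule cong_dvd_modulus; simp add: N_def)+
  then have 1: "[int n = u] (mod int m1)" and 2: "[int n = y] (mod int (q * r))" using x cong_trans by blast+
  have "[int n = y] (mod int q)" "[int n = y] (mod int r)" using 2 by (rule cong_dvd_modulus; simp)+
  then have "[int n = v] (mod int q)" "[int n = w] (mod int r)" using y cong_trans by blast+
  moreover have "n > 0" unfolding n_def using n0 by simp
  ultimately show ?thesis using 1 by blast
qed

lemma prime_square_not_dvd:
  assumes "s = q \<or> s = r"
  shows "\<not> s\<^sup>2 dvd p\<^sup>2 * q * r"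
proof
  assume h: "s\<^sup>2 dvd p\<^sup>2 * q * r"
  have "coprime (s\<^sup>2) (p\<^sup>2)" using assms coprimes by (auto simp: coprime_commute)
  then have "s\<^sup>2 dvd q * r" using h by (metis coprime_dvd_mult_right_iff mult.assoc)
  then have "s dvd (if s = q then r else q)"
    using assms pos by (auto simp: power2_eq_square)
  then show False using assms primes distinct by (auto simp: primes_dvd_imp_eq split: if_splits)
qed

text \<open>A condition under which two differences \<open>d = a - a'\<close> and \<open>e = b - b'\<close> have equal multiples \<open>m d = n e\<close>
  with \<open>m\<close> coprime to \<open>|A|\<close> and \<open>n\<close> coprime to \<open>|B|\<close>, so that both must be zero. In the component of
  order \<open>p\<^sup>2\<close> it asks for equal orders, since there the multipliers have to be units. Each of \<open>q\<close> and
  \<open>r\<close> divides exactly one of \<open>|A|\<close> and \<open>|B|\<close>. If \<open>q\<close> divides \<open>|A|\<close>, then \<open>m\<close> is a unit modulo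
  \<open>q\<close> but \<open>n\<close> is arbitrary there, so the component of \<open>e\<close> can be turned into that of \<open>d\<close> unless the
  former is zero and the latter is not.\<close>

lemma factorization_collision:
  assumes f: "factorization G A B"
    and el: "a \<in> A" "a' \<in> A" "b \<in> B" "b' \<in> B"
    and p1: "fst a mod p = fst a' mod p \<longleftrightarrow> fst b mod p = fst b' mod p"
    and p2: "fst a = fst a' \<longleftrightarrow> fst b = fst b'"
    and hq: "if q dvd card A then fst (snd b) = fst (snd b') \<longrightarrow> fst (snd a) = fst (snd a')
                             else fst (snd a) = fst (snd a') \<longrightarrow> fst (snd b) = fst (snd b')"
    and hr: "if r dvd card A then snd (snd b) = snd (snd b') \<longrightarrow> snd (snd a) = snd (snd a')
                             else snd (snd a) = snd (snd a') \<longrightarrow> snd (snd b) = snd (snd b')"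
  shows "a = a' \<and> b = b'"
proof -
  interpret comm_group G by (rule comm_group_Zppqr)
  have card: "card A * card B = p\<^sup>2 * q * r"
    using factorization_card[OF f] order_Zppqr pos by simp
  have car: "a \<in> carrier G" "a' \<in> carrier G" "b \<in> carrier G" "b' \<in> carrier G"
    using f el unfolding factorization_def by auto
  have eqv: "int s dvd x - y \<longleftrightarrow> x = y" if "0 \<le> x" "x < int s" "0 \<le> y" "y < int s" for s x y
    using that by (metis mod_eq_dvd_iff mod_pos_pos_trivial)
  define d1 d2 d3 e1 e2 e3 where
    d: "d1 = fst a - fst a'" "d2 = fst (snd a) - fst (snd a')" "d3 = snd (snd a) - snd (snd a')" and
    e: "e1 = fst b - fst b'" "e2 = fst (snd b) - fst (snd b')" "e3 = snd (snd b) - snd (snd b')"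
  have dvd1: "int (p\<^sup>2) dvd d1 \<longleftrightarrow> fst a = fst a'" "int (p\<^sup>2) dvd e1 \<longleftrightarrow> fst b = fst b'"
    and dvd2: "int q dvd d2 \<longleftrightarrow> fst (snd a) = fst (snd a')" "int q dvd e2 \<longleftrightarrow> fst (snd b) = fst (snd b')"
    and dvd3: "int r dvd d3 \<longleftrightarrow> snd (snd a) = snd (snd a')" "int r dvd e3 \<longleftrightarrow> snd (snd b) = snd (snd b')"
    unfolding d e using car pos by (intro eqv; auto simp: carrier_Zppqr)+
  have "\<exists>u. \<not> int p dvd u \<and> [u * d1 = e1] (mod (int p)\<^sup>2)"
  proof (rule exists_unit_multiplier_mod_prime_square)
    show "prime (int p)" using primes by simp
    show "int p dvd d1 \<longleftrightarrow> int p dvd e1" using p1 unfolding d e by (simp add: mod_eq_dvd_iff)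
    show "(int p)\<^sup>2 dvd d1 \<longleftrightarrow> (int p)\<^sup>2 dvd e1" using p2 dvd1 by simp
  qed
  then obtain u where u: "\<not> int p dvd u" "[u * d1 = e1] (mod int (p\<^sup>2))" by auto
  (* In a component of prime order one multiplier is 1 and the other one is adjusted. *)
  have side: "\<exists>v w. [v * d = w * e] (mod int s) \<and> (s dvd card A \<longrightarrow> v = 1) \<and> (\<not> s dvd card A \<longrightarrow> w = 1)"
    if s: "prime s" "s dvd card A \<Longrightarrow> int s dvd e \<Longrightarrow> int s dvd d"
      "\<not> s dvd card A \<Longrightarrow> int s dvd d \<Longrightarrow> int s dvd e" for s d e
  proof (cases "s dvd card A")
    case True
    then obtain w where "[w * e = d] (mod int s)"
      using exists_multiplier_mod_prime[of "int s" e d] s True by auto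
    then show ?thesis using True by (intro exI[of _ 1] exI[of _ w]) (auto simp: cong_sym)
  next
    case False
    then obtain v where "[v * d = e] (mod int s)"
      using exists_multiplier_mod_prime[of "int s" d e] s False by auto
    then show ?thesis using False by (intro exI[of _ v] exI[of _ 1]) auto
  qed
  obtain v2 w2 where 2: "[v2 * d2 = w2 * e2] (mod int q)" "q dvd card A \<Longrightarrow> v2 = 1" "\<not> q dvd card A \<Longrightarrow> w2 = 1"
    using side[OF primes(2), of e2 d2] hq dvd2 by auto
  obtain v3 w3 where 3: "[v3 * d3 = w3 * e3] (mod int r)" "r dvd card A \<Longrightarrow> v3 = 1" "\<not> r dvd card A \<Longrightarrow> w3 = 1"
    using side[OF primes(3), of e3 d3] hr dvd3 by auto
  have cpp: "coprime (p\<^sup>2) q" "coprime (p\<^sup>2) r" "p\<^sup>2 > 0" using coprimes pos by auto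
  obtain m where m: "m > 0" "[int m = u] (mod int (p\<^sup>2))" "[int m = v2] (mod int q)" "[int m = v3] (mod int r)"
    using chinese_remainder_pqr[OF cpp] by blast
  obtain n where n: "n > 0" "[int n = 1] (mod int (p\<^sup>2))" "[int n = w2] (mod int q)" "[int n = w3] (mod int r)"
    using chinese_remainder_pqr[OF cpp] by blast
  have not_both: "\<not> s dvd card B" if "s dvd card A" "s = q \<or> s = r" for s
    using prime_square_not_dvd[OF that(2)] mult_dvd_mono[OF that(1), of s "card B"] card by (auto simp: power2_eq_square)
  have unit: "\<not> s dvd x" if "[int x = 1] (mod int s)" "prime s" for s x
  proof
    assume "s dvd x"
    then have "int s dvd int x" by simp
    then have "int s dvd 1" using that(1) cong_dvd_iff by blast
    then show False using that(2) by simp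
  qed
  have modp: "[x = y] (mod int p)" if "[x = y] (mod int (p\<^sup>2))" for x y
    using that by (rule cong_dvd_modulus) (simp add: power2_eq_square)
  have pqr: "s \<in> {p, q, r}" if "prime s" "s dvd card A \<or> s dvd card B" for s
  proof -
    have "s dvd p\<^sup>2 * q * r" using that(2) card by (metis dvd_mult dvd_mult2)
    then show ?thesis using that(1) primes by (auto simp: prime_dvd_mult_iff prime_dvd_power_iff primes_dvd_imp_eq)
  qed
  have "coprime m (card A)"
  proof (rule ccontr)
    assume "\<not> coprime m (card A)"
    then obtain s where s: "prime s" "s dvd m" "s dvd card A"
      by (metis coprime_iff_gcd_eq_1 gcd_greatest_iff prime_factor_nat)
    have "\<not> p dvd m" using modp[OF m(2)] u(1) by (metis cong_dvd_iff int_dvd_int_iff)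
    then have "s = q \<or> s = r" using pqr s by auto
    then have "[int m = 1] (mod int s)" using m 2 3 s by auto
    then show False using unit s by blast
  qed
  moreover have "coprime n (card B)"
  proof (rule ccontr)
    assume "\<not> coprime n (card B)"
    then obtain s where s: "prime s" "s dvd n" "s dvd card B"
      by (metis coprime_iff_gcd_eq_1 gcd_greatest_iff prime_factor_nat)
    have "s = p \<or> s = q \<or> s = r" using pqr s by auto
    then have "[int n = 1] (mod int s)" using n 2 3 s not_both modp[OF n(2)] by auto
    then show False using unit s by blast
  qed
  moreover have "a [^]\<^bsub>G\<^esub> m \<otimes>\<^bsub>G\<^esub> b' [^]\<^bsub>G\<^esub> n = a' [^]\<^bsub>G\<^esub> m \<otimes>\<^bsub>G\<^esub> b [^]\<^bsub>G\<^esub> n"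
  proof -
    have "[int m * x + int n * y' = int m * x' + int n * y] (mod int s)"
      if "[int m = v] (mod int s)" "[int n = w] (mod int s)" "[v * (x - x') = w * (y - y')] (mod int s)"
      for s v w x x' y y'
    proof -
      have "[int m * (x - x') = v * (x - x')] (mod int s)" "[w * (y - y') = int n * (y - y')] (mod int s)"
        using that(1,2) by (auto intro: cong_scalar_right simp: cong_sym)
      then have "[int m * (x - x') = int n * (y - y')] (mod int s)" using that(3) cong_trans by blast
      then show ?thesis by (simp add: cong_iff_dvd_diff algebra_simps)
    qed
    from this[OF m(2) n(2), of "fst a" "fst a'" "fst b" "fst b'"] this[OF m(3) n(3)] this[OF m(4) n(4)]
    show ?thesis unfolding pow_Zppqr mult_elt elt_eq_iff using u 2 3 unfolding d e by simp
  qed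
  ultimately show ?thesis
    using factorization_powers_unique[OF finite_carrier f _ m(1) _ n(1) el(1,2,4,3)] by auto
qed

end

section \<open>The families of pairs\<close>

text \<open>The lists below follow one convention. Let \<open>P = {(i p, 0, 0)}\<close>. The order of \<open>A\<close> is the product in
  the name. In a name with \<open>cosets\<close> directly after this product, \<open>A\<close> is a union of cosets of \<open>P\<close> (after
  forgetting the coordinates that its fibres are not indexed by) and \<open>B\<close> consists of transversals;
  otherwise these roles are exchanged, and the name goes on to say what is special about \<open>B\<close>. A parameter
  that occurs in two coordinates is no restriction, as its residues modulo different primes are
  independent.\<close>

definition pair_p :: "nat \<Rightarrow> nat \<Rightarrow> nat \<Rightarrow> (int \<times> int \<times> int) set \<Rightarrow> (int \<times> int \<times> int) set \<Rightarrow> bool" where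
  "pair_p p q r A B \<longleftrightarrow> (\<exists>(\<alpha> :: nat \<Rightarrow> int). \<alpha> 0 = 0 \<and>
     A = {elt p q r (int i + \<alpha> i * int p) (\<alpha> i) (\<alpha> i) | i. i < p} \<and>
     B = {elt p q r (int i * int p) (int j) (int k) | i j k. i < p \<and> j < q \<and> k < r})"

text \<open>The third coordinate of \<open>A\<close> is constant on the cosets, which leaves the transversals in \<open>B\<close>
  unrestricted.\<close>

definition pair_pq_cosets_free_code :: "nat \<Rightarrow> nat \<Rightarrow> nat \<Rightarrow> (int \<times> int \<times> int) set \<Rightarrow> (int \<times> int \<times> int) set \<Rightarrow> bool" where
  "pair_pq_cosets_free_code p q r A B \<longleftrightarrow> (\<exists>(\<alpha> :: nat \<Rightarrow> int) (\<beta> :: nat \<Rightarrow> int) (l :: nat \<Rightarrow> nat \<Rightarrow> int). \<alpha> 0 = 0 \<and> \<beta> 0 = 0 \<and> l 0 0 = 0 \<and>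
     A = {elt p q r (\<alpha> i + int j * int p) (int i) (\<beta> i) | i j. i < q \<and> j < p} \<and>
     B = {elt p q r (int i + l i j * int p) 0 (int j) | i j. i < p \<and> j < r})"

text \<open>The second coordinate of \<open>B\<close> is arbitrary; the price is that the first and the third coordinate of
  \<open>A\<close> depend only on the class of the first one modulo \<open>p\<close>.\<close>

definition pair_pq_code_q_free :: "nat \<Rightarrow> nat \<Rightarrow> nat \<Rightarrow> (int \<times> int \<times> int) set \<Rightarrow> (int \<times> int \<times> int) set \<Rightarrow> bool" where
  "pair_pq_code_q_free p q r A B \<longleftrightarrow> (\<exists>(\<alpha> :: nat \<Rightarrow> int) (l :: nat \<Rightarrow> nat \<Rightarrow> int). \<alpha> 0 = 0 \<and> l 0 0 = 0 \<and>
     A = {elt p q r (int i + \<alpha> i * int p) (int j) (\<alpha> i) | i j. i < p \<and> j < q} \<and>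
     B = {elt p q r (int i * int p) (l i j) (int j) | i j. i < p \<and> j < r})"

text \<open>Here \<open>B\<close> may meet several cosets of \<open>P\<close>. In the six other families in which \<open>A\<close> has order \<open>p q\<close> either
  \<open>A\<close> is built from cosets, or the first coordinates of \<open>B\<close> fill \<open>P\<close> only.\<close>

definition pair_pq_code_cosets :: "nat \<Rightarrow> nat \<Rightarrow> nat \<Rightarrow> (int \<times> int \<times> int) set \<Rightarrow> (int \<times> int \<times> int) set \<Rightarrow> bool" where
  "pair_pq_code_cosets p q r A B \<longleftrightarrow> (\<exists>(\<alpha> :: nat \<Rightarrow> nat \<Rightarrow> int) (\<beta> :: nat \<Rightarrow> int) (l :: nat \<Rightarrow> int). \<alpha> 0 0 = 0 \<and> \<beta> 0 = 0 \<and> l 0 = 0 \<and>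
     A = {elt p q r (int j + \<alpha> i j * int p) (int i) (\<beta> i) | i j. i < q \<and> j < p} \<and>
     B = {elt p q r (l i + int j * int p) 0 (int i) | i j. i < r \<and> j < p})"

definition pair_pq_code_q_by_r :: "nat \<Rightarrow> nat \<Rightarrow> nat \<Rightarrow> (int \<times> int \<times> int) set \<Rightarrow> (int \<times> int \<times> int) set \<Rightarrow> bool" where
  "pair_pq_code_q_by_r p q r A B \<longleftrightarrow> (\<exists>(\<alpha> :: nat \<Rightarrow> nat \<Rightarrow> int) (\<beta> :: nat \<Rightarrow> int) (l :: nat \<Rightarrow> int). \<alpha> 0 0 = 0 \<and> \<beta> 0 = 0 \<and> l 0 = 0 \<and>
     A = {elt p q r (int i + \<alpha> i j * int p) (int j) (\<beta> i) | i j. i < p \<and> j < q} \<and>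
     B = {elt p q r (int j * int p) (l i) (int i) | i j. i < r \<and> j < p})"

definition pair_pq_code_q_by_P :: "nat \<Rightarrow> nat \<Rightarrow> nat \<Rightarrow> (int \<times> int \<times> int) set \<Rightarrow> (int \<times> int \<times> int) set \<Rightarrow> bool" where
  "pair_pq_code_q_by_P p q r A B \<longleftrightarrow> (\<exists>(\<alpha> :: nat \<Rightarrow> int) (\<beta> :: nat \<Rightarrow> nat \<Rightarrow> int) (l :: nat \<Rightarrow> int). \<alpha> 0 = 0 \<and> \<beta> 0 0 = 0 \<and> l 0 = 0 \<and>
     A = {elt p q r (int i + \<alpha> i * int p) (int j) (\<beta> i j) | i j. i < p \<and> j < q} \<and>
     B = {elt p q r (int i * int p) (l i) (int j) | i j. i < p \<and> j < r})"

text \<open>The third coordinate of \<open>A\<close> varies inside the cosets, and all transversals in \<open>B\<close> are translates of one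
  another by third coordinates.\<close>

definition pair_pq_cosets_free_set :: "nat \<Rightarrow> nat \<Rightarrow> nat \<Rightarrow> (int \<times> int \<times> int) set \<Rightarrow> (int \<times> int \<times> int) set \<Rightarrow> bool" where
  "pair_pq_cosets_free_set p q r A B \<longleftrightarrow> (\<exists>(\<alpha> :: nat \<Rightarrow> int) (\<beta> :: nat \<Rightarrow> nat \<Rightarrow> int) (l :: nat \<Rightarrow> int). \<alpha> 0 = 0 \<and> \<beta> 0 0 = 0 \<and> l 0 = 0 \<and>
     A = {elt p q r (\<alpha> i + int j * int p) (int i) (\<beta> i j) | i j. i < q \<and> j < p} \<and>
     B = {elt p q r (int i + l i * int p) 0 (int j) | i j. i < p \<and> j < r})"

text \<open>\<open>B\<close> is the subgroup of order \<open>p r\<close> and \<open>A\<close> is any transversal of it.\<close>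

definition pair_pq_code_subgroup :: "nat \<Rightarrow> nat \<Rightarrow> nat \<Rightarrow> (int \<times> int \<times> int) set \<Rightarrow> (int \<times> int \<times> int) set \<Rightarrow> bool" where
  "pair_pq_code_subgroup p q r A B \<longleftrightarrow> (\<exists>(\<alpha> :: nat \<Rightarrow> nat \<Rightarrow> int) (\<beta> :: nat \<Rightarrow> nat \<Rightarrow> int). \<alpha> 0 0 = 0 \<and> \<beta> 0 0 = 0 \<and>
     A = {elt p q r (int i + \<alpha> i j * int p) (int j) (\<beta> i j) | i j. i < p \<and> j < q} \<and>
     B = {elt p q r (int i * int p) 0 (int j) | i j. i < p \<and> j < r})"

definition pair_pqr_cosets :: "nat \<Rightarrow> nat \<Rightarrow> nat \<Rightarrow> (int \<times> int \<times> int) set \<Rightarrow> (int \<times> int \<times> int) set \<Rightarrow> bool" where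
  "pair_pqr_cosets p q r A B \<longleftrightarrow> (\<exists>(\<alpha> :: nat \<Rightarrow> nat \<Rightarrow> int) (l :: nat \<Rightarrow> int). \<alpha> 0 0 = 0 \<and> l 0 = 0 \<and>
     A = {elt p q r (\<alpha> i j + int k * int p) (int i) (int j) | i j k. i < q \<and> j < r \<and> k < p} \<and>
     B = {elt p q r (int i + l i * int p) 0 0 | i. i < p})"

definition pair_pqr_code_q :: "nat \<Rightarrow> nat \<Rightarrow> nat \<Rightarrow> (int \<times> int \<times> int) set \<Rightarrow> (int \<times> int \<times> int) set \<Rightarrow> bool" where
  "pair_pqr_code_q p q r A B \<longleftrightarrow> (\<exists>(\<alpha> :: nat \<Rightarrow> nat \<Rightarrow> int) (l :: nat \<Rightarrow> int). \<alpha> 0 0 = 0 \<and> l 0 = 0 \<and>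
     A = {elt p q r (int i + \<alpha> i j * int p) (int k) (int j) | i j k. i < p \<and> j < r \<and> k < q} \<and>
     B = {elt p q r (int i * int p) (l i) 0 | i. i < p})"

definition pair_pqr_cosets_code_q :: "nat \<Rightarrow> nat \<Rightarrow> nat \<Rightarrow> (int \<times> int \<times> int) set \<Rightarrow> (int \<times> int \<times> int) set \<Rightarrow> bool" where
  "pair_pqr_cosets_code_q p q r A B \<longleftrightarrow> (\<exists>(\<alpha> :: nat \<Rightarrow> int) (l :: nat \<Rightarrow> int). \<alpha> 0 = 0 \<and> l 0 = 0 \<and>
     A = {elt p q r (\<alpha> i + int j * int p) (int k) (int i) | i j k. i < r \<and> j < p \<and> k < q} \<and>
     B = {elt p q r (int i + l i * int p) (l i) 0 | i. i < p})"

definition pair_pqr_code_qr :: "nat \<Rightarrow> nat \<Rightarrow> nat \<Rightarrow> (int \<times> int \<times> int) set \<Rightarrow> (int \<times> int \<times> int) set \<Rightarrow> bool" where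
  "pair_pqr_code_qr p q r A B \<longleftrightarrow> (\<exists>(\<alpha> :: nat \<Rightarrow> int) (l :: nat \<Rightarrow> int). \<alpha> 0 = 0 \<and> l 0 = 0 \<and>
     A = {elt p q r (int i + \<alpha> i * int p) (int j) (int k) | i j k. i < p \<and> j < q \<and> k < r} \<and>
     B = {elt p q r (int i * int p) (l i) (l i) | i. i < p})"

text \<open>\<open>B\<close> is the subgroup \<open>P\<close> and \<open>A\<close> is any transversal of it.\<close>

definition pair_pqr_code_subgroup :: "nat \<Rightarrow> nat \<Rightarrow> nat \<Rightarrow> (int \<times> int \<times> int) set \<Rightarrow> (int \<times> int \<times> int) set \<Rightarrow> bool" where
  "pair_pqr_code_subgroup p q r A B \<longleftrightarrow> (\<exists>(\<alpha> :: nat \<Rightarrow> nat \<Rightarrow> nat \<Rightarrow> int). \<alpha> 0 0 0 = 0 \<and>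
     A = {elt p q r (int i + \<alpha> i j k * int p) (int j) (int k) | i j k. i < p \<and> j < q \<and> k < r} \<and>
     B = {elt p q r (int i * int p) 0 0 | i. i < p})"


section \<open>Every listed pair is a factorization\<close>

lemma family_eq_image:
  "{F i | i. i < l} = F ` {..<l}"
  "{F' i j | i j. i < l \<and> j < m} = (\<lambda>(i, j). F' i j) ` ({..<l} \<times> {..<m})"
  "{F'' i j k | i j k. i < l \<and> j < m \<and> k < n} = (\<lambda>(i, j, k). F'' i j k) ` ({..<l} \<times> {..<m} \<times> {..<n})"
  for l m n :: nat
  by (auto simp: image_iff Bex_def, blast)

context distinct_primes begin

text \<open>Together the index sets have as many elements as the group, so it is enough that the pair of
  indices can be recovered from the sum.\<close>

lemma factorization_parametrized:
  fixes I :: "'i set" and J :: "'j set"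
  assumes fin: "finite I" "finite J" and card: "card I * card J = p\<^sup>2 * q * r"
    and A: "A = (\<lambda>i. elt p q r (x i) (y i) (z i)) ` I"
    and B: "B = (\<lambda>j. elt p q r (x' j) (y' j) (z' j)) ` J"
    and inj: "\<And>i i' j j'. i \<in> I \<Longrightarrow> i' \<in> I \<Longrightarrow> j \<in> J \<Longrightarrow> j' \<in> J \<Longrightarrow>
      int (p\<^sup>2) dvd x i + x' j - (x i' + x' j') \<Longrightarrow> int q dvd y i + y' j - (y i' + y' j') \<Longrightarrow>
      int r dvd z i + z' j - (z i' + z' j') \<Longrightarrow> i = i' \<and> j = j'"
  shows "factorization G A B"
proof -
  interpret comm_group G by (rule comm_group_Zppqr)
  define h where "h = (\<lambda>(i, j). elt p q r (x i + x' j) (y i + y' j) (z i + z' j))"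
  have "inj_on h (I \<times> J)"
    unfolding inj_on_def h_def using inj by (auto simp: elt_eq_iff cong_iff_dvd_diff)
  then have "card (h ` (I \<times> J)) = order G"
    using card pos by (simp add: card_image card_cartesian_product order_Zppqr)
  moreover have "h ` (I \<times> J) \<subseteq> carrier G" using pos unfolding h_def by (auto simp: elt_in_carrier)
  ultimately have img: "h ` (I \<times> J) = carrier G"
    using finite_carrier unfolding order_def by (metis card_subset_eq)
  show ?thesis
  proof (rule factorizationI_surj)
    show "card A * card B \<le> order G"
      unfolding A B order_Zppqr[OF pos] card[symmetric]
      by (intro mult_le_mono card_image_le fin)
    fix g assume "g \<in> carrier G"
    then have "g \<in> h ` (I \<times> J)" using img by simp
    then obtain i j where "i \<in> I" "j \<in> J" "g = h (i, j)" by auto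
    then have "elt p q r (x i) (y i) (z i) \<in> A" "elt p q r (x' j) (y' j) (z' j) \<in> B"
      "elt p q r (x i) (y i) (z i) \<otimes>\<^bsub>G\<^esub> elt p q r (x' j) (y' j) (z' j) = g"
      unfolding A B h_def by (auto simp: mult_elt)
    then show "\<exists>a\<in>A. \<exists>b\<in>B. a \<otimes>\<^bsub>G\<^esub> b = g" by blast
  qed (use finite_carrier pos in \<open>auto simp: A B elt_in_carrier monoid_axioms\<close>)
qed

lemma residues_eqI:
  assumes "int n dvd int i - int i'" "i < n" "i' < n"
  shows "i = i'"
  using assms by (metis mod_eq_dvd_iff mod_less of_nat_eq_iff zmod_int)

text \<open>The base \<open>p\<close> digits of an element of the component of order \<open>p\<^sup>2\<close> are compared one after the other,
  first modulo \<open>p\<close>; contributions of the parameters \<open>t\<close> are multiples of \<open>p\<close>.\<close>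

lemma low_digits_eqI:
  assumes "int (p\<^sup>2) dvd D" "D = int i - int i' + t * int p" "i < p" "i' < p"
  shows "i = i'"
proof (rule residues_eqI[of p])
  have "int p dvd D" using assms(1) by (rule dvd_trans[rotated]) (simp add: power2_eq_square)
  then show "int p dvd int i - int i'" unfolding assms(2) by (simp add: dvd_add_times_triv_right_iff)
qed (use assms in auto)

lemma high_digits_eqI:
  assumes "int (p\<^sup>2) dvd D" "D = (int i - int i') * int p" "i < p" "i' < p"
  shows "i = i'"
proof (rule residues_eqI[of p])
  show "int p dvd int i - int i'" using assms(1) pos unfolding assms(2) by (simp add: power2_eq_square)
qed (use assms in auto)

text \<open>In each of the thirteen cases the indices are determined in an order in which the next congruence has
  only one unknown left. The multiple of \<open>p\<close> that is passed to \<open>low_digits_eqI\<close> collects all terms that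
  vanish modulo \<open>p\<close>.\<close>

lemma factorization_pair_p:
  assumes "pair_p p q r A B"
  shows "factorization G A B"
proof -
  obtain \<alpha> where A: "A = {elt p q r (int i + \<alpha> i * int p) (\<alpha> i) (\<alpha> i) | i. i < p}"
    and B: "B = {elt p q r (int i * int p) (int j) (int k) | i j k. i < p \<and> j < q \<and> k < r}"
    using assms unfolding pair_p_def by blast
  show ?thesis
  proof (rule factorization_parametrized[where I = "{..<p}" and J = "{..<p} \<times> {..<q} \<times> {..<r}"
        and x = "\<lambda>i. int i + \<alpha> i * int p" and y = "\<lambda>i. \<alpha> i" and z = "\<lambda>i. \<alpha> i"
        and x' = "\<lambda>(s, t, u). int s * int p" and y' = "\<lambda>(s, t, u). int t" and z' = "\<lambda>(s, t, u). int u"], goal_cases)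
    case (6 ii ii' jj jj')
    obtain i i' s t u s' t' u' where idx: "ii = i" "ii' = i'" "jj = (s, t, u)" "jj' = (s', t', u')"
      by (metis surj_pair)
    note dp = 6(5)[unfolded idx prod.case] and dq = 6(6)[unfolded idx prod.case] and dr = 6(7)[unfolded idx prod.case]
    note bd = 6(1-4)[unfolded idx]
    have i: "i = i'"
      by (rule low_digits_eqI[OF dp, of _ _ "(\<alpha> i + int s) - (\<alpha> i' + int s')"]) (use bd in \<open>auto simp: algebra_simps\<close>)
    have s: "s = s'" by (rule high_digits_eqI[OF dp]) (use bd i in \<open>auto simp: algebra_simps\<close>)
    have t: "t = t'" by (rule residues_eqI[of q]) (use dq bd i s in auto)
    have u: "u = u'" by (rule residues_eqI[of r]) (use dr bd i s t in auto)
    show ?case unfolding idx using i s t u by simp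
  qed (simp_all add: A B family_eq_image case_prod_unfold power2_eq_square)
qed

lemma factorization_pair_pq_cosets_free_code:
  assumes "pair_pq_cosets_free_code p q r A B"
  shows "factorization G A B"
proof -
  obtain \<alpha> \<beta> l where A: "A = {elt p q r (\<alpha> i + int j * int p) (int i) (\<beta> i) | i j. i < q \<and> j < p}"
    and B: "B = {elt p q r (int i + l i j * int p) 0 (int j) | i j. i < p \<and> j < r}"
    using assms unfolding pair_pq_cosets_free_code_def by blast
  show ?thesis
  proof (rule factorization_parametrized[where I = "{..<q} \<times> {..<p}" and J = "{..<p} \<times> {..<r}"
        and x = "\<lambda>(i, j). \<alpha> i + int j * int p" and y = "\<lambda>(i, j). int i" and z = "\<lambda>(i, j). \<beta> i"
        and x' = "\<lambda>(s, t). int s + l s t * int p" and y' = "\<lambda>(s, t). 0" and z' = "\<lambda>(s, t). int t"], goal_cases)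
    case (6 ii ii' jj jj')
    obtain i j i' j' s t s' t' where idx: "ii = (i, j)" "ii' = (i', j')" "jj = (s, t)" "jj' = (s', t')"
      by (metis surj_pair)
    note dp = 6(5)[unfolded idx prod.case] and dq = 6(6)[unfolded idx prod.case] and dr = 6(7)[unfolded idx prod.case]
    note bd = 6(1-4)[unfolded idx]
    have i: "i = i'" by (rule residues_eqI[of q]) (use dq bd in auto)
    have t: "t = t'" by (rule residues_eqI[of r]) (use dr bd i in auto)
    have s: "s = s'"
      by (rule low_digits_eqI[OF dp, of _ _ "(int j + l s t) - (int j' + l s' t')"]) (use bd i t in \<open>auto simp: algebra_simps\<close>)
    have j: "j = j'" by (rule high_digits_eqI[OF dp]) (use bd i t s in \<open>auto simp: algebra_simps\<close>)
    show ?case unfolding idx using i t s j by simp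
  qed (simp_all add: A B family_eq_image case_prod_unfold power2_eq_square)
qed

lemma factorization_pair_pq_code_q_free:
  assumes "pair_pq_code_q_free p q r A B"
  shows "factorization G A B"
proof -
  obtain \<alpha> l where A: "A = {elt p q r (int i + \<alpha> i * int p) (int j) (\<alpha> i) | i j. i < p \<and> j < q}"
    and B: "B = {elt p q r (int i * int p) (l i j) (int j) | i j. i < p \<and> j < r}"
    using assms unfolding pair_pq_code_q_free_def by blast
  show ?thesis
  proof (rule factorization_parametrized[where I = "{..<p} \<times> {..<q}" and J = "{..<p} \<times> {..<r}"
        and x = "\<lambda>(i, j). int i + \<alpha> i * int p" and y = "\<lambda>(i, j). int j" and z = "\<lambda>(i, j). \<alpha> i"
        and x' = "\<lambda>(s, t). int s * int p" and y' = "\<lambda>(s, t). l s t" and z' = "\<lambda>(s, t). int t"], goal_cases)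
    case (6 ii ii' jj jj')
    obtain i j i' j' s t s' t' where idx: "ii = (i, j)" "ii' = (i', j')" "jj = (s, t)" "jj' = (s', t')"
      by (metis surj_pair)
    note dp = 6(5)[unfolded idx prod.case] and dq = 6(6)[unfolded idx prod.case] and dr = 6(7)[unfolded idx prod.case]
    note bd = 6(1-4)[unfolded idx]
    have i: "i = i'"
      by (rule low_digits_eqI[OF dp, of _ _ "(\<alpha> i + int s) - (\<alpha> i' + int s')"]) (use bd in \<open>auto simp: algebra_simps\<close>)
    have t: "t = t'" by (rule residues_eqI[of r]) (use dr bd i in auto)
    have s: "s = s'" by (rule high_digits_eqI[OF dp]) (use bd i t in \<open>auto simp: algebra_simps\<close>)
    have j: "j = j'" by (rule residues_eqI[of q]) (use dq bd i t s in auto)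
    show ?case unfolding idx using i t s j by simp
  qed (simp_all add: A B family_eq_image case_prod_unfold power2_eq_square)
qed

lemma factorization_pair_pq_code_cosets:
  assumes "pair_pq_code_cosets p q r A B"
  shows "factorization G A B"
proof -
  obtain \<alpha> \<beta> l where A: "A = {elt p q r (int j + \<alpha> i j * int p) (int i) (\<beta> i) | i j. i < q \<and> j < p}"
    and B: "B = {elt p q r (l i + int j * int p) 0 (int i) | i j. i < r \<and> j < p}"
    using assms unfolding pair_pq_code_cosets_def by blast
  show ?thesis
  proof (rule factorization_parametrized[where I = "{..<q} \<times> {..<p}" and J = "{..<r} \<times> {..<p}"
        and x = "\<lambda>(i, j). int j + \<alpha> i j * int p" and y = "\<lambda>(i, j). int i" and z = "\<lambda>(i, j). \<beta> i"
        and x' = "\<lambda>(s, t). l s + int t * int p" and y' = "\<lambda>(s, t). 0" and z' = "\<lambda>(s, t). int s"], goal_cases)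
    case (6 ii ii' jj jj')
    obtain i j i' j' s t s' t' where idx: "ii = (i, j)" "ii' = (i', j')" "jj = (s, t)" "jj' = (s', t')"
      by (metis surj_pair)
    note dp = 6(5)[unfolded idx prod.case] and dq = 6(6)[unfolded idx prod.case] and dr = 6(7)[unfolded idx prod.case]
    note bd = 6(1-4)[unfolded idx]
    have i: "i = i'" by (rule residues_eqI[of q]) (use dq bd in auto)
    have s: "s = s'" by (rule residues_eqI[of r]) (use dr bd i in auto)
    have j: "j = j'"
      by (rule low_digits_eqI[OF dp, of _ _ "(\<alpha> i j + int t) - (\<alpha> i' j' + int t')"]) (use bd i s in \<open>auto simp: algebra_simps\<close>)
    have t: "t = t'" by (rule high_digits_eqI[OF dp]) (use bd i s j in \<open>auto simp: algebra_simps\<close>)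
    show ?case unfolding idx using i s j t by simp
  qed (simp_all add: A B family_eq_image case_prod_unfold power2_eq_square)
qed

lemma factorization_pair_pq_code_q_by_r:
  assumes "pair_pq_code_q_by_r p q r A B"
  shows "factorization G A B"
proof -
  obtain \<alpha> \<beta> l where A: "A = {elt p q r (int i + \<alpha> i j * int p) (int j) (\<beta> i) | i j. i < p \<and> j < q}"
    and B: "B = {elt p q r (int j * int p) (l i) (int i) | i j. i < r \<and> j < p}"
    using assms unfolding pair_pq_code_q_by_r_def by blast
  show ?thesis
  proof (rule factorization_parametrized[where I = "{..<p} \<times> {..<q}" and J = "{..<r} \<times> {..<p}"
        and x = "\<lambda>(i, j). int i + \<alpha> i j * int p" and y = "\<lambda>(i, j). int j" and z = "\<lambda>(i, j). \<beta> i"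
        and x' = "\<lambda>(s, t). int t * int p" and y' = "\<lambda>(s, t). l s" and z' = "\<lambda>(s, t). int s"], goal_cases)
    case (6 ii ii' jj jj')
    obtain i j i' j' s t s' t' where idx: "ii = (i, j)" "ii' = (i', j')" "jj = (s, t)" "jj' = (s', t')"
      by (metis surj_pair)
    note dp = 6(5)[unfolded idx prod.case] and dq = 6(6)[unfolded idx prod.case] and dr = 6(7)[unfolded idx prod.case]
    note bd = 6(1-4)[unfolded idx]
    have i: "i = i'"
      by (rule low_digits_eqI[OF dp, of _ _ "(\<alpha> i j + int t) - (\<alpha> i' j' + int t')"]) (use bd in \<open>auto simp: algebra_simps\<close>)
    have s: "s = s'" by (rule residues_eqI[of r]) (use dr bd i in auto)
    have j: "j = j'" by (rule residues_eqI[of q]) (use dq bd i s in auto)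
    have t: "t = t'" by (rule high_digits_eqI[OF dp]) (use bd i s j in \<open>auto simp: algebra_simps\<close>)
    show ?case unfolding idx using i s j t by simp
  qed (simp_all add: A B family_eq_image case_prod_unfold power2_eq_square)
qed

lemma factorization_pair_pq_code_q_by_P:
  assumes "pair_pq_code_q_by_P p q r A B"
  shows "factorization G A B"
proof -
  obtain \<alpha> \<beta> l where A: "A = {elt p q r (int i + \<alpha> i * int p) (int j) (\<beta> i j) | i j. i < p \<and> j < q}"
    and B: "B = {elt p q r (int i * int p) (l i) (int j) | i j. i < p \<and> j < r}"
    using assms unfolding pair_pq_code_q_by_P_def by blast
  show ?thesis
  proof (rule factorization_parametrized[where I = "{..<p} \<times> {..<q}" and J = "{..<p} \<times> {..<r}"
        and x = "\<lambda>(i, j). int i + \<alpha> i * int p" and y = "\<lambda>(i, j). int j" and z = "\<lambda>(i, j). \<beta> i j"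
        and x' = "\<lambda>(s, t). int s * int p" and y' = "\<lambda>(s, t). l s" and z' = "\<lambda>(s, t). int t"], goal_cases)
    case (6 ii ii' jj jj')
    obtain i j i' j' s t s' t' where idx: "ii = (i, j)" "ii' = (i', j')" "jj = (s, t)" "jj' = (s', t')"
      by (metis surj_pair)
    note dp = 6(5)[unfolded idx prod.case] and dq = 6(6)[unfolded idx prod.case] and dr = 6(7)[unfolded idx prod.case]
    note bd = 6(1-4)[unfolded idx]
    have i: "i = i'"
      by (rule low_digits_eqI[OF dp, of _ _ "(\<alpha> i + int s) - (\<alpha> i' + int s')"]) (use bd in \<open>auto simp: algebra_simps\<close>)
    have s: "s = s'" by (rule high_digits_eqI[OF dp]) (use bd i in \<open>auto simp: algebra_simps\<close>)
    have j: "j = j'" by (rule residues_eqI[of q]) (use dq bd i s in auto)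
    have t: "t = t'" by (rule residues_eqI[of r]) (use dr bd i s j in auto)
    show ?case unfolding idx using i s j t by simp
  qed (simp_all add: A B family_eq_image case_prod_unfold power2_eq_square)
qed

lemma factorization_pair_pq_cosets_free_set:
  assumes "pair_pq_cosets_free_set p q r A B"
  shows "factorization G A B"
proof -
  obtain \<alpha> \<beta> l where A: "A = {elt p q r (\<alpha> i + int j * int p) (int i) (\<beta> i j) | i j. i < q \<and> j < p}"
    and B: "B = {elt p q r (int i + l i * int p) 0 (int j) | i j. i < p \<and> j < r}"
    using assms unfolding pair_pq_cosets_free_set_def by blast
  show ?thesis
  proof (rule factorization_parametrized[where I = "{..<q} \<times> {..<p}" and J = "{..<p} \<times> {..<r}"
        and x = "\<lambda>(i, j). \<alpha> i + int j * int p" and y = "\<lambda>(i, j). int i" and z = "\<lambda>(i, j). \<beta> i j"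
        and x' = "\<lambda>(s, t). int s + l s * int p" and y' = "\<lambda>(s, t). 0" and z' = "\<lambda>(s, t). int t"], goal_cases)
    case (6 ii ii' jj jj')
    obtain i j i' j' s t s' t' where idx: "ii = (i, j)" "ii' = (i', j')" "jj = (s, t)" "jj' = (s', t')"
      by (metis surj_pair)
    note dp = 6(5)[unfolded idx prod.case] and dq = 6(6)[unfolded idx prod.case] and dr = 6(7)[unfolded idx prod.case]
    note bd = 6(1-4)[unfolded idx]
    have i: "i = i'" by (rule residues_eqI[of q]) (use dq bd in auto)
    have s: "s = s'"
      by (rule low_digits_eqI[OF dp, of _ _ "(int j + l s) - (int j' + l s')"]) (use bd i in \<open>auto simp: algebra_simps\<close>)
    have j: "j = j'" by (rule high_digits_eqI[OF dp]) (use bd i s in \<open>auto simp: algebra_simps\<close>)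
    have t: "t = t'" by (rule residues_eqI[of r]) (use dr bd i s j in auto)
    show ?case unfolding idx using i s j t by simp
  qed (simp_all add: A B family_eq_image case_prod_unfold power2_eq_square)
qed

lemma factorization_pair_pq_code_subgroup:
  assumes "pair_pq_code_subgroup p q r A B"
  shows "factorization G A B"
proof -
  obtain \<alpha> \<beta> where A: "A = {elt p q r (int i + \<alpha> i j * int p) (int j) (\<beta> i j) | i j. i < p \<and> j < q}"
    and B: "B = {elt p q r (int i * int p) 0 (int j) | i j. i < p \<and> j < r}"
    using assms unfolding pair_pq_code_subgroup_def by blast
  show ?thesis
  proof (rule factorization_parametrized[where I = "{..<p} \<times> {..<q}" and J = "{..<p} \<times> {..<r}"
        and x = "\<lambda>(i, j). int i + \<alpha> i j * int p" and y = "\<lambda>(i, j). int j" and z = "\<lambda>(i, j). \<beta> i j"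
        and x' = "\<lambda>(s, t). int s * int p" and y' = "\<lambda>(s, t). 0" and z' = "\<lambda>(s, t). int t"], goal_cases)
    case (6 ii ii' jj jj')
    obtain i j i' j' s t s' t' where idx: "ii = (i, j)" "ii' = (i', j')" "jj = (s, t)" "jj' = (s', t')"
      by (metis surj_pair)
    note dp = 6(5)[unfolded idx prod.case] and dq = 6(6)[unfolded idx prod.case] and dr = 6(7)[unfolded idx prod.case]
    note bd = 6(1-4)[unfolded idx]
    have i: "i = i'"
      by (rule low_digits_eqI[OF dp, of _ _ "(\<alpha> i j + int s) - (\<alpha> i' j' + int s')"]) (use bd in \<open>auto simp: algebra_simps\<close>)
    have j: "j = j'" by (rule residues_eqI[of q]) (use dq bd i in auto)
    have s: "s = s'" by (rule high_digits_eqI[OF dp]) (use bd i j in \<open>auto simp: algebra_simps\<close>)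
    have t: "t = t'" by (rule residues_eqI[of r]) (use dr bd i j s in auto)
    show ?case unfolding idx using i j s t by simp
  qed (simp_all add: A B family_eq_image case_prod_unfold power2_eq_square)
qed

lemma factorization_pair_pqr_cosets:
  assumes "pair_pqr_cosets p q r A B"
  shows "factorization G A B"
proof -
  obtain \<alpha> l where A: "A = {elt p q r (\<alpha> i j + int k * int p) (int i) (int j) | i j k. i < q \<and> j < r \<and> k < p}"
    and B: "B = {elt p q r (int i + l i * int p) 0 0 | i. i < p}"
    using assms unfolding pair_pqr_cosets_def by blast
  show ?thesis
  proof (rule factorization_parametrized[where I = "{..<q} \<times> {..<r} \<times> {..<p}" and J = "{..<p}"
        and x = "\<lambda>(i, j, k). \<alpha> i j + int k * int p" and y = "\<lambda>(i, j, k). int i" and z = "\<lambda>(i, j, k). int j"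
        and x' = "\<lambda>s. int s + l s * int p" and y' = "\<lambda>s. 0" and z' = "\<lambda>s. 0"], goal_cases)
    case (6 ii ii' jj jj')
    obtain i j k i' j' k' s s' where idx: "ii = (i, j, k)" "ii' = (i', j', k')" "jj = s" "jj' = s'"
      by (metis surj_pair)
    note dp = 6(5)[unfolded idx prod.case] and dq = 6(6)[unfolded idx prod.case] and dr = 6(7)[unfolded idx prod.case]
    note bd = 6(1-4)[unfolded idx]
    have i: "i = i'" by (rule residues_eqI[of q]) (use dq bd in auto)
    have j: "j = j'" by (rule residues_eqI[of r]) (use dr bd i in auto)
    have s: "s = s'"
      by (rule low_digits_eqI[OF dp, of _ _ "(int k + l s) - (int k' + l s')"]) (use bd i j in \<open>auto simp: algebra_simps\<close>)
    have k: "k = k'" by (rule high_digits_eqI[OF dp]) (use bd i j s in \<open>auto simp: algebra_simps\<close>)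
    show ?case unfolding idx using i j s k by simp
  qed (simp_all add: A B family_eq_image case_prod_unfold power2_eq_square)
qed

lemma factorization_pair_pqr_code_q:
  assumes "pair_pqr_code_q p q r A B"
  shows "factorization G A B"
proof -
  obtain \<alpha> l where A: "A = {elt p q r (int i + \<alpha> i j * int p) (int k) (int j) | i j k. i < p \<and> j < r \<and> k < q}"
    and B: "B = {elt p q r (int i * int p) (l i) 0 | i. i < p}"
    using assms unfolding pair_pqr_code_q_def by blast
  show ?thesis
  proof (rule factorization_parametrized[where I = "{..<p} \<times> {..<r} \<times> {..<q}" and J = "{..<p}"
        and x = "\<lambda>(i, j, k). int i + \<alpha> i j * int p" and y = "\<lambda>(i, j, k). int k" and z = "\<lambda>(i, j, k). int j"
        and x' = "\<lambda>s. int s * int p" and y' = "\<lambda>s. l s" and z' = "\<lambda>s. 0"], goal_cases)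
    case (6 ii ii' jj jj')
    obtain i j k i' j' k' s s' where idx: "ii = (i, j, k)" "ii' = (i', j', k')" "jj = s" "jj' = s'"
      by (metis surj_pair)
    note dp = 6(5)[unfolded idx prod.case] and dq = 6(6)[unfolded idx prod.case] and dr = 6(7)[unfolded idx prod.case]
    note bd = 6(1-4)[unfolded idx]
    have i: "i = i'"
      by (rule low_digits_eqI[OF dp, of _ _ "(\<alpha> i j + int s) - (\<alpha> i' j' + int s')"]) (use bd in \<open>auto simp: algebra_simps\<close>)
    have j: "j = j'" by (rule residues_eqI[of r]) (use dr bd i in auto)
    have s: "s = s'" by (rule high_digits_eqI[OF dp]) (use bd i j in \<open>auto simp: algebra_simps\<close>)
    have k: "k = k'" by (rule residues_eqI[of q]) (use dq bd i j s in auto)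
    show ?case unfolding idx using i j s k by simp
  qed (simp_all add: A B family_eq_image case_prod_unfold power2_eq_square)
qed

lemma factorization_pair_pqr_cosets_code_q:
  assumes "pair_pqr_cosets_code_q p q r A B"
  shows "factorization G A B"
proof -
  obtain \<alpha> l where A: "A = {elt p q r (\<alpha> i + int j * int p) (int k) (int i) | i j k. i < r \<and> j < p \<and> k < q}"
    and B: "B = {elt p q r (int i + l i * int p) (l i) 0 | i. i < p}"
    using assms unfolding pair_pqr_cosets_code_q_def by blast
  show ?thesis
  proof (rule factorization_parametrized[where I = "{..<r} \<times> {..<p} \<times> {..<q}" and J = "{..<p}"
        and x = "\<lambda>(i, j, k). \<alpha> i + int j * int p" and y = "\<lambda>(i, j, k). int k" and z = "\<lambda>(i, j, k). int i"
        and x' = "\<lambda>s. int s + l s * int p" and y' = "\<lambda>s. l s" and z' = "\<lambda>s. 0"], goal_cases)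
    case (6 ii ii' jj jj')
    obtain i j k i' j' k' s s' where idx: "ii = (i, j, k)" "ii' = (i', j', k')" "jj = s" "jj' = s'"
      by (metis surj_pair)
    note dp = 6(5)[unfolded idx prod.case] and dq = 6(6)[unfolded idx prod.case] and dr = 6(7)[unfolded idx prod.case]
    note bd = 6(1-4)[unfolded idx]
    have i: "i = i'" by (rule residues_eqI[of r]) (use dr bd in auto)
    have s: "s = s'"
      by (rule low_digits_eqI[OF dp, of _ _ "(int j + l s) - (int j' + l s')"]) (use bd i in \<open>auto simp: algebra_simps\<close>)
    have j: "j = j'" by (rule high_digits_eqI[OF dp]) (use bd i s in \<open>auto simp: algebra_simps\<close>)
    have k: "k = k'" by (rule residues_eqI[of q]) (use dq bd i s j in auto)
    show ?case unfolding idx using i s j k by simp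
  qed (simp_all add: A B family_eq_image case_prod_unfold power2_eq_square)
qed

lemma factorization_pair_pqr_code_qr:
  assumes "pair_pqr_code_qr p q r A B"
  shows "factorization G A B"
proof -
  obtain \<alpha> l where A: "A = {elt p q r (int i + \<alpha> i * int p) (int j) (int k) | i j k. i < p \<and> j < q \<and> k < r}"
    and B: "B = {elt p q r (int i * int p) (l i) (l i) | i. i < p}"
    using assms unfolding pair_pqr_code_qr_def by blast
  show ?thesis
  proof (rule factorization_parametrized[where I = "{..<p} \<times> {..<q} \<times> {..<r}" and J = "{..<p}"
        and x = "\<lambda>(i, j, k). int i + \<alpha> i * int p" and y = "\<lambda>(i, j, k). int j" and z = "\<lambda>(i, j, k). int k"
        and x' = "\<lambda>s. int s * int p" and y' = "\<lambda>s. l s" and z' = "\<lambda>s. l s"], goal_cases)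
    case (6 ii ii' jj jj')
    obtain i j k i' j' k' s s' where idx: "ii = (i, j, k)" "ii' = (i', j', k')" "jj = s" "jj' = s'"
      by (metis surj_pair)
    note dp = 6(5)[unfolded idx prod.case] and dq = 6(6)[unfolded idx prod.case] and dr = 6(7)[unfolded idx prod.case]
    note bd = 6(1-4)[unfolded idx]
    have i: "i = i'"
      by (rule low_digits_eqI[OF dp, of _ _ "(\<alpha> i + int s) - (\<alpha> i' + int s')"]) (use bd in \<open>auto simp: algebra_simps\<close>)
    have s: "s = s'" by (rule high_digits_eqI[OF dp]) (use bd i in \<open>auto simp: algebra_simps\<close>)
    have j: "j = j'" by (rule residues_eqI[of q]) (use dq bd i s in auto)
    have k: "k = k'" by (rule residues_eqI[of r]) (use dr bd i s j in auto)
    show ?case unfolding idx using i s j k by simp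
  qed (simp_all add: A B family_eq_image case_prod_unfold power2_eq_square)
qed

lemma factorization_pair_pqr_code_subgroup:
  assumes "pair_pqr_code_subgroup p q r A B"
  shows "factorization G A B"
proof -
  obtain \<alpha> where A: "A = {elt p q r (int i + \<alpha> i j k * int p) (int j) (int k) | i j k. i < p \<and> j < q \<and> k < r}"
    and B: "B = {elt p q r (int i * int p) 0 0 | i. i < p}"
    using assms unfolding pair_pqr_code_subgroup_def by blast
  show ?thesis
  proof (rule factorization_parametrized[where I = "{..<p} \<times> {..<q} \<times> {..<r}" and J = "{..<p}"
        and x = "\<lambda>(i, j, k). int i + \<alpha> i j k * int p" and y = "\<lambda>(i, j, k). int j" and z = "\<lambda>(i, j, k). int k"
        and x' = "\<lambda>s. int s * int p" and y' = "\<lambda>s. 0" and z' = "\<lambda>s. 0"], goal_cases)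
    case (6 ii ii' jj jj')
    obtain i j k i' j' k' s s' where idx: "ii = (i, j, k)" "ii' = (i', j', k')" "jj = s" "jj' = s'"
      by (metis surj_pair)
    note dp = 6(5)[unfolded idx prod.case] and dq = 6(6)[unfolded idx prod.case] and dr = 6(7)[unfolded idx prod.case]
    note bd = 6(1-4)[unfolded idx]
    have i: "i = i'"
      by (rule low_digits_eqI[OF dp, of _ _ "(\<alpha> i j k + int s) - (\<alpha> i' j' k' + int s')"]) (use bd in \<open>auto simp: algebra_simps\<close>)
    have j: "j = j'" by (rule residues_eqI[of q]) (use dq bd i in auto)
    have k: "k = k'" by (rule residues_eqI[of r]) (use dr bd i j in auto)
    have s: "s = s'" by (rule high_digits_eqI[OF dp]) (use bd i j k in \<open>auto simp: algebra_simps\<close>)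
    show ?case unfolding idx using i j k s by simp
  qed (simp_all add: A B family_eq_image case_prod_unfold power2_eq_square)
qed

end

section \<open>Coordinates and parameters\<close>

lemma coordinates_surj:
  assumes "inj_on f S" "f ` S \<subseteq> I" "finite I" "card S = card I"
  shows "f ` S = I"
  using assms by (metis card_image card_subset_eq)

lemma eq_family_imageI:
  assumes "inj_on f S" "f ` S \<subseteq> I" "finite I" "card S = card I" "\<And>a. a \<in> S \<Longrightarrow> E (f a) = a"
  shows "S = E ` I"
proof -
  have "S = E ` f ` S" using assms(5) by (auto simp: image_image)
  then show ?thesis using coordinates_surj[OF assms(1-4)] by simp
qed

text \<open>If \<open>u\<close> depends on \<open>a\<close> only through the index \<open>f a\<close>, it is given by a family of integers over the
  indices. The point \<open>c\<close> is going to be zero, which makes the family vanish at the first index.\<close>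

lemma exists_parameter:
  fixes u :: "'a \<Rightarrow> nat"
  assumes "c \<in> S" "u c = 0" "\<And>a b. a \<in> S \<Longrightarrow> b \<in> S \<Longrightarrow> f a = f b \<Longrightarrow> u a = u b"
  shows "\<exists>\<alpha>. \<alpha> (f c) = 0 \<and> (\<forall>a\<in>S. \<alpha> (f a) = int (u a))"
proof -
  define \<alpha> where "\<alpha> = (\<lambda>i. int (u (SOME a. a \<in> S \<and> f a = i)))"
  have "\<alpha> (f a) = int (u a)" if "a \<in> S" for a
  proof -
    have b: "(SOME b. b \<in> S \<and> f b = f a) \<in> S \<and> f (SOME b. b \<in> S \<and> f b = f a) = f a"
      by (rule someI[of _ a]) (simp add: that)
    then show ?thesis unfolding \<alpha>_def using assms(3)[OF conjunct1[OF b] that conjunct2[OF b]] by simp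
  qed
  then show ?thesis using assms(1,2) by (intro exI[of _ \<alpha>]) simp
qed

lemma exists_parameter_inj:
  fixes u :: "'a \<Rightarrow> nat"
  assumes "inj_on f S" "c \<in> S" "u c = 0"
  shows "\<exists>\<alpha>. \<alpha> (f c) = 0 \<and> (\<forall>a\<in>S. \<alpha> (f a) = int (u a))"
  by (rule exists_parameter) (use assms in \<open>auto dest: inj_onD\<close>)

context distinct_primes begin

text \<open>The digits in base \<open>p\<close> of the first coordinate: \<open>lo\<close> is the class modulo the subgroup \<open>P\<close> of order \<open>p\<close>
  and \<open>hi\<close> is the position inside a coset of \<open>P\<close>. All coordinates are natural numbers because the
  families of pairs are indexed by natural numbers.\<close>

definition lo :: "int \<times> int \<times> int \<Rightarrow> nat" where "lo a = nat (fst a mod int p)"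
definition hi :: "int \<times> int \<times> int \<Rightarrow> nat" where "hi a = nat (fst a div int p)"
definition cy :: "int \<times> int \<times> int \<Rightarrow> nat" where "cy a = nat (fst (snd a))"
definition cz :: "int \<times> int \<times> int \<Rightarrow> nat" where "cz a = nat (snd (snd a))"

lemma zero_coords [simp]: "lo (0, 0, 0) = 0" "hi (0, 0, 0) = 0" "cy (0, 0, 0) = 0" "cz (0, 0, 0) = 0"
  by (simp_all add: lo_def hi_def cy_def cz_def)

lemma coords:
  assumes "a \<in> carrier G"
  shows "lo a < p" "hi a < p" "cy a < q" "cz a < r"
    and "int (lo a) = fst a mod int p" "fst a = int (lo a) + int (hi a) * int p"
    and "fst (snd a) = int (cy a)" "snd (snd a) = int (cz a)"
proof -
  have b: "0 \<le> fst a" "fst a < int p * int p" "0 \<le> fst (snd a)" "fst (snd a) < int q"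
    "0 \<le> snd (snd a)" "snd (snd a) < int r"
    using assms pos by (auto simp: carrier_Zppqr power2_eq_square)
  have "fst a div int p < int p"
  proof (rule ccontr)
    assume "\<not> fst a div int p < int p"
    then have "int p * int p \<le> fst a div int p * int p" by (intro mult_right_mono) auto
    also have "\<dots> \<le> fst a" using b(1) pos by (metis add_increasing2 div_mult_mod_eq dual_order.refl mod_int_pos_iff of_nat_0_less_iff order_less_imp_le)
    finally show False using b(2) by simp
  qed
  then have d: "0 \<le> fst a div int p" "fst a div int p < int p"
    using b pos by (simp_all add: pos_imp_zdiv_nonneg_iff)
  show "lo a < p" "hi a < p" "cy a < q" "cz a < r"
    using b d pos by (simp_all add: lo_def hi_def cy_def cz_def nat_less_iff)
  show 1: "int (lo a) = fst a mod int p" using pos by (simp add: lo_def)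
  show "fst a = int (lo a) + int (hi a) * int p"
    using d unfolding 1 by (simp add: hi_def)
  show "fst (snd a) = int (cy a)" "snd (snd a) = int (cz a)" using b by (simp_all add: cy_def cz_def)
qed

lemma fst_eq_iff:
  assumes "a \<in> carrier G" "b \<in> carrier G"
  shows "fst a = fst b \<longleftrightarrow> lo a = lo b \<and> hi a = hi b"
proof
  assume "fst a = fst b"
  then show "lo a = lo b \<and> hi a = hi b" by (simp add: lo_def hi_def)
next
  assume "lo a = lo b \<and> hi a = hi b"
  then show "fst a = fst b" using coords(6) assms by simp
qed

lemma elt_eqI:
  assumes a: "a \<in> carrier G"
    and "[x = int (lo a) + int (hi a) * int p] (mod int (p\<^sup>2))"
    and "[y = int (cy a)] (mod int q)" "[z = int (cz a)] (mod int r)"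
  shows "elt p q r x y z = a"
proof -
  have "elt p q r x y z = elt p q r (fst a) (fst (snd a)) (snd (snd a))"
    unfolding elt_eq_iff coords(7,8)[OF a] using assms coords(6)[OF a] by simp
  also have "\<dots> = a" using a pos by (auto simp: elt_def carrier_Zppqr)
  finally show ?thesis .
qed

lemma elt_eqI_high:
  assumes "a \<in> carrier G" "[t = int (hi a)] (mod int (p\<^sup>2))"
    and "[y = int (cy a)] (mod int q)" "[z = int (cz a)] (mod int r)"
  shows "elt p q r (int (lo a) + t * int p) y z = a"
  using assms by (intro elt_eqI cong_add cong_mult) auto

lemma elt_eqI_low:
  assumes "a \<in> carrier G" "[t = int (lo a)] (mod int (p\<^sup>2))"
    and "[y = int (cy a)] (mod int q)" "[z = int (cz a)] (mod int r)"
  shows "elt p q r (t + int (hi a) * int p) y z = a"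
  using assms by (intro elt_eqI cong_add cong_mult) auto

lemma elt_eqI_no_low:
  assumes "a \<in> carrier G" "lo a = 0"
    and "[y = int (cy a)] (mod int q)" "[z = int (cz a)] (mod int r)"
  shows "elt p q r (int (hi a) * int p) y z = a"
  using assms by (intro elt_eqI) auto

text \<open>A single family of integers can prescribe independent residues in all three coordinates.\<close>

lemma combine_parameters:
  fixes \<alpha> \<beta> \<gamma> :: "'i \<Rightarrow> int"
  assumes "\<alpha> c = 0" "\<beta> c = 0" "\<gamma> c = 0"
  shows "\<exists>\<delta>. \<delta> c = 0 \<and> (\<forall>i. [\<delta> i = \<alpha> i] (mod int (p\<^sup>2)) \<and> [\<delta> i = \<beta> i] (mod int q) \<and> [\<delta> i = \<gamma> i] (mod int r))"
proof -
  have cpp: "coprime (p\<^sup>2) q" "coprime (p\<^sup>2) r" "p\<^sup>2 > 0" using coprimes pos by auto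
  have "\<exists>x. (i = c \<longrightarrow> x = 0) \<and> [x = \<alpha> i] (mod int (p\<^sup>2)) \<and> [x = \<beta> i] (mod int q) \<and> [x = \<gamma> i] (mod int r)" for i
    using chinese_remainder_pqr[OF cpp, of "\<alpha> i" "\<beta> i" "\<gamma> i"] assms by (cases "i = c") auto
  then obtain \<delta> where "\<forall>i. (i = c \<longrightarrow> \<delta> i = 0) \<and> [\<delta> i = \<alpha> i] (mod int (p\<^sup>2)) \<and> [\<delta> i = \<beta> i] (mod int q) \<and>
      [\<delta> i = \<gamma> i] (mod int r)" by metis
  then show ?thesis by blast
qed

end

text \<open>That \<open>A\<close> generates the group is used in the form that it lies in none of the three maximal
  subgroups, which have the indices \<open>p\<close>, \<open>q\<close> and \<open>r\<close>.\<close>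

locale zppqr_factorization = distinct_primes +
  fixes A B :: "(int \<times> int \<times> int) set"
  assumes fact: "factorization G A B"
    and zero_A: "(0, 0, 0) \<in> A" and zero_B: "(0, 0, 0) \<in> B"
    and gen_p: "\<exists>a\<in>A. fst a mod int p \<noteq> 0"
    and gen_q: "\<exists>a\<in>A. fst (snd a) \<noteq> 0"
    and gen_r: "\<exists>a\<in>A. snd (snd a) \<noteq> 0"
begin

lemma sub: "A \<subseteq> carrier G" "B \<subseteq> carrier G"
  using fact unfolding factorization_def by auto

lemma inc: "a \<in> A \<Longrightarrow> a \<in> carrier G" "b \<in> B \<Longrightarrow> b \<in> carrier G"
  using sub by auto

lemma exists_nonzero: "\<exists>a\<in>A. lo a \<noteq> 0" "\<exists>a\<in>A. cy a \<noteq> 0" "\<exists>a\<in>A. cz a \<noteq> 0"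
proof -
  show "\<exists>a\<in>A. lo a \<noteq> 0" using gen_p coords(5) inc by (metis of_nat_0)
  show "\<exists>a\<in>A. cy a \<noteq> 0" using gen_q coords(7) inc by (metis of_nat_0)
  show "\<exists>a\<in>A. cz a \<noteq> 0" using gen_r coords(8) inc by (metis of_nat_0)
qed

lemma collision:
  assumes "a \<in> A" "a' \<in> A" "b \<in> B" "b' \<in> B"
    and "lo a = lo a' \<longleftrightarrow> lo b = lo b'"
    and "lo a = lo a' \<Longrightarrow> lo b = lo b' \<Longrightarrow> hi a = hi a' \<longleftrightarrow> hi b = hi b'"
    and "if q dvd card A then cy b = cy b' \<longrightarrow> cy a = cy a' else cy a = cy a' \<longrightarrow> cy b = cy b'"
    and "if r dvd card A then cz b = cz b' \<longrightarrow> cz a = cz a' else cz a = cz a' \<longrightarrow> cz b = cz b'"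
  shows "a = a' \<and> b = b'"
proof -
  have c: "a \<in> carrier G" "a' \<in> carrier G" "b \<in> carrier G" "b' \<in> carrier G" using assms(1-4) inc by auto
  have 1: "fst a mod int p = fst a' mod int p \<longleftrightarrow> lo a = lo a'" "fst b mod int p = fst b' mod int p \<longleftrightarrow> lo b = lo b'"
    using coords(5) c by (metis of_nat_eq_iff)+
  show ?thesis
    by (rule factorization_collision[OF fact assms(1-4)])
      (use assms(5-8) fst_eq_iff c in \<open>auto simp: 1 coords(7,8)\<close>)
qed

text \<open>Let \<open>f\<close> and \<open>h\<close> be the coordinates over which \<open>A\<close> and \<open>B\<close> are fibred. The first coordinates of two
  distinct points in one fibre differ either by an element of \<open>P\<close> or by a generator of the component of
  order \<open>p\<^sup>2\<close>. By the collision property the same alternative cannot occur both in a fibre of \<open>A\<close> and in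
  a fibre of \<open>B\<close>. As there are fibres with two points on both sides, one side realizes only the first
  alternative and the other one only the second.\<close>

lemma dichotomy:
  assumes coll: "\<And>a a' b b'. a \<in> A \<Longrightarrow> a' \<in> A \<Longrightarrow> b \<in> B \<Longrightarrow> b' \<in> B \<Longrightarrow> f a = f a' \<Longrightarrow> h b = h b' \<Longrightarrow>
      lo a = lo a' \<longleftrightarrow> lo b = lo b' \<Longrightarrow>
      (lo a = lo a' \<Longrightarrow> lo b = lo b' \<Longrightarrow> hi a = hi a' \<longleftrightarrow> hi b = hi b') \<Longrightarrow> a = a' \<and> b = b'"
    and not_inj: "\<not> inj_on f A" "\<not> inj_on h B"
  shows "inj_on (\<lambda>a. (f a, lo a)) A \<and> inj_on (\<lambda>b. (h b, hi b)) B \<and>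
           (\<forall>b\<in>B. \<forall>b'\<in>B. h b = h b' \<longrightarrow> lo b = lo b') \<or>
         inj_on (\<lambda>a. (f a, hi a)) A \<and> inj_on (\<lambda>b. (h b, lo b)) B \<and>
           (\<forall>a\<in>A. \<forall>a'\<in>A. f a = f a' \<longrightarrow> lo a = lo a')"
proof -
  have diff: "lo a = lo a' \<longleftrightarrow> lo b \<noteq> lo b'"
    if "a \<in> A" "a' \<in> A" "b \<in> B" "b' \<in> B" "f a = f a'" "h b = h b'" "a \<noteq> a'" "b \<noteq> b'" for a a' b b'
  proof -
    have "\<not> (lo a = lo a' \<and> hi a = hi a')" using coll[OF that(1,2,3,3,5)] that(7) by auto
    moreover have "\<not> (lo b = lo b' \<and> hi b = hi b')" using coll[OF that(1,1,3,4) _ that(6)] that(8) by auto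
    ultimately show ?thesis using coll[OF that(1-6)] that(7) by blast
  qed
  have injA: "a = a'" if "a \<in> A" "a' \<in> A" "f a = f a'" "lo a = lo a'" "hi a = hi a'" for a a'
    using coll[OF that(1,2) zero_B zero_B that(3)] that by auto
  have injB: "b = b'" if "b \<in> B" "b' \<in> B" "h b = h b'" "lo b = lo b'" "hi b = hi b'" for b b'
    using coll[OF zero_A zero_A that(1,2) _ that(3)] that by auto
  obtain a a' where a: "a \<in> A" "a' \<in> A" "a \<noteq> a'" "f a = f a'" using not_inj(1) unfolding inj_on_def by blast
  obtain b b' where b: "b \<in> B" "b' \<in> B" "b \<noteq> b'" "h b = h b'" using not_inj(2) unfolding inj_on_def by blast
  show ?thesis
  proof (cases "lo a = lo a'")
    case True
    have B: "lo c \<noteq> lo c'" if "c \<in> B" "c' \<in> B" "c \<noteq> c'" "h c = h c'" for c c'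
      using diff[OF a(1,2) that(1,2) a(4) that(4) a(3) that(3)] True by simp
    have A: "lo c = lo c'" if "c \<in> A" "c' \<in> A" "f c = f c'" for c c'
      using diff[OF that(1,2) b(1,2) that(3) b(4) _ b(3)] B[OF b] by blast
    show ?thesis using A B injA unfolding inj_on_def by blast
  next
    case False
    have B: "lo c = lo c'" if "c \<in> B" "c' \<in> B" "h c = h c'" for c c'
      using diff[OF a(1,2) that(1,2) a(4) that(3) a(3)] False by blast
    have A: "lo c \<noteq> lo c'" if "c \<in> A" "c' \<in> A" "c \<noteq> c'" "f c = f c'" for c c'
      using diff[OF that(1,2) b(1,2) that(4) b(4) that(3) b(3)] B[OF b(1,2,4)] by simp
    show ?thesis using A B injB unfolding inj_on_def by blast
  qed
qed

lemma p_gt_1: "p > 1" "1 < q" "1 < r" using primes prime_gt_1_nat by auto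

text \<open>The fibres have \<open>p\<close> elements on average, so some fibre has two.\<close>

lemma not_inj_of_card:
  assumes "f ` S \<subseteq> I" "finite I" "card S = p * card I" "S \<noteq> {}"
  shows "\<not> inj_on f S"
proof
  assume inj: "inj_on f S"
  have "card S \<le> card I" using card_inj_on_le[OF inj assms(1,2)] .
  moreover have "card I > 0" using assms by (auto simp: card_gt_0_iff)
  ultimately show False using assms(3) p_gt_1 by auto
qed

lemma exists_with_coordinates:
  assumes "inj_on f S" "f ` S \<subseteq> I" "finite I" "card S = card I" "i \<in> I"
  obtains a where "a \<in> S" "f a = i"
  using coordinates_surj[OF assms(1-4)] assms(5) by (metis imageE)

end

section \<open>Classification by the order of the first factor\<close>

context zppqr_factorization begin

lemma not_dvd: "\<not> q dvd p" "\<not> r dvd p" "\<not> q dvd r" "\<not> r dvd q"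
  using primes distinct primes_dvd_imp_eq by metis+

text \<open>If the digits \<open>lo\<close> were constant on \<open>A\<close>, then \<open>A\<close> would lie in the maximal subgroup of index \<open>p\<close>.
  Hence \<open>A\<close> is a transversal and the fibres of \<open>B\<close> are cosets of \<open>P\<close>. As \<open>A\<close> has a nonzero second and a
  nonzero third coordinate, these cosets depend neither on the second nor on the third coordinate, so \<open>B\<close>
  is the whole subgroup of index \<open>p\<close>.\<close>

lemma classification_card_p:
  assumes cardA: "card A = p" and cardB: "card B = p * (q * r)"
  shows "pair_p p q r A B"
proof -
  have nd: "\<not> q dvd card A" "\<not> r dvd card A"
    using not_dvd unfolding cardA by auto
  have coll: "a = a' \<and> b = b'" if "a \<in> A" "a' \<in> A" "b \<in> B" "b' \<in> B" "lo a = lo a' \<longleftrightarrow> lo b = lo b'"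
    "lo a = lo a' \<Longrightarrow> lo b = lo b' \<Longrightarrow> hi a = hi a' \<longleftrightarrow> hi b = hi b'"
    "cy a = cy a' \<Longrightarrow> cy b = cy b'" "cz a = cz a' \<Longrightarrow> cz b = cz b'" for a a' b b'
    using collision[OF that(1-6)] nd that(7,8) by simp
  have "inj_on (\<lambda>a. ((), lo a)) A \<and> inj_on (\<lambda>b. ((cy b, cz b), hi b)) B \<and>
           (\<forall>b\<in>B. \<forall>b'\<in>B. (cy b, cz b) = (cy b', cz b') \<longrightarrow> lo b = lo b') \<or>
         inj_on (\<lambda>a. ((), hi a)) A \<and> inj_on (\<lambda>b. ((cy b, cz b), lo b)) B \<and>
           (\<forall>a\<in>A. \<forall>a'\<in>A. () = () \<longrightarrow> lo a = lo a')"
  proof (rule dichotomy)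
    show "\<not> inj_on (\<lambda>a. ()) A" by (rule not_inj_of_card[of _ _ "{()}"]) (use cardA zero_A in auto)
    show "\<not> inj_on (\<lambda>b. (cy b, cz b)) B"
      by (rule not_inj_of_card[of _ _ "{..<q} \<times> {..<r}"]) (use cardB zero_B coords inc in auto)
    show "a = a' \<and> b = b'" if "a \<in> A" "a' \<in> A" "b \<in> B" "b' \<in> B" "() = ()" "(cy b, cz b) = (cy b', cz b')"
      "lo a = lo a' \<longleftrightarrow> lo b = lo b'" "lo a = lo a' \<Longrightarrow> lo b = lo b' \<Longrightarrow> hi a = hi a' \<longleftrightarrow> hi b = hi b'" for a a' b b'
      by (rule coll[OF that(1-4,7,8)]) (use that(5,6) in simp_all)
  qed
  moreover have "\<not> (\<forall>a\<in>A. \<forall>a'\<in>A. () = () \<longrightarrow> lo a = lo a')"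
    using exists_nonzero(1) zero_A zero_coords(1) by metis
  ultimately have "inj_on (\<lambda>a. ((), lo a)) A" "inj_on (\<lambda>b. ((cy b, cz b), hi b)) B" by blast+
  then have injA: "inj_on lo A" and injB: "inj_on (\<lambda>b. (hi b, cy b, cz b)) B" by (simp_all add: inj_on_def)
  have imA: "lo ` A \<subseteq> {..<p}" using coords inc by auto
  have imB: "(\<lambda>b. (hi b, cy b, cz b)) ` B \<subseteq> {..<p} \<times> {..<q} \<times> {..<r}" using coords inc by auto
  have cardB': "card B = card ({..<p} \<times> {..<q} \<times> {..<r})" using cardB by (simp add: card_cartesian_product)
  (* An element a with nonzero third coordinate could be matched with b - b', whose second coordinate is 0. *)
  have cy_const: "lo b = lo b'" if "b \<in> B" "b' \<in> B" "cy b = cy b'" for b b'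
  proof (rule ccontr)
    assume ne: "lo b \<noteq> lo b'"
    obtain a where a: "a \<in> A" "cz a \<noteq> 0" using exists_nonzero by blast
    then have "lo a \<noteq> lo (0, 0, 0)" using injA zero_A zero_coords(4) by (metis inj_onD)
    then show False using coll[OF a(1) zero_A that(1,2)] ne that(3) a by auto
  qed
  have cz_const: "lo b = lo b'" if "b \<in> B" "b' \<in> B" "cz b = cz b'" for b b'
  proof (rule ccontr)
    assume ne: "lo b \<noteq> lo b'"
    obtain a where a: "a \<in> A" "cy a \<noteq> 0" using exists_nonzero by blast
    then have "lo a \<noteq> lo (0, 0, 0)" using injA zero_A zero_coords(3) by (metis inj_onD)
    then show False using coll[OF a(1) zero_A that(1,2)] ne that(3) a by auto
  qed
  have lo_B: "lo b = 0" if b: "b \<in> B" for b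
  proof -
    (* A point that shares one coordinate with b and the other one with 0. *)
    have "(0, cy b, 0) \<in> {..<p} \<times> {..<q} \<times> {..<r}" using coords inc b pos by auto
    moreover have "finite ({..<p} \<times> {..<q} \<times> {..<r})" by simp
    ultimately obtain c where c: "c \<in> B" "(hi c, cy c, cz c) = (0, cy b, 0)"
      using exists_with_coordinates[OF injB imB _ cardB'] by blast
    then have "lo b = lo c" "lo c = lo (0, 0, 0)" using cy_const[OF b] cz_const[OF c(1) zero_B] by auto
    then show ?thesis by simp
  qed
  obtain \<alpha> where \<alpha>: "\<alpha> 0 = 0" "\<forall>a\<in>A. [\<alpha> (lo a) = int (hi a)] (mod int (p\<^sup>2)) \<and>
      [\<alpha> (lo a) = int (cy a)] (mod int q) \<and> [\<alpha> (lo a) = int (cz a)] (mod int r)"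
  proof -
    obtain a1 a2 a3 where "a1 0 = 0" "\<forall>a\<in>A. a1 (lo a) = int (hi a)" "a2 0 = 0" "\<forall>a\<in>A. a2 (lo a) = int (cy a)"
      "a3 0 = 0" "\<forall>a\<in>A. a3 (lo a) = int (cz a)"
      using exists_parameter_inj[where u = hi, OF injA zero_A zero_coords(2)] exists_parameter_inj[where u = cy, OF injA zero_A zero_coords(3)]
        exists_parameter_inj[where u = cz, OF injA zero_A zero_coords(4)] unfolding zero_coords by blast
    then show ?thesis using that combine_parameters[of a1 0 a2 a3] by metis
  qed
  have cardA': "card A = card {..<p}" using cardA by simp
  have "A = (\<lambda>i. elt p q r (int i + \<alpha> i * int p) (\<alpha> i) (\<alpha> i)) ` {..<p}"
    by (rule eq_family_imageI[OF injA imA _ cardA']) (use \<alpha> inc in \<open>auto intro!: elt_eqI_high\<close>)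
  moreover have "B = (\<lambda>(i, j, k). elt p q r (int i * int p) (int j) (int k)) ` ({..<p} \<times> {..<q} \<times> {..<r})"
    by (rule eq_family_imageI[OF injB imB _ cardB']) (use inc lo_B in \<open>auto intro!: elt_eqI_no_low\<close>)
  ultimately show ?thesis unfolding pair_p_def family_eq_image using \<alpha>(1) by blast
qed


text \<open>A difference of \<open>A\<close> and a difference of \<open>B\<close> collide if their first coordinates have equal order, the
  second coordinate of the former is zero whenever that of the latter is, and the third coordinate of the
  latter is zero whenever that of the former is. Excluding all collisions, first where \<open>A\<close> consists of
  transversals and then where it consists of cosets, leaves seven families. In each step two points that
  would violate the claimed dependence are matched with a suitable pair of points of the other factor.\<close>

lemma classification_card_pq:
  assumes cardA: "card A = p * q" and cardB: "card B = p * r"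
  shows "pair_pq_cosets_free_code p q r A B \<or> pair_pq_code_q_free p q r A B \<or> pair_pq_code_cosets p q r A B \<or> pair_pq_code_q_by_r p q r A B \<or>
         pair_pq_code_q_by_P p q r A B \<or> pair_pq_cosets_free_set p q r A B \<or> pair_pq_code_subgroup p q r A B"
proof -
  have nd: "q dvd card A" "\<not> r dvd card A"
    using not_dvd primes unfolding cardA by (auto simp: prime_dvd_mult_iff)
  have coll: "a = a' \<and> b = b'" if "a \<in> A" "a' \<in> A" "b \<in> B" "b' \<in> B" "lo a = lo a' \<longleftrightarrow> lo b = lo b'"
    "lo a = lo a' \<Longrightarrow> lo b = lo b' \<Longrightarrow> hi a = hi a' \<longleftrightarrow> hi b = hi b'"
    "cy b = cy b' \<Longrightarrow> cy a = cy a'" "cz a = cz a' \<Longrightarrow> cz b = cz b'" for a a' b b'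
    using collision[OF that(1-6)] nd that(7,8) by simp
  have dich: "inj_on (\<lambda>a. (cy a, lo a)) A \<and> inj_on (\<lambda>b. (cz b, hi b)) B \<and>
           (\<forall>b\<in>B. \<forall>b'\<in>B. cz b = cz b' \<longrightarrow> lo b = lo b') \<or>
         inj_on (\<lambda>a. (cy a, hi a)) A \<and> inj_on (\<lambda>b. (cz b, lo b)) B \<and>
           (\<forall>a\<in>A. \<forall>a'\<in>A. cy a = cy a' \<longrightarrow> lo a = lo a')"
  proof (rule dichotomy)
    show "\<not> inj_on cy A" by (rule not_inj_of_card[of _ _ "{..<q}"]) (use cardA zero_A coords inc in auto)
    show "\<not> inj_on cz B" by (rule not_inj_of_card[of _ _ "{..<r}"]) (use cardB zero_B coords inc in auto)
    show "a = a' \<and> b = b'" if "a \<in> A" "a' \<in> A" "b \<in> B" "b' \<in> B" "cy a = cy a'" "cz b = cz b'"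
      "lo a = lo a' \<longleftrightarrow> lo b = lo b'" "lo a = lo a' \<Longrightarrow> lo b = lo b' \<Longrightarrow> hi a = hi a' \<longleftrightarrow> hi b = hi b'" for a a' b b'
      by (rule coll[OF that(1-4,7,8)]) (use that(5,6) in simp_all)
  qed
  have cards: "card A = card ({..<q} \<times> {..<p})" "card B = card ({..<r} \<times> {..<p})"
      "card A = card ({..<p} \<times> {..<q})" "card B = card ({..<p} \<times> {..<r})"
    using cardA cardB by (simp_all add: card_cartesian_product)
  show ?thesis using dich
  proof (elim disjE conjE)
    assume injA: "inj_on (\<lambda>a. (cy a, lo a)) A" and injB: "inj_on (\<lambda>b. (cz b, hi b)) B"
      and "\<forall>b\<in>B. \<forall>b'\<in>B. cz b = cz b' \<longrightarrow> lo b = lo b'"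
    then have cosets: "\<And>b b'. b \<in> B \<Longrightarrow> b' \<in> B \<Longrightarrow> cz b = cz b' \<Longrightarrow> lo b = lo b'" by blast
    have eqA: "a = a'" if "a \<in> A" "a' \<in> A" "cy a = cy a'" "lo a = lo a'" for a a'
      using inj_onD[OF injA _ that(1,2)] that by simp
    have eqB: "b = b'" if "b \<in> B" "b' \<in> B" "cz b = cz b'" "hi b = hi b'" for b b'
      using inj_onD[OF injB _ that(1,2)] that by simp
    have imA: "(\<lambda>a. (cy a, lo a)) ` A \<subseteq> {..<q} \<times> {..<p}" and imB: "(\<lambda>b. (cz b, hi b)) ` B \<subseteq> {..<r} \<times> {..<p}"
      using coords inc by auto
    have injA': "inj_on (\<lambda>a. (lo a, cy a)) A" and imA': "(\<lambda>a. (lo a, cy a)) ` A \<subseteq> {..<p} \<times> {..<q}"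
      and injB': "inj_on (\<lambda>b. (hi b, cz b)) B" and imB': "(\<lambda>b. (hi b, cz b)) ` B \<subseteq> {..<p} \<times> {..<r}"
      using injA injB coords inc by (auto simp: inj_on_def)
    have getA: "\<exists>a\<in>A. cy a = i \<and> lo a = j" if "i < q" "j < p" for i j
      using exists_with_coordinates[OF injA imA _ cards(1), of "(i, j)"] that by auto
    have getB: "\<exists>b\<in>B. cz b = i \<and> hi b = j" if "i < r" "j < p" for i j
      using exists_with_coordinates[OF injB imB _ cards(2), of "(i, j)"] that by auto
    show ?thesis
    proof (cases "\<forall>b\<in>B. lo b = 0")
      case False
      then obtain b1 where b1: "b1 \<in> B" "lo b1 \<noteq> 0" by blast
      have cz_cy: "cz a = cz a'" if "a \<in> A" "a' \<in> A" "cy a = cy a'" for a a'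
      proof (rule ccontr)
        assume ne: "cz a \<noteq> cz a'"
        then have "lo a \<noteq> lo a'" using eqA[OF that] by blast
        then show False using coll[OF that(1,2) b1(1) zero_B] b1(2) ne that(3) by auto
      qed
      (* Moving inside the fibre of a1 makes the lowest digit nonzero and keeps the third coordinate. *)
      obtain a1 where a1: "a1 \<in> A" "cz a1 \<noteq> 0" using exists_nonzero by blast
      obtain a2 where a2: "a2 \<in> A" "cy a2 = cy a1" "lo a2 = 1"
        using getA[OF coords(3)[OF inc(1)[OF a1(1)]] p_gt_1(1)] by blast
      have a2_cz: "cz a2 \<noteq> 0" using cz_cy[OF a2(1) a1(1) a2(2)] a1(2) by simp
      have cy_ne: "cy b = cy b'" if "b \<in> B" "b' \<in> B" "lo b \<noteq> lo b'" for b b'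
        using coll[OF a2(1) zero_A that(1,2)] that(3) a2 a2_cz by auto
      (* Both b1 and 0 lie in B and have different lowest digits, so b differs from one of them in it. *)
      have cy_B: "cy b = 0" if "b \<in> B" for b
        using cy_ne[OF that zero_B] cy_ne[OF that b1(1)] cy_ne[OF b1(1) zero_B] b1(2) by fastforce
      obtain \<alpha> where \<alpha>: "\<alpha> (0, 0) = 0" "\<forall>a\<in>A. \<alpha> (cy a, lo a) = int (hi a)"
        using exists_parameter_inj[where u = hi, OF injA zero_A zero_coords(2)] unfolding zero_coords by blast
      obtain \<beta> where \<beta>: "\<beta> 0 = 0" "\<forall>a\<in>A. \<beta> (cy a) = int (cz a)"
        using exists_parameter[where f = cy and u = cz, OF zero_A zero_coords(4) cz_cy] unfolding zero_coords by blast
      obtain l where l: "l 0 = 0" "\<forall>b\<in>B. l (cz b) = int (lo b)"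
        using exists_parameter[where f = cz and u = lo, OF zero_B zero_coords(1) cosets] unfolding zero_coords by blast
      have "A = (\<lambda>(i, j). elt p q r (int j + \<alpha> (i, j) * int p) (int i) (\<beta> i)) ` ({..<q} \<times> {..<p})"
        by (rule eq_family_imageI[OF injA imA _ cards(1)]) (use \<alpha> \<beta> inc in \<open>auto intro!: elt_eqI_high\<close>)
      moreover have "B = (\<lambda>(i, j). elt p q r (l i + int j * int p) 0 (int i)) ` ({..<r} \<times> {..<p})"
        by (rule eq_family_imageI[OF injB imB _ cards(2)]) (use l cy_B inc in \<open>auto intro!: elt_eqI_low\<close>)
      ultimately have "pair_pq_code_cosets p q r A B"
        unfolding pair_pq_code_cosets_def family_eq_image using \<alpha>(1) \<beta>(1) l(1)
        by (intro exI[of _ "curry \<alpha>"] exI[of _ \<beta>] exI[of _ l]) simp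
      then show ?thesis by blast
    next
      case lo_B: True
      show ?thesis
      proof (cases "\<forall>b\<in>B. cy b = 0")
        case cy_B: True
        obtain \<alpha> where \<alpha>: "\<alpha> (0, 0) = 0" "\<forall>a\<in>A. \<alpha> (lo a, cy a) = int (hi a)"
          using exists_parameter_inj[where u = hi, OF injA' zero_A zero_coords(2)] unfolding zero_coords by blast
        obtain \<beta> where \<beta>: "\<beta> (0, 0) = 0" "\<forall>a\<in>A. \<beta> (lo a, cy a) = int (cz a)"
          using exists_parameter_inj[where u = cz, OF injA' zero_A zero_coords(4)] unfolding zero_coords by blast
        have "A = (\<lambda>(i, j). elt p q r (int i + \<alpha> (i, j) * int p) (int j) (\<beta> (i, j))) ` ({..<p} \<times> {..<q})"
          by (rule eq_family_imageI[OF injA' imA' _ cards(3)]) (use \<alpha> \<beta> inc in \<open>auto intro!: elt_eqI_high\<close>)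
        moreover have "B = (\<lambda>(i, j). elt p q r (int i * int p) 0 (int j)) ` ({..<p} \<times> {..<r})"
          by (rule eq_family_imageI[OF injB' imB' _ cards(4)]) (use lo_B cy_B inc in \<open>auto intro!: elt_eqI_no_low\<close>)
        ultimately have "pair_pq_code_subgroup p q r A B"
          unfolding pair_pq_code_subgroup_def family_eq_image using \<alpha>(1) \<beta>(1)
          by (intro exI[of _ "curry \<alpha>"] exI[of _ "curry \<beta>"]) simp
        then show ?thesis by blast
      next
        case False
        then obtain b1 where b1: "b1 \<in> B" "cy b1 \<noteq> 0" by blast
        show ?thesis
        proof (cases "\<forall>b\<in>B. \<forall>b'\<in>B. cz b = cz b' \<longrightarrow> cy b = cy b'")
          case True
          then have cy_cz: "\<And>b b'. b \<in> B \<Longrightarrow> b' \<in> B \<Longrightarrow> cz b = cz b' \<Longrightarrow> cy b = cy b'" by blast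
          have cz_lo: "cz a = cz a'" if "a \<in> A" "a' \<in> A" "lo a = lo a'" for a a'
          proof (rule ccontr)
            assume ne: "cz a \<noteq> cz a'"
            (* The point b is chosen in the fibre of b1 so that b - 0 has the same order as a - a' in the first coordinate. *)
            have "(if hi a = hi a' then 0 else 1) < p" using p_gt_1(1) by simp
            then obtain b where b: "b \<in> B" "cz b = cz b1" "hi b = (if hi a = hi a' then 0 else 1)"
              using getB[OF coords(4)[OF inc(2)[OF b1(1)]]] by blast
            have "cy b \<noteq> 0" using cy_cz[OF b(1) b1(1) b(2)] b1(2) by simp
            have "hi a = hi a' \<longleftrightarrow> hi b = 0" using b(3) by simp
            then show False using coll[OF that(1,2) b(1) zero_B] b(1) \<open>cy b \<noteq> 0\<close> lo_B ne that(3) by auto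
          qed
          obtain \<alpha> where \<alpha>: "\<alpha> (0, 0) = 0" "\<forall>a\<in>A. \<alpha> (lo a, cy a) = int (hi a)"
            using exists_parameter_inj[where u = hi, OF injA' zero_A zero_coords(2)] unfolding zero_coords by blast
          obtain \<beta> where \<beta>: "\<beta> 0 = 0" "\<forall>a\<in>A. \<beta> (lo a) = int (cz a)"
            using exists_parameter[where f = lo and u = cz, OF zero_A zero_coords(4) cz_lo] unfolding zero_coords by blast
          obtain l where l: "l 0 = 0" "\<forall>b\<in>B. l (cz b) = int (cy b)"
            using exists_parameter[where f = cz and u = cy, OF zero_B zero_coords(3) cy_cz] unfolding zero_coords by blast
          have "A = (\<lambda>(i, j). elt p q r (int i + \<alpha> (i, j) * int p) (int j) (\<beta> i)) ` ({..<p} \<times> {..<q})"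
            by (rule eq_family_imageI[OF injA' imA' _ cards(3)]) (use \<alpha> \<beta> inc in \<open>auto intro!: elt_eqI_high\<close>)
          moreover have "B = (\<lambda>(i, j). elt p q r (int j * int p) (l i) (int i)) ` ({..<r} \<times> {..<p})"
            by (rule eq_family_imageI[OF injB imB _ cards(2)]) (use l lo_B inc in \<open>auto intro!: elt_eqI_no_low\<close>)
          ultimately have "pair_pq_code_q_by_r p q r A B"
            unfolding pair_pq_code_q_by_r_def family_eq_image using \<alpha>(1) \<beta>(1) l(1)
            by (intro exI[of _ "curry \<alpha>"] exI[of _ \<beta>] exI[of _ l]) simp
          then show ?thesis by blast
        next
          case False
          then obtain b b' where b: "b \<in> B" "b' \<in> B" "cz b = cz b'" "cy b \<noteq> cy b'" by blast
          then have hi_ne: "hi b \<noteq> hi b'" using eqB[OF b(1-3)] by blast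
          have hi_lo: "hi a = hi a'" if "a \<in> A" "a' \<in> A" "lo a = lo a'" for a a'
            using coll[OF that(1,2) b(1,2)] that(3) b lo_B hi_ne by auto
          show ?thesis
          proof (cases "\<forall>a\<in>A. \<forall>a'\<in>A. lo a = lo a' \<longrightarrow> cz a = cz a'")
            case True
            then have cz_lo: "\<And>a a'. a \<in> A \<Longrightarrow> a' \<in> A \<Longrightarrow> lo a = lo a' \<Longrightarrow> cz a = cz a'" by blast
            obtain \<alpha>' where \<alpha>': "\<alpha>' 0 = 0" "\<forall>a\<in>A. \<alpha>' (lo a) = int (hi a)"
              using exists_parameter[where f = lo and u = hi, OF zero_A zero_coords(2) hi_lo] unfolding zero_coords by blast
            obtain \<beta> where \<beta>: "\<beta> 0 = 0" "\<forall>a\<in>A. \<beta> (lo a) = int (cz a)"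
              using exists_parameter[where f = lo and u = cz, OF zero_A zero_coords(4) cz_lo] unfolding zero_coords by blast
            obtain \<alpha> where \<alpha>: "\<alpha> 0 = 0" "\<forall>a\<in>A. [\<alpha> (lo a) = int (hi a)] (mod int (p\<^sup>2)) \<and> [\<alpha> (lo a) = int (cz a)] (mod int r)"
              using combine_parameters[of \<alpha>' 0 "\<lambda>_. 0" \<beta>] \<alpha>' \<beta> by metis
            obtain l where l: "l (0, 0) = 0" "\<forall>b\<in>B. l (hi b, cz b) = int (cy b)"
              using exists_parameter_inj[where u = cy, OF injB' zero_B zero_coords(3)] unfolding zero_coords by blast
            have "A = (\<lambda>(i, j). elt p q r (int i + \<alpha> i * int p) (int j) (\<alpha> i)) ` ({..<p} \<times> {..<q})"
              by (rule eq_family_imageI[OF injA' imA' _ cards(3)]) (use \<alpha> inc in \<open>auto intro!: elt_eqI_high\<close>)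
            moreover have "B = (\<lambda>(i, j). elt p q r (int i * int p) (l (i, j)) (int j)) ` ({..<p} \<times> {..<r})"
              by (rule eq_family_imageI[OF injB' imB' _ cards(4)]) (use l lo_B inc in \<open>auto intro!: elt_eqI_no_low\<close>)
            ultimately have "pair_pq_code_q_free p q r A B"
              unfolding pair_pq_code_q_free_def family_eq_image using \<alpha>(1) l(1)
              by (intro exI[of _ \<alpha>] exI[of _ "curry l"]) simp
            then show ?thesis by blast
          next
            case False
            then obtain a a' where a: "a \<in> A" "a' \<in> A" "lo a = lo a'" "cz a \<noteq> cz a'" by blast
            have cy_hi: "cy c = cy c'" if "c \<in> B" "c' \<in> B" "hi c = hi c'" for c c'
              using coll[OF a(1,2) that(1,2)] that lo_B a hi_lo[OF a(1-3)] by auto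
            obtain \<alpha> where \<alpha>: "\<alpha> 0 = 0" "\<forall>a\<in>A. \<alpha> (lo a) = int (hi a)"
              using exists_parameter[where f = lo and u = hi, OF zero_A zero_coords(2) hi_lo] unfolding zero_coords by blast
            obtain \<beta> where \<beta>: "\<beta> (0, 0) = 0" "\<forall>a\<in>A. \<beta> (lo a, cy a) = int (cz a)"
              using exists_parameter_inj[where u = cz, OF injA' zero_A zero_coords(4)] unfolding zero_coords by blast
            obtain l where l: "l 0 = 0" "\<forall>b\<in>B. l (hi b) = int (cy b)"
              using exists_parameter[where f = hi and u = cy, OF zero_B zero_coords(3) cy_hi] unfolding zero_coords by blast
            have "A = (\<lambda>(i, j). elt p q r (int i + \<alpha> i * int p) (int j) (\<beta> (i, j))) ` ({..<p} \<times> {..<q})"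
              by (rule eq_family_imageI[OF injA' imA' _ cards(3)]) (use \<alpha> \<beta> inc in \<open>auto intro!: elt_eqI_high\<close>)
            moreover have "B = (\<lambda>(i, j). elt p q r (int i * int p) (l i) (int j)) ` ({..<p} \<times> {..<r})"
              by (rule eq_family_imageI[OF injB' imB' _ cards(4)]) (use l lo_B inc in \<open>auto intro!: elt_eqI_no_low\<close>)
            ultimately have "pair_pq_code_q_by_P p q r A B"
              unfolding pair_pq_code_q_by_P_def family_eq_image using \<alpha>(1) \<beta>(1) l(1)
              by (intro exI[of _ \<alpha>] exI[of _ "curry \<beta>"] exI[of _ l]) simp
            then show ?thesis by blast
          qed
        qed
      qed
    qed
  next
    assume injA: "inj_on (\<lambda>a. (cy a, hi a)) A" and injB0: "inj_on (\<lambda>b. (cz b, lo b)) B"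
      and "\<forall>a\<in>A. \<forall>a'\<in>A. cy a = cy a' \<longrightarrow> lo a = lo a'"
    then have cosets: "\<And>a a'. a \<in> A \<Longrightarrow> a' \<in> A \<Longrightarrow> cy a = cy a' \<Longrightarrow> lo a = lo a'" by blast
    have eqA: "a = a'" if "a \<in> A" "a' \<in> A" "cy a = cy a'" "hi a = hi a'" for a a'
      using inj_onD[OF injA _ that(1,2)] that by simp
    have eqB: "b = b'" if "b \<in> B" "b' \<in> B" "cz b = cz b'" "lo b = lo b'" for b b'
      using inj_onD[OF injB0 _ that(1,2)] that by simp
    have imA: "(\<lambda>a. (cy a, hi a)) ` A \<subseteq> {..<q} \<times> {..<p}" and imB: "(\<lambda>b. (lo b, cz b)) ` B \<subseteq> {..<p} \<times> {..<r}"
      using coords inc by auto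
    have injB: "inj_on (\<lambda>b. (lo b, cz b)) B" using injB0 by (auto simp: inj_on_def)
    have getB: "\<exists>b\<in>B. cz b = i \<and> lo b = j" if "i < r" "j < p" for i j
      using exists_with_coordinates[OF injB imB _ cards(4), of "(j, i)"] that by auto
    (* Here generation is needed to have a difference of order p^2 in A at all. *)
    obtain a1 where a1: "a1 \<in> A" "lo a1 \<noteq> 0" using exists_nonzero by blast
    have cy_cz: "cy b = cy b'" if "b \<in> B" "b' \<in> B" "cz b = cz b'" for b b'
    proof (rule ccontr)
      assume ne: "cy b \<noteq> cy b'"
      then have "lo b \<noteq> lo b'" using eqB[OF that] by blast
      then show False using coll[OF a1(1) zero_A that(1,2)] a1(2) ne that(3) by auto
    qed
    have cy_B: "cy b = 0" if b: "b \<in> B" for b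
    proof (rule ccontr)
      assume ne: "cy b \<noteq> 0"
      obtain b' where b': "b' \<in> B" "cz b' = cz b" "lo b' = 1"
        using getB[OF coords(4)[OF inc(2)[OF b]] p_gt_1(1)] by blast
      have cy': "cy b' \<noteq> 0" using cy_cz[OF b'(1) b b'(2)] ne by simp
      (* A nonzero second coordinate in B would confine A to the maximal subgroup of index r. *)
      have cz_ne: "cz a = cz a'" if "a \<in> A" "a' \<in> A" "lo a \<noteq> lo a'" for a a'
        using coll[OF that(1,2) b'(1) zero_B] that(3) b' cy' by auto
      have "cz a = 0" if "a \<in> A" for a
        using cz_ne[OF that zero_A] cz_ne[OF that a1(1)] cz_ne[OF a1(1) zero_A] a1(2) by fastforce
      then show False using exists_nonzero(3) by metis
    qed
    show ?thesis
    proof (cases "\<forall>a\<in>A. \<forall>a'\<in>A. cy a = cy a' \<longrightarrow> cz a = cz a'")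
      case True
      then have cz_cy: "\<And>a a'. a \<in> A \<Longrightarrow> a' \<in> A \<Longrightarrow> cy a = cy a' \<Longrightarrow> cz a = cz a'" by blast
      obtain \<alpha> where \<alpha>: "\<alpha> 0 = 0" "\<forall>a\<in>A. \<alpha> (cy a) = int (lo a)"
        using exists_parameter[where f = cy and u = lo, OF zero_A zero_coords(1) cosets] unfolding zero_coords by blast
      obtain \<beta> where \<beta>: "\<beta> 0 = 0" "\<forall>a\<in>A. \<beta> (cy a) = int (cz a)"
        using exists_parameter[where f = cy and u = cz, OF zero_A zero_coords(4) cz_cy] unfolding zero_coords by blast
      obtain l where l: "l (0, 0) = 0" "\<forall>b\<in>B. l (lo b, cz b) = int (hi b)"
        using exists_parameter_inj[where u = hi, OF injB zero_B zero_coords(2)] unfolding zero_coords by blast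
      have "A = (\<lambda>(i, j). elt p q r (\<alpha> i + int j * int p) (int i) (\<beta> i)) ` ({..<q} \<times> {..<p})"
        by (rule eq_family_imageI[OF injA imA _ cards(1)]) (use \<alpha> \<beta> inc in \<open>auto intro!: elt_eqI_low\<close>)
      moreover have "B = (\<lambda>(i, j). elt p q r (int i + l (i, j) * int p) 0 (int j)) ` ({..<p} \<times> {..<r})"
        by (rule eq_family_imageI[OF injB imB _ cards(4)]) (use l cy_B inc in \<open>auto intro!: elt_eqI_high\<close>)
      ultimately have "pair_pq_cosets_free_code p q r A B"
        unfolding pair_pq_cosets_free_code_def family_eq_image using \<alpha>(1) \<beta>(1) l(1)
        by (intro exI[of _ \<alpha>] exI[of _ \<beta>] exI[of _ "curry l"]) simp
      then show ?thesis by blast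
    next
      case False
      then obtain a a' where a: "a \<in> A" "a' \<in> A" "cy a = cy a'" "cz a \<noteq> cz a'" by blast
      then have hi_ne: "hi a \<noteq> hi a'" using eqA[OF a(1-3)] by blast
      have hi_lo: "hi b = hi b'" if "b \<in> B" "b' \<in> B" "lo b = lo b'" for b b'
        using coll[OF a(1,2) that(1,2)] that a hi_ne cosets[OF a(1-3)] by auto
      obtain \<alpha> where \<alpha>: "\<alpha> 0 = 0" "\<forall>a\<in>A. \<alpha> (cy a) = int (lo a)"
        using exists_parameter[where f = cy and u = lo, OF zero_A zero_coords(1) cosets] unfolding zero_coords by blast
      obtain \<beta> where \<beta>: "\<beta> (0, 0) = 0" "\<forall>a\<in>A. \<beta> (cy a, hi a) = int (cz a)"
        using exists_parameter_inj[where u = cz, OF injA zero_A zero_coords(4)] unfolding zero_coords by blast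
      obtain l where l: "l 0 = 0" "\<forall>b\<in>B. l (lo b) = int (hi b)"
        using exists_parameter[where f = lo and u = hi, OF zero_B zero_coords(2) hi_lo] unfolding zero_coords by blast
      have "A = (\<lambda>(i, j). elt p q r (\<alpha> i + int j * int p) (int i) (\<beta> (i, j))) ` ({..<q} \<times> {..<p})"
        by (rule eq_family_imageI[OF injA imA _ cards(1)]) (use \<alpha> \<beta> inc in \<open>auto intro!: elt_eqI_low\<close>)
      moreover have "B = (\<lambda>(i, j). elt p q r (int i + l i * int p) 0 (int j)) ` ({..<p} \<times> {..<r})"
        by (rule eq_family_imageI[OF injB imB _ cards(4)]) (use l cy_B inc in \<open>auto intro!: elt_eqI_high\<close>)
      ultimately have "pair_pq_cosets_free_set p q r A B"
        unfolding pair_pq_cosets_free_set_def family_eq_image using \<alpha>(1) \<beta>(1) l(1)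
        by (intro exI[of _ \<alpha>] exI[of _ "curry \<beta>"] exI[of _ l]) simp
      then show ?thesis by blast
    qed
  qed
qed


lemma collision_pqr:
  assumes "card A = p * (q * r)"
    and "a \<in> A" "a' \<in> A" "b \<in> B" "b' \<in> B" "lo a = lo a' \<longleftrightarrow> lo b = lo b'"
    and "lo a = lo a' \<Longrightarrow> lo b = lo b' \<Longrightarrow> hi a = hi a' \<longleftrightarrow> hi b = hi b'"
    and "cy b = cy b' \<Longrightarrow> cy a = cy a'" "cz b = cz b' \<Longrightarrow> cz a = cz a'"
  shows "a = a' \<and> b = b'"
  using collision[OF assms(2-7)] assms(1,8,9) by simp

lemma dichotomy_pqr:
  assumes cardA: "card A = p * (q * r)" and cardB: "card B = p"
  shows "inj_on (\<lambda>a. (lo a, cy a, cz a)) A \<and> inj_on hi B \<and> (\<forall>b\<in>B. lo b = 0) \<or>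
         inj_on (\<lambda>a. (hi a, cy a, cz a)) A \<and> inj_on lo B \<and>
           (\<forall>a\<in>A. \<forall>a'\<in>A. cy a = cy a' \<longrightarrow> cz a = cz a' \<longrightarrow> lo a = lo a')"
proof -
  have "inj_on (\<lambda>a. ((cy a, cz a), lo a)) A \<and> inj_on (\<lambda>b. ((), hi b)) B \<and>
           (\<forall>b\<in>B. \<forall>b'\<in>B. () = () \<longrightarrow> lo b = lo b') \<or>
         inj_on (\<lambda>a. ((cy a, cz a), hi a)) A \<and> inj_on (\<lambda>b. ((), lo b)) B \<and>
           (\<forall>a\<in>A. \<forall>a'\<in>A. (cy a, cz a) = (cy a', cz a') \<longrightarrow> lo a = lo a')"
  proof (rule dichotomy)
    show "\<not> inj_on (\<lambda>b. ()) B" by (rule not_inj_of_card[of _ _ "{()}"]) (use cardB zero_B in auto)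
    show "\<not> inj_on (\<lambda>a. (cy a, cz a)) A"
      by (rule not_inj_of_card[of _ _ "{..<q} \<times> {..<r}"]) (use cardA zero_A coords inc in auto)
    show "a = a' \<and> b = b'" if "a \<in> A" "a' \<in> A" "b \<in> B" "b' \<in> B" "(cy a, cz a) = (cy a', cz a')" "() = ()"
      "lo a = lo a' \<longleftrightarrow> lo b = lo b'" "lo a = lo a' \<Longrightarrow> lo b = lo b' \<Longrightarrow> hi a = hi a' \<longleftrightarrow> hi b = hi b'" for a a' b b'
      by (rule collision_pqr[OF cardA that(1-4,7,8)]) (use that(5) in simp_all)
  qed
  then show ?thesis
  proof (elim disjE conjE)
    assume 1: "inj_on (\<lambda>a. ((cy a, cz a), lo a)) A" "inj_on (\<lambda>b. ((), hi b)) B"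
      and 2: "\<forall>b\<in>B. \<forall>b'\<in>B. () = () \<longrightarrow> lo b = lo b'"
    have "\<forall>b\<in>B. lo b = 0" using 2 zero_B zero_coords(1) by metis
    moreover have "inj_on (\<lambda>a. (lo a, cy a, cz a)) A" "inj_on hi B" using 1 by (simp_all add: inj_on_def)
    ultimately show ?thesis by blast
  next
    assume 1: "inj_on (\<lambda>a. ((cy a, cz a), hi a)) A" "inj_on (\<lambda>b. ((), lo b)) B"
      and 2: "\<forall>a\<in>A. \<forall>a'\<in>A. (cy a, cz a) = (cy a', cz a') \<longrightarrow> lo a = lo a'"
    have "inj_on (\<lambda>a. (hi a, cy a, cz a)) A" "inj_on lo B" using 1 by (simp_all add: inj_on_def)
    then show ?thesis using 2 unfolding prod.inject by blast
  qed
qed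

context
  assumes cardA: "card A = p * (q * r)" and cardB: "card B = p"
begin

lemma cards_pqr:
  "card A = card ({..<p} \<times> {..<q} \<times> {..<r})" "card A = card ({..<p} \<times> {..<r} \<times> {..<q})"
  "card A = card ({..<q} \<times> {..<r} \<times> {..<p})" "card A = card ({..<r} \<times> {..<p} \<times> {..<q})"
  "card B = card {..<p}"
  using cardA cardB by (simp_all add: card_cartesian_product)

text \<open>When \<open>B\<close> has only first coordinates, the collision property adds nothing to the dichotomy.\<close>

lemma classification_card_pqr_trivial:
  assumes triv: "\<And>b. b \<in> B \<Longrightarrow> cy b = 0" "\<And>b. b \<in> B \<Longrightarrow> cz b = 0"
  shows "pair_pqr_cosets p q r A B \<or> pair_pqr_code_subgroup p q r A B"
  using dichotomy_pqr[OF cardA cardB]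
proof (elim disjE conjE)
  assume injA: "inj_on (\<lambda>a. (lo a, cy a, cz a)) A" and injB: "inj_on hi B" and lo_B: "\<forall>b\<in>B. lo b = 0"
  have imA: "(\<lambda>a. (lo a, cy a, cz a)) ` A \<subseteq> {..<p} \<times> {..<q} \<times> {..<r}" and imB: "hi ` B \<subseteq> {..<p}"
    using coords inc by auto
  obtain \<alpha> where \<alpha>: "\<alpha> (0, 0, 0) = 0" "\<forall>a\<in>A. \<alpha> (lo a, cy a, cz a) = int (hi a)"
    using exists_parameter_inj[where u = hi, OF injA zero_A zero_coords(2)] unfolding zero_coords by blast
  have "A = (\<lambda>(i, j, k). elt p q r (int i + \<alpha> (i, j, k) * int p) (int j) (int k)) ` ({..<p} \<times> {..<q} \<times> {..<r})"
    by (rule eq_family_imageI[OF injA imA _ cards_pqr(1)]) (use \<alpha> inc in \<open>auto intro!: elt_eqI_high\<close>)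
  moreover have "B = (\<lambda>i. elt p q r (int i * int p) 0 0) ` {..<p}"
    by (rule eq_family_imageI[OF injB imB _ cards_pqr(5)]) (use lo_B triv inc in \<open>auto intro!: elt_eqI_no_low\<close>)
  ultimately have "pair_pqr_code_subgroup p q r A B"
    unfolding pair_pqr_code_subgroup_def family_eq_image using \<alpha>(1) by (intro exI[of _ "\<lambda>i j k. \<alpha> (i, j, k)"]) simp
  then show ?thesis by blast
next
  assume injA0: "inj_on (\<lambda>a. (hi a, cy a, cz a)) A" and injB: "inj_on lo B"
    and cosets: "\<forall>a\<in>A. \<forall>a'\<in>A. cy a = cy a' \<longrightarrow> cz a = cz a' \<longrightarrow> lo a = lo a'"
  have injA: "inj_on (\<lambda>a. (cy a, cz a, hi a)) A" using injA0 by (simp add: inj_on_def)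
  have imA: "(\<lambda>a. (cy a, cz a, hi a)) ` A \<subseteq> {..<q} \<times> {..<r} \<times> {..<p}" and imB: "lo ` B \<subseteq> {..<p}"
    using coords inc by auto
  have cos: "lo a = lo a'" if "a \<in> A" "a' \<in> A" "(cy a, cz a) = (cy a', cz a')" for a a'
    using cosets that by blast
  obtain \<alpha> where \<alpha>: "\<alpha> (0, 0) = 0" "\<forall>a\<in>A. \<alpha> (cy a, cz a) = int (lo a)"
    using exists_parameter[where f = "\<lambda>a. (cy a, cz a)" and u = lo, OF zero_A zero_coords(1) cos]
    unfolding zero_coords by blast
  obtain l where l: "l 0 = 0" "\<forall>b\<in>B. l (lo b) = int (hi b)"
    using exists_parameter_inj[where u = hi, OF injB zero_B zero_coords(2)] unfolding zero_coords by blast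
  have "A = (\<lambda>(i, j, k). elt p q r (\<alpha> (i, j) + int k * int p) (int i) (int j)) ` ({..<q} \<times> {..<r} \<times> {..<p})"
    by (rule eq_family_imageI[OF injA imA _ cards_pqr(3)]) (use \<alpha> inc in \<open>auto intro!: elt_eqI_low\<close>)
  moreover have "B = (\<lambda>i. elt p q r (int i + l i * int p) 0 0) ` {..<p}"
    by (rule eq_family_imageI[OF injB imB _ cards_pqr(5)]) (use l triv inc in \<open>auto intro!: elt_eqI_high\<close>)
  ultimately have "pair_pqr_cosets p q r A B"
    unfolding pair_pqr_cosets_def family_eq_image using \<alpha>(1) l(1) by (intro exI[of _ "curry \<alpha>"] exI[of _ l]) simp
  then show ?thesis by blast
qed

text \<open>The nonzero second coordinate of \<open>b1\<close> can be matched with any second coordinate of a difference of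
  \<open>A\<close>. So the free digit in the first coordinate of \<open>A\<close> cannot depend on the second coordinate.\<close>

lemma classification_card_pqr_one_sided:
  assumes triv: "\<And>b. b \<in> B \<Longrightarrow> cz b = 0" and b1: "b1 \<in> B" "cy b1 \<noteq> 0"
  shows "pair_pqr_code_q p q r A B \<or> pair_pqr_cosets_code_q p q r A B"
  using dichotomy_pqr[OF cardA cardB]
proof (elim disjE conjE)
  assume injA0: "inj_on (\<lambda>a. (lo a, cy a, cz a)) A" and injB: "inj_on hi B" and lo_B: "\<forall>b\<in>B. lo b = 0"
  have injA: "inj_on (\<lambda>a. (lo a, cz a, cy a)) A" using injA0 by (simp add: inj_on_def)
  have imA: "(\<lambda>a. (lo a, cz a, cy a)) ` A \<subseteq> {..<p} \<times> {..<r} \<times> {..<q}" and imB: "hi ` B \<subseteq> {..<p}"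
    using coords inc by auto
  have "b1 \<noteq> (0, 0, 0)" using b1 by auto
  then have "hi b1 \<noteq> 0" using inj_onD[OF injB _ b1(1) zero_B] by auto
  then have hi_A: "hi a = hi a'" if "a \<in> A" "a' \<in> A" "(lo a, cz a) = (lo a', cz a')" for a a'
    using collision_pqr[OF cardA that(1,2) b1(1) zero_B] that(3) b1 lo_B by auto
  obtain \<alpha> where \<alpha>: "\<alpha> (0, 0) = 0" "\<forall>a\<in>A. \<alpha> (lo a, cz a) = int (hi a)"
    using exists_parameter[where f = "\<lambda>a. (lo a, cz a)" and u = hi, OF zero_A zero_coords(2) hi_A]
    unfolding zero_coords by blast
  obtain l where l: "l 0 = 0" "\<forall>b\<in>B. l (hi b) = int (cy b)"
    using exists_parameter_inj[where u = cy, OF injB zero_B zero_coords(3)] unfolding zero_coords by blast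
  have "A = (\<lambda>(i, j, k). elt p q r (int i + \<alpha> (i, j) * int p) (int k) (int j)) ` ({..<p} \<times> {..<r} \<times> {..<q})"
    by (rule eq_family_imageI[OF injA imA _ cards_pqr(2)]) (use \<alpha> inc in \<open>auto intro!: elt_eqI_high\<close>)
  moreover have "B = (\<lambda>i. elt p q r (int i * int p) (l i) 0) ` {..<p}"
    by (rule eq_family_imageI[OF injB imB _ cards_pqr(5)]) (use lo_B l triv inc in \<open>auto intro!: elt_eqI_no_low\<close>)
  ultimately have "pair_pqr_code_q p q r A B"
    unfolding pair_pqr_code_q_def family_eq_image using \<alpha>(1) l(1) by (intro exI[of _ "curry \<alpha>"] exI[of _ l]) simp
  then show ?thesis by blast
next
  assume injA0: "inj_on (\<lambda>a. (hi a, cy a, cz a)) A" and injB: "inj_on lo B"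
  have injA: "inj_on (\<lambda>a. (cz a, hi a, cy a)) A" using injA0 by (simp add: inj_on_def)
  have imA: "(\<lambda>a. (cz a, hi a, cy a)) ` A \<subseteq> {..<r} \<times> {..<p} \<times> {..<q}" and imB: "lo ` B \<subseteq> {..<p}"
    using coords inc by auto
  have "b1 \<noteq> (0, 0, 0)" using b1 by auto
  then have "lo b1 \<noteq> 0" using inj_onD[OF injB _ b1(1) zero_B] by auto
  then have lo_A: "lo a = lo a'" if "a \<in> A" "a' \<in> A" "cz a = cz a'" for a a'
    using collision_pqr[OF cardA that(1,2) b1(1) zero_B] that(3) b1 by auto
  obtain \<alpha> where \<alpha>: "\<alpha> 0 = 0" "\<forall>a\<in>A. \<alpha> (cz a) = int (lo a)"
    using exists_parameter[where f = cz and u = lo, OF zero_A zero_coords(1) lo_A] unfolding zero_coords by blast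
  obtain l1 where l1: "l1 0 = 0" "\<forall>b\<in>B. l1 (lo b) = int (hi b)"
    using exists_parameter_inj[where u = hi, OF injB zero_B zero_coords(2)] unfolding zero_coords by blast
  obtain l2 where l2: "l2 0 = 0" "\<forall>b\<in>B. l2 (lo b) = int (cy b)"
    using exists_parameter_inj[where u = cy, OF injB zero_B zero_coords(3)] unfolding zero_coords by blast
  obtain l where l: "l 0 = 0" "\<forall>b\<in>B. [l (lo b) = int (hi b)] (mod int (p\<^sup>2)) \<and> [l (lo b) = int (cy b)] (mod int q)"
    using combine_parameters[of l1 0 l2 "\<lambda>_. 0"] l1 l2 by metis
  have "A = (\<lambda>(i, j, k). elt p q r (\<alpha> i + int j * int p) (int k) (int i)) ` ({..<r} \<times> {..<p} \<times> {..<q})"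
    by (rule eq_family_imageI[OF injA imA _ cards_pqr(4)]) (use \<alpha> inc in \<open>auto intro!: elt_eqI_low\<close>)
  moreover have "B = (\<lambda>i. elt p q r (int i + l i * int p) (l i) 0) ` {..<p}"
    by (rule eq_family_imageI[OF injB imB _ cards_pqr(5)]) (use l triv inc in \<open>auto intro!: elt_eqI_high\<close>)
  ultimately have "pair_pqr_cosets_code_q p q r A B"
    unfolding pair_pqr_cosets_code_q_def family_eq_image using \<alpha>(1) l(1) by (intro exI[of _ \<alpha>] exI[of _ l]) simp
  then show ?thesis by blast
qed

text \<open>Now the free digit in the first coordinate of \<open>A\<close> depends neither on the second coordinate, by \<open>b1\<close>,
  nor on the third one, by \<open>b2\<close>. If \<open>A\<close> were built from cosets, then this digit would be \<open>lo\<close>, and \<open>A\<close>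
  would lie in the maximal subgroup of index \<open>p\<close>.\<close>

lemma classification_card_pqr_two_sided:
  assumes b1: "b1 \<in> B" "cy b1 \<noteq> 0" and b2: "b2 \<in> B" "cz b2 \<noteq> 0"
  shows "pair_pqr_code_qr p q r A B"
  using dichotomy_pqr[OF cardA cardB]
proof (elim disjE conjE)
  assume injA: "inj_on (\<lambda>a. (lo a, cy a, cz a)) A" and injB: "inj_on hi B" and lo_B: "\<forall>b\<in>B. lo b = 0"
  have imA: "(\<lambda>a. (lo a, cy a, cz a)) ` A \<subseteq> {..<p} \<times> {..<q} \<times> {..<r}" and imB: "hi ` B \<subseteq> {..<p}"
    using coords inc by auto
  have "b1 \<noteq> (0, 0, 0)" "b2 \<noteq> (0, 0, 0)" using b1 b2 by auto
  then have hi_b: "hi b1 \<noteq> 0" "hi b2 \<noteq> 0"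
    using inj_onD[OF injB _ b1(1) zero_B] inj_onD[OF injB _ b2(1) zero_B] by auto
  have hi_z: "hi a = hi a'" if "a \<in> A" "a' \<in> A" "lo a = lo a'" "cz a = cz a'" for a a'
    using collision_pqr[OF cardA that(1,2) b1(1) zero_B] that(3,4) b1 lo_B hi_b by auto
  have hi_y: "hi a = hi a'" if "a \<in> A" "a' \<in> A" "lo a = lo a'" "cy a = cy a'" for a a'
    using collision_pqr[OF cardA that(1,2) b2(1) zero_B] that(3,4) b2 lo_B hi_b by auto
  have hi_lo: "hi a = hi a'" if a: "a \<in> A" "a' \<in> A" "lo a = lo a'" for a a'
  proof -
    have "(lo a, cy a, cz a') \<in> {..<p} \<times> {..<q} \<times> {..<r}" using coords inc a by auto
    then obtain c where "c \<in> A" "(lo c, cy c, cz c) = (lo a, cy a, cz a')"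
      using exists_with_coordinates[OF injA imA _ cards_pqr(1)] by blast
    then show ?thesis using hi_y[of a c] hi_z[of c a'] a by simp
  qed
  obtain \<alpha> where \<alpha>: "\<alpha> 0 = 0" "\<forall>a\<in>A. \<alpha> (lo a) = int (hi a)"
    using exists_parameter[where f = lo and u = hi, OF zero_A zero_coords(2) hi_lo] unfolding zero_coords by blast
  obtain l1 where l1: "l1 0 = 0" "\<forall>b\<in>B. l1 (hi b) = int (cy b)"
    using exists_parameter_inj[where u = cy, OF injB zero_B zero_coords(3)] unfolding zero_coords by blast
  obtain l2 where l2: "l2 0 = 0" "\<forall>b\<in>B. l2 (hi b) = int (cz b)"
    using exists_parameter_inj[where u = cz, OF injB zero_B zero_coords(4)] unfolding zero_coords by blast
  obtain l where l: "l 0 = 0" "\<forall>b\<in>B. [l (hi b) = int (cy b)] (mod int q) \<and> [l (hi b) = int (cz b)] (mod int r)"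
    using combine_parameters[of "\<lambda>_. 0" 0 l1 l2] l1 l2 by metis
  have "A = (\<lambda>(i, j, k). elt p q r (int i + \<alpha> i * int p) (int j) (int k)) ` ({..<p} \<times> {..<q} \<times> {..<r})"
    by (rule eq_family_imageI[OF injA imA _ cards_pqr(1)]) (use \<alpha> inc in \<open>auto intro!: elt_eqI_high\<close>)
  moreover have "B = (\<lambda>i. elt p q r (int i * int p) (l i) (l i)) ` {..<p}"
    by (rule eq_family_imageI[OF injB imB _ cards_pqr(5)]) (use lo_B l inc in \<open>auto intro!: elt_eqI_no_low\<close>)
  ultimately show ?thesis
    unfolding pair_pqr_code_qr_def family_eq_image using \<alpha>(1) l(1) by (intro exI[of _ \<alpha>] exI[of _ l]) simp
next
  assume injA: "inj_on (\<lambda>a. (hi a, cy a, cz a)) A" and injB: "inj_on lo B"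
  have imA: "(\<lambda>a. (hi a, cy a, cz a)) ` A \<subseteq> {..<p} \<times> {..<q} \<times> {..<r}" using coords inc by auto
  have "b1 \<noteq> (0, 0, 0)" "b2 \<noteq> (0, 0, 0)" using b1 b2 by auto
  then have lo_b: "lo b1 \<noteq> 0" "lo b2 \<noteq> 0"
    using inj_onD[OF injB _ b1(1) zero_B] inj_onD[OF injB _ b2(1) zero_B] by auto
  have lo_z: "lo a = lo a'" if "a \<in> A" "a' \<in> A" "cz a = cz a'" for a a'
    using collision_pqr[OF cardA that(1,2) b1(1) zero_B] that(3) b1 lo_b by auto
  have lo_y: "lo a = lo a'" if "a \<in> A" "a' \<in> A" "cy a = cy a'" for a a'
    using collision_pqr[OF cardA that(1,2) b2(1) zero_B] that(3) b2 lo_b by auto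
  have "lo a = 0" if a: "a \<in> A" for a
  proof -
    have "(0, cy a, 0) \<in> {..<p} \<times> {..<q} \<times> {..<r}" using coords inc a pos by auto
    then obtain c where "c \<in> A" "(hi c, cy c, cz c) = (0, cy a, 0)"
      using exists_with_coordinates[OF injA imA _ cards_pqr(1)] by blast
    then show ?thesis using lo_y[of a c] lo_z[OF _ zero_A, of c] a by simp
  qed
  then show ?thesis using exists_nonzero(1) by metis
qed

end

end

section \<open>Exchanging the two simple cyclic factors\<close>

definition swap_qr :: "int \<times> int \<times> int \<Rightarrow> int \<times> int \<times> int" where
  "swap_qr a = (fst a, snd (snd a), fst (snd a))"

lemma swap_qr_swap_qr [simp]: "swap_qr (swap_qr a) = a"
  by (simp add: swap_qr_def)

lemma swap_qr_elt: "swap_qr (elt p q r x y z) = elt p r q x z y"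
  by (simp add: swap_qr_def elt_def)

lemma inj_swap_qr: "inj_on swap_qr A"
  by (rule inj_on_inverseI[of _ swap_qr]) simp

lemma swap_qr_image_eq_iff: "swap_qr ` A = swap_qr ` B \<longleftrightarrow> A = B"
  using inj_swap_qr by (rule inj_image_eq_iff)

lemma swap_qr_family:
  fixes P :: "'a \<Rightarrow> bool" and P' :: "'b \<Rightarrow> 'c \<Rightarrow> bool" and P'' :: "'d \<Rightarrow> 'e \<Rightarrow> 'f \<Rightarrow> bool"
  shows "swap_qr ` A = {elt p r q (x i) (z i) (y i) | i. P i} \<longleftrightarrow> A = {elt p q r (x i) (y i) (z i) | i. P i}"
  "swap_qr ` A = {elt p r q (x' i j) (z' i j) (y' i j) | i j. P' i j} \<longleftrightarrow>
     A = {elt p q r (x' i j) (y' i j) (z' i j) | i j. P' i j}"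
  "swap_qr ` A = {elt p r q (x'' i j k) (z'' i j k) (y'' i j k) | i j k. P'' i j k} \<longleftrightarrow>
     A = {elt p q r (x'' i j k) (y'' i j k) (z'' i j k) | i j k. P'' i j k}"
proof -
  have 1: "{elt p r q (x i) (z i) (y i) | i. P i} = swap_qr ` {elt p q r (x i) (y i) (z i) | i. P i}"
    unfolding swap_qr_elt[of p q r, symmetric] by blast
  show "swap_qr ` A = {elt p r q (x i) (z i) (y i) | i. P i} \<longleftrightarrow> A = {elt p q r (x i) (y i) (z i) | i. P i}"
    unfolding 1 by (rule swap_qr_image_eq_iff)
  have 2: "{elt p r q (x' i j) (z' i j) (y' i j) | i j. P' i j} =
      swap_qr ` {elt p q r (x' i j) (y' i j) (z' i j) | i j. P' i j}"
    unfolding swap_qr_elt[of p q r, symmetric] by blast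
  show "swap_qr ` A = {elt p r q (x' i j) (z' i j) (y' i j) | i j. P' i j} \<longleftrightarrow>
     A = {elt p q r (x' i j) (y' i j) (z' i j) | i j. P' i j}"
    unfolding 2 by (rule swap_qr_image_eq_iff)
  have 3: "{elt p r q (x'' i j k) (z'' i j k) (y'' i j k) | i j k. P'' i j k} =
      swap_qr ` {elt p q r (x'' i j k) (y'' i j k) (z'' i j k) | i j k. P'' i j k}"
    unfolding swap_qr_elt[of p q r, symmetric] by blast
  show "swap_qr ` A = {elt p r q (x'' i j k) (z'' i j k) (y'' i j k) | i j k. P'' i j k} \<longleftrightarrow>
     A = {elt p q r (x'' i j k) (y'' i j k) (z'' i j k) | i j k. P'' i j k}"
    unfolding 3 by (rule swap_qr_image_eq_iff)
qed

lemma factorization_swap_qr: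
  assumes pos: "p > 0" "q > 0" "r > 0" and f: "factorization (Zppqr p q r) A B"
  shows "factorization (Zppqr p r q) (swap_qr ` A) (swap_qr ` B)"
proof -
  have car: "swap_qr a \<in> carrier (Zppqr p r q) \<longleftrightarrow> a \<in> carrier (Zppqr p q r)" for a
    using pos by (cases a) (auto simp: carrier_Zppqr swap_qr_def)
  have mult: "swap_qr a \<otimes>\<^bsub>Zppqr p r q\<^esub> swap_qr b = swap_qr (a \<otimes>\<^bsub>Zppqr p q r\<^esub> b)" for a b
    unfolding mult_Zppqr swap_qr_elt by (simp add: swap_qr_def)
  interpret comm_group "Zppqr p r q" by (rule comm_group_Zppqr)
  show ?thesis
  proof (rule factorizationI_surj)
    show "finite (carrier (Zppqr p r q))" using pos by (simp add: carrier_Zppqr)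
    show "card (swap_qr ` A) * card (swap_qr ` B) \<le> order (Zppqr p r q)"
      using factorization_card[OF f] pos by (simp add: card_image inj_swap_qr order_Zppqr mult.assoc mult.commute)
    fix g assume "g \<in> carrier (Zppqr p r q)"
    then have "swap_qr g \<in> carrier (Zppqr p q r)" using car[of "swap_qr g"] by simp
    then obtain a b where "a \<in> A" "b \<in> B" "a \<otimes>\<^bsub>Zppqr p q r\<^esub> b = swap_qr g" using factorization_exists[OF f] by blast
    then show "\<exists>a\<in>swap_qr ` A. \<exists>b\<in>swap_qr ` B. a \<otimes>\<^bsub>Zppqr p r q\<^esub> b = g"
      using mult[of a b] by auto
  qed (use f car in \<open>auto simp: factorization_def monoid_axioms\<close>)
qed

context distinct_primes begin

text \<open>A common prime factor \<open>s\<close> of the orders satisfies \<open>s\<^sup>2 | p\<^sup>2 q r\<close>, which leaves \<open>s = p\<close>.\<close>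

lemma card_cases:
  assumes mn: "m * n = p\<^sup>2 * q * r" and nc: "\<not> coprime n m"
  shows "m = p \<and> n = p * (q * r) \<or> m = p * q \<and> n = p * r \<or> m = p * r \<and> n = p * q \<or> m = p * (q * r) \<and> n = p"
proof -
  obtain s where s: "prime s" "s dvd m" "s dvd n"
    using nc by (metis coprime_iff_gcd_eq_1 gcd_greatest_iff prime_factor_nat)
  have "s * s dvd m * n" using s(2,3) by (rule mult_dvd_mono)
  then have ss: "s\<^sup>2 dvd p\<^sup>2 * q * r" using mn by (simp add: power2_eq_square)
  have "s dvd p\<^sup>2 * q * r" using ss by (metis dvd_trans dvd_triv_left power2_eq_square)
  then have "s = p \<or> s = q \<or> s = r"
    using s(1) primes by (auto simp: prime_dvd_mult_iff prime_dvd_power_iff primes_dvd_imp_eq)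
  then have sp: "s = p" using prime_square_not_dvd ss by blast
  obtain m' n' where m': "m = p * m'" "n = p * n'" using s(2,3) unfolding sp by (auto elim!: dvdE)
  have mn': "m' * n' = q * r" using mn pos unfolding m' by (simp add: power2_eq_square)
  have pr: "x = 1 \<and> y = s \<or> x = s \<and> y = 1" if "x * y = s" "prime s" for x y s :: nat
    using prime_product[of x y] that by auto
  from mn' have "q dvd m' * n'" by simp
  then have "q dvd m' \<or> q dvd n'" using primes(2) prime_dvd_mult_iff by blast
  then have "m' = 1 \<and> n' = q * r \<or> m' = q \<and> n' = r \<or> m' = r \<and> n' = q \<or> m' = q * r \<and> n' = 1"
  proof
    assume "q dvd m'"
    then obtain k where k: "m' = q * k" by (elim dvdE)
    then have "k * n' = r" using mn' pos by simp
    then show ?thesis using pr[of k n' r] primes k by auto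
  next
    assume "q dvd n'"
    then obtain k where k: "n' = q * k" by (elim dvdE)
    then have "m' * k = r" using mn' pos by simp
    then show ?thesis using pr[of m' k r] primes k by auto
  qed
  then show ?thesis unfolding m' by auto
qed

end

lemma (in zppqr_factorization) zppqr_factorization_swap_qr:
  "zppqr_factorization p r q (swap_qr ` A) (swap_qr ` B)"
proof
  show "factorization (Zppqr p r q) (swap_qr ` A) (swap_qr ` B)"
    by (rule factorization_swap_qr[OF pos fact])
  have "swap_qr (0, 0, 0) = (0, 0, 0)" by (simp add: swap_qr_def)
  then show "(0, 0, 0) \<in> swap_qr ` A" "(0, 0, 0) \<in> swap_qr ` B"
    using zero_A zero_B by (metis image_eqI)+
qed (use primes distinct gen_p gen_q gen_r in \<open>auto simp: swap_qr_def\<close>)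

text \<open>The case in which \<open>A\<close> has order \<open>p r\<close> is the mirror image of order \<open>p q\<close>, and for order \<open>p q r\<close> a code whose
  third coordinates alone are not all zero is the mirror image of one with this property in the second
  coordinates.\<close>

lemma (in zppqr_factorization) classification:
  assumes "\<not> coprime (card B) (card A)"
  shows "pair_p p q r A B \<or>
    pair_pq_cosets_free_code p q r A B \<or>
    pair_pq_code_q_free p q r A B \<or>
    pair_pq_code_cosets p q r A B \<or>
    pair_pq_code_q_by_r p q r A B \<or>
    pair_pq_code_q_by_P p q r A B \<or>
    pair_pq_cosets_free_set p q r A B \<or>
    pair_pq_code_subgroup p q r A B \<or>
    pair_pq_cosets_free_code p r q (swap_qr ` A) (swap_qr ` B) \<or>
    pair_pq_code_q_free p r q (swap_qr ` A) (swap_qr ` B) \<or>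
    pair_pq_code_cosets p r q (swap_qr ` A) (swap_qr ` B) \<or>
    pair_pq_code_q_by_r p r q (swap_qr ` A) (swap_qr ` B) \<or>
    pair_pq_code_q_by_P p r q (swap_qr ` A) (swap_qr ` B) \<or>
    pair_pq_cosets_free_set p r q (swap_qr ` A) (swap_qr ` B) \<or>
    pair_pq_code_subgroup p r q (swap_qr ` A) (swap_qr ` B) \<or>
    pair_pqr_cosets p q r A B \<or>
    pair_pqr_code_q p q r A B \<or>
    pair_pqr_code_q p r q (swap_qr ` A) (swap_qr ` B) \<or>
    pair_pqr_cosets_code_q p q r A B \<or>
    pair_pqr_cosets_code_q p r q (swap_qr ` A) (swap_qr ` B) \<or>
    pair_pqr_code_qr p q r A B \<or>
    pair_pqr_code_subgroup p q r A B"
proof -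
  interpret swapped: zppqr_factorization p r q "swap_qr ` A" "swap_qr ` B"
    by (rule zppqr_factorization_swap_qr)
  have card_sw: "card (swap_qr ` A) = card A" "card (swap_qr ` B) = card B" by (simp_all add: card_image inj_swap_qr)
  have "card A * card B = p\<^sup>2 * q * r" using factorization_card[OF fact] order_Zppqr pos by simp
  then consider "card A = p" "card B = p * (q * r)" | "card A = p * q" "card B = p * r"
    | "card A = p * r" "card B = p * q" | "card A = p * (q * r)" "card B = p"
    using card_cases assms by blast
  then show ?thesis
  proof cases
    case 1
    then show ?thesis using classification_card_p by blast
  next
    case 2
    then show ?thesis using classification_card_pq by blast
  next
    case 3
    then show ?thesis using swapped.classification_card_pq unfolding card_sw by blast
  next
    case 4
    have card_pqr: "card (swap_qr ` A) = p * (r * q)" "card (swap_qr ` B) = p" using 4 card_sw by (simp_all add: mult.commute)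
    have swc: "swapped.cy (swap_qr b) = cz b" "swapped.cz (swap_qr b) = cy b" for b
      by (simp_all add: swap_qr_def cy_def cz_def swapped.cy_def swapped.cz_def)
    consider "\<forall>b\<in>B. cy b = 0" "\<forall>b\<in>B. cz b = 0" | b where "\<forall>b\<in>B. cz b = 0" "b \<in> B" "cy b \<noteq> 0"
      | b where "\<forall>b\<in>B. cy b = 0" "b \<in> B" "cz b \<noteq> 0" | b c where "b \<in> B" "cy b \<noteq> 0" "c \<in> B" "cz c \<noteq> 0"
      by metis
    then show ?thesis
    proof cases
      case 1
      then show ?thesis using classification_card_pqr_trivial[OF 4] by blast
    next
      case 2
      then show ?thesis using classification_card_pqr_one_sided[OF 4] by blast
    next
      case (3 b)
      have "pair_pqr_code_q p r q (swap_qr ` A) (swap_qr ` B) \<or> pair_pqr_cosets_code_q p r q (swap_qr ` A) (swap_qr ` B)"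
        by (rule swapped.classification_card_pqr_one_sided[OF card_pqr, of "swap_qr b"]) (use 3 swc in auto)
      then show ?thesis by blast
    next
      case (4 b c)
      then show ?thesis using classification_card_pqr_two_sided[OF \<open>card A = p * (q * r)\<close> \<open>card B = p\<close>] by blast
    qed
  qed
qed


section \<open>The classification of perfect codes\<close>

theorem theorem6p7:
  fixes p q r :: nat
    and G :: "(int \<times> int \<times> int) monoid"
    and S C :: "(int \<times> int \<times> int) set"
  assumes "prime p" and "prime q" and "prime r"
    and "p \<noteq> q" and "p \<noteq> r" and "q \<noteq> r"
    and "G = Zppqr p q r"
    and "S \<subset> carrier G - {\<one>\<^bsub>G\<^esub>}"
    and "generate G S = carrier G"
    and "\<one>\<^bsub>G\<^esub> \<in> C" and "C \<subseteq> carrier G"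
    and "\<not> coprime (card C) (card (insert \<one>\<^bsub>G\<^esub> S))"
  shows "perfect_code (with_proj (cayley_digraph G S)) C \<longleftrightarrow>
    (\<exists>(\<alpha>\<^sub>1 :: nat \<Rightarrow> int) (\<alpha>\<^sub>2 :: nat \<Rightarrow> nat \<Rightarrow> int) (\<alpha>\<^sub>3 :: nat \<Rightarrow> nat \<Rightarrow> nat \<Rightarrow> int)
      (\<beta>\<^sub>1 :: nat \<Rightarrow> int) (\<beta>\<^sub>2 :: nat \<Rightarrow> nat \<Rightarrow> int)
      (l\<^sub>1 :: nat \<Rightarrow> int) (l\<^sub>2 :: nat \<Rightarrow> nat \<Rightarrow> int).
      \<alpha>\<^sub>1 0 = 0 \<and> \<alpha>\<^sub>2 0 0 = 0 \<and> \<alpha>\<^sub>3 0 0 0 = 0 \<and> \<beta>\<^sub>1 0 = 0 \<and> \<beta>\<^sub>2 0 0 = 0 \<and> l\<^sub>1 0 = 0 \<and> l\<^sub>2 0 0 = 0 \<and>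
      (
       (insert \<one>\<^bsub>G\<^esub> S = {elt p q r (int i + \<alpha>\<^sub>1 i * int p) (\<alpha>\<^sub>1 i) (\<alpha>\<^sub>1 i) | i. i < p} \<and>
        C = {elt p q r (int i * int p) (int j) (int k) | i j k. i < p \<and> j < q \<and> k < r}) \<or>
       (insert \<one>\<^bsub>G\<^esub> S = {elt p q r (\<alpha>\<^sub>1 i + int j * int p) (int i) (\<beta>\<^sub>1 i) | i j. i < q \<and> j < p} \<and>
        C = {elt p q r (int i + l\<^sub>2 i j * int p) 0 (int j) | i j. i < p \<and> j < r}) \<or>
       (insert \<one>\<^bsub>G\<^esub> S = {elt p q r (int i + \<alpha>\<^sub>1 i * int p) (int j) (\<alpha>\<^sub>1 i) | i j. i < p \<and> j < q} \<and>
        C = {elt p q r (int i * int p) (l\<^sub>2 i j) (int j) | i j. i < p \<and> j < r}) \<or>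
       (insert \<one>\<^bsub>G\<^esub> S = {elt p q r (int j + \<alpha>\<^sub>2 i j * int p) (int i) (\<alpha>\<^sub>1 i) | i j. i < q \<and> j < p} \<and>
        C = {elt p q r (l\<^sub>1 i + int j * int p) 0 (int i) | i j. i < r \<and> j < p}) \<or>
       (insert \<one>\<^bsub>G\<^esub> S = {elt p q r (int i + \<alpha>\<^sub>2 i j * int p) (int j) (\<alpha>\<^sub>1 i) | i j. i < p \<and> j < q} \<and>
        C = {elt p q r (int j * int p) (l\<^sub>1 i) (int i) | i j. i < r \<and> j < p}) \<or>
       (insert \<one>\<^bsub>G\<^esub> S = {elt p q r (int i + \<alpha>\<^sub>1 i * int p) (int j) (\<alpha>\<^sub>2 i j) | i j. i < p \<and> j < q} \<and>
        C = {elt p q r (int i * int p) (l\<^sub>1 i) (int j) | i j. i < p \<and> j < r}) \<or>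
       (insert \<one>\<^bsub>G\<^esub> S = {elt p q r (\<alpha>\<^sub>1 i + int j * int p) (int i) (\<alpha>\<^sub>2 i j) | i j. i < q \<and> j < p} \<and>
        C = {elt p q r (int i + l\<^sub>1 i * int p) 0 (int j) | i j. i < p \<and> j < r}) \<or>
       (insert \<one>\<^bsub>G\<^esub> S = {elt p q r (int i + \<alpha>\<^sub>2 i j * int p) (int j) (\<beta>\<^sub>2 i j) | i j. i < p \<and> j < q} \<and>
        C = {elt p q r (int i * int p) 0 (int j) | i j. i < p \<and> j < r}) \<or>
       (insert \<one>\<^bsub>G\<^esub> S = {elt p q r (\<alpha>\<^sub>1 i + int j * int p) (\<beta>\<^sub>1 i) (int i) | i j. i < r \<and> j < p} \<and>
        C = {elt p q r (int i + l\<^sub>2 i j * int p) (int j) 0 | i j. i < p \<and> j < q}) \<or>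
       (insert \<one>\<^bsub>G\<^esub> S = {elt p q r (int i + \<alpha>\<^sub>1 i * int p) (\<alpha>\<^sub>1 i) (int j) | i j. i < p \<and> j < r} \<and>
        C = {elt p q r (int i * int p) (int j) (l\<^sub>2 i j) | i j. i < p \<and> j < q}) \<or>
       (insert \<one>\<^bsub>G\<^esub> S = {elt p q r (int j + \<alpha>\<^sub>2 i j * int p) (\<alpha>\<^sub>1 i) (int i) | i j. i < r \<and> j < p} \<and>
        C = {elt p q r (l\<^sub>1 i + int j * int p) (int i) 0 | i j. i < q \<and> j < p}) \<or>
       (insert \<one>\<^bsub>G\<^esub> S = {elt p q r (int i + \<alpha>\<^sub>2 i j * int p) (\<alpha>\<^sub>1 i) (int j) | i j. i < p \<and> j < r} \<and>
        C = {elt p q r (int j * int p) (int i) (l\<^sub>1 i) | i j. i < q \<and> j < p}) \<or>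
       (insert \<one>\<^bsub>G\<^esub> S = {elt p q r (int i + \<alpha>\<^sub>1 i * int p) (\<alpha>\<^sub>2 i j) (int j) | i j. i < p \<and> j < r} \<and>
        C = {elt p q r (int i * int p) (int j) (l\<^sub>1 i) | i j. i < p \<and> j < q}) \<or>
       (insert \<one>\<^bsub>G\<^esub> S = {elt p q r (\<alpha>\<^sub>1 i + int j * int p) (\<alpha>\<^sub>2 i j) (int i) | i j. i < r \<and> j < p} \<and>
        C = {elt p q r (int i + l\<^sub>1 i * int p) (int j) 0 | i j. i < p \<and> j < q}) \<or>
       (insert \<one>\<^bsub>G\<^esub> S = {elt p q r (int i + \<alpha>\<^sub>2 i j * int p) (\<beta>\<^sub>2 i j) (int j) | i j. i < p \<and> j < r} \<and>
        C = {elt p q r (int i * int p) (int j) 0 | i j. i < p \<and> j < q}) \<or>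
       (insert \<one>\<^bsub>G\<^esub> S = {elt p q r (\<alpha>\<^sub>2 i j + int k * int p) (int i) (int j) | i j k. i < q \<and> j < r \<and> k < p} \<and>
        C = {elt p q r (int i + l\<^sub>1 i * int p) 0 0 | i. i < p}) \<or>
       (insert \<one>\<^bsub>G\<^esub> S = {elt p q r (int i + \<alpha>\<^sub>2 i j * int p) (int k) (int j) | i j k. i < p \<and> j < r \<and> k < q} \<and>
        C = {elt p q r (int i * int p) (l\<^sub>1 i) 0 | i. i < p}) \<or>
       (insert \<one>\<^bsub>G\<^esub> S = {elt p q r (int i + \<alpha>\<^sub>2 i j * int p) (int j) (int k) | i j k. i < p \<and> j < q \<and> k < r} \<and>
        C = {elt p q r (int i * int p) 0 (l\<^sub>1 i) | i. i < p}) \<or>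
       (insert \<one>\<^bsub>G\<^esub> S = {elt p q r (\<alpha>\<^sub>1 i + int j * int p) (int k) (int i) | i j k. i < r \<and> j < p \<and> k < q} \<and>
        C = {elt p q r (int i + l\<^sub>1 i * int p) (l\<^sub>1 i) 0 | i. i < p}) \<or>
       (insert \<one>\<^bsub>G\<^esub> S = {elt p q r (\<alpha>\<^sub>1 i + int j * int p) (int i) (int k) | i j k. i < q \<and> j < p \<and> k < r} \<and>
        C = {elt p q r (int i + l\<^sub>1 i * int p) 0 (l\<^sub>1 i) | i. i < p}) \<or>
       (insert \<one>\<^bsub>G\<^esub> S = {elt p q r (int i + \<alpha>\<^sub>1 i * int p) (int j) (int k) | i j k. i < p \<and> j < q \<and> k < r} \<and>
        C = {elt p q r (int i * int p) (l\<^sub>1 i) (l\<^sub>1 i) | i. i < p}) \<or>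
       (insert \<one>\<^bsub>G\<^esub> S = {elt p q r (int i + \<alpha>\<^sub>3 i j k * int p) (int j) (int k) | i j k. i < p \<and> j < q \<and> k < r} \<and>
        C = {elt p q r (int i * int p) 0 0 | i. i < p})))" (is "_ \<longleftrightarrow> ?R" is "_ \<longleftrightarrow> (\<exists>a1 a2 a3 b1 b2 l1 l2. ?Q a1 a2 a3 b1 b2 l1 l2)")
proof -
  let ?A = "insert \<one>\<^bsub>G\<^esub> S"
  have dp: "distinct_primes p q r" "distinct_primes p r q" using assms(1-6) by unfold_locales auto
  note pos = distinct_primes.pos[OF dp(1)]
  have one: "\<one>\<^bsub>G\<^esub> = (0, 0, 0)" using assms(7) by simp
  interpret comm_group G unfolding assms(7) by (rule comm_group_Zppqr)
  have S: "S \<subseteq> carrier G" using assms(8) by blast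
  have "perfect_code (with_proj (cayley_digraph G S)) C \<longleftrightarrow> factorization (Zppqr p q r) ?A C"
    using perfect_code_iff_factorization[OF is_group S assms(11)] unfolding assms(7) .
  also have "\<dots> \<longleftrightarrow> ?R"
  proof
    assume f: "factorization (Zppqr p q r) ?A C"
    have mult: "a \<otimes>\<^bsub>G\<^esub> b = elt p q r (fst a + fst b) (fst (snd a) + fst (snd b)) (snd (snd a) + snd (snd b))" for a b
      unfolding assms(7) by (rule mult_Zppqr)
    have g: "elt p q r 1 1 1 \<in> carrier G" using elt_in_carrier[OF pos] assms(7) by simp
    have big: "\<not> int p dvd 1" "\<not> int q dvd 1" "\<not> int r dvd 1" using assms(1-3) by auto
    have pp: "int p dvd int (p\<^sup>2)" by (simp add: power2_eq_square)
    have "\<exists>s\<in>S. \<not> int p dvd fst s"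
      by (rule generating_set_not_in_kernel[OF is_group S assms(9) _ g])
        (use big pp in \<open>auto simp: mult elt_def cong_def mod_mod_cancel dvd_mod_iff\<close>)
    moreover have "\<exists>s\<in>S. \<not> int q dvd fst (snd s)"
      by (rule generating_set_not_in_kernel[OF is_group S assms(9) _ g])
        (use big in \<open>auto simp: mult elt_def cong_def dvd_mod_iff\<close>)
    moreover have "\<exists>s\<in>S. \<not> int r dvd snd (snd s)"
      by (rule generating_set_not_in_kernel[OF is_group S assms(9) _ g])
        (use big in \<open>auto simp: mult elt_def cong_def dvd_mod_iff\<close>)
    ultimately have gens: "\<exists>a\<in>?A. fst a mod int p \<noteq> 0" "\<exists>a\<in>?A. fst (snd a) \<noteq> 0" "\<exists>a\<in>?A. snd (snd a) \<noteq> 0"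
      by (metis dvd_eq_mod_eq_0 insertCI, metis dvd_0_right insertCI, metis dvd_0_right insertCI)
    interpret zf: zppqr_factorization p q r ?A C
      by (intro zppqr_factorization.intro dp zppqr_factorization_axioms.intro f gens) (use assms(10) one in auto)
    (* From a family to the list: parameters that do not occur in the family are set to zero. *)
    have p: ?R if "pair_p p q r ?A C"
      using that unfolding pair_p_def
    proof (elim exE conjE, goal_cases)
      case (1 \<alpha>)
      show ?case
        by (rule exI[of _ "\<alpha>"], rule exI[of _ "\<lambda>_ _. 0"], rule exI[of _ "\<lambda>_ _ _. 0"], rule exI[of _ "\<lambda>_. 0"], rule exI[of _ "\<lambda>_ _. 0"], rule exI[of _ "\<lambda>_. 0"], rule exI[of _ "\<lambda>_ _. 0"],
            (rule conjI, (fact 1 | rule refl))+, ((rule conjI | (rule disjI1, rule conjI)), fact 1, fact 1 | rule disjI2)+)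
    qed
    have pq_cosets_free_code: ?R if "pair_pq_cosets_free_code p q r ?A C"
      using that unfolding pair_pq_cosets_free_code_def
    proof (elim exE conjE, goal_cases)
      case (1 \<alpha> \<beta> l)
      show ?case
        by (rule exI[of _ "\<alpha>"], rule exI[of _ "\<lambda>_ _. 0"], rule exI[of _ "\<lambda>_ _ _. 0"], rule exI[of _ "\<beta>"], rule exI[of _ "\<lambda>_ _. 0"], rule exI[of _ "\<lambda>_. 0"], rule exI[of _ "l"],
            (rule conjI, (fact 1 | rule refl))+, ((rule conjI | (rule disjI1, rule conjI)), fact 1, fact 1 | rule disjI2)+)
    qed
    have pq_code_q_free: ?R if "pair_pq_code_q_free p q r ?A C"
      using that unfolding pair_pq_code_q_free_def
    proof (elim exE conjE, goal_cases)
      case (1 \<alpha> l)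
      show ?case
        by (rule exI[of _ "\<alpha>"], rule exI[of _ "\<lambda>_ _. 0"], rule exI[of _ "\<lambda>_ _ _. 0"], rule exI[of _ "\<lambda>_. 0"], rule exI[of _ "\<lambda>_ _. 0"], rule exI[of _ "\<lambda>_. 0"], rule exI[of _ "l"],
            (rule conjI, (fact 1 | rule refl))+, ((rule conjI | (rule disjI1, rule conjI)), fact 1, fact 1 | rule disjI2)+)
    qed
    have pq_code_cosets: ?R if "pair_pq_code_cosets p q r ?A C"
      using that unfolding pair_pq_code_cosets_def
    proof (elim exE conjE, goal_cases)
      case (1 \<alpha> \<beta> l)
      show ?case
        by (rule exI[of _ "\<beta>"], rule exI[of _ "\<alpha>"], rule exI[of _ "\<lambda>_ _ _. 0"], rule exI[of _ "\<lambda>_. 0"], rule exI[of _ "\<lambda>_ _. 0"], rule exI[of _ "l"], rule exI[of _ "\<lambda>_ _. 0"],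
            (rule conjI, (fact 1 | rule refl))+, ((rule conjI | (rule disjI1, rule conjI)), fact 1, fact 1 | rule disjI2)+)
    qed
    have pq_code_q_by_r: ?R if "pair_pq_code_q_by_r p q r ?A C"
      using that unfolding pair_pq_code_q_by_r_def
    proof (elim exE conjE, goal_cases)
      case (1 \<alpha> \<beta> l)
      show ?case
        by (rule exI[of _ "\<beta>"], rule exI[of _ "\<alpha>"], rule exI[of _ "\<lambda>_ _ _. 0"], rule exI[of _ "\<lambda>_. 0"], rule exI[of _ "\<lambda>_ _. 0"], rule exI[of _ "l"], rule exI[of _ "\<lambda>_ _. 0"],
            (rule conjI, (fact 1 | rule refl))+, ((rule conjI | (rule disjI1, rule conjI)), fact 1, fact 1 | rule disjI2)+)
    qed
    have pq_code_q_by_P: ?R if "pair_pq_code_q_by_P p q r ?A C"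
      using that unfolding pair_pq_code_q_by_P_def
    proof (elim exE conjE, goal_cases)
      case (1 \<alpha> \<beta> l)
      show ?case
        by (rule exI[of _ "\<alpha>"], rule exI[of _ "\<beta>"], rule exI[of _ "\<lambda>_ _ _. 0"], rule exI[of _ "\<lambda>_. 0"], rule exI[of _ "\<lambda>_ _. 0"], rule exI[of _ "l"], rule exI[of _ "\<lambda>_ _. 0"],
            (rule conjI, (fact 1 | rule refl))+, ((rule conjI | (rule disjI1, rule conjI)), fact 1, fact 1 | rule disjI2)+)
    qed
    have pq_cosets_free_set: ?R if "pair_pq_cosets_free_set p q r ?A C"
      using that unfolding pair_pq_cosets_free_set_def
    proof (elim exE conjE, goal_cases)
      case (1 \<alpha> \<beta> l)
      show ?case
        by (rule exI[of _ "\<alpha>"], rule exI[of _ "\<beta>"], rule exI[of _ "\<lambda>_ _ _. 0"], rule exI[of _ "\<lambda>_. 0"], rule exI[of _ "\<lambda>_ _. 0"], rule exI[of _ "l"], rule exI[of _ "\<lambda>_ _. 0"],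
            (rule conjI, (fact 1 | rule refl))+, ((rule conjI | (rule disjI1, rule conjI)), fact 1, fact 1 | rule disjI2)+)
    qed
    have pq_code_subgroup: ?R if "pair_pq_code_subgroup p q r ?A C"
      using that unfolding pair_pq_code_subgroup_def
    proof (elim exE conjE, goal_cases)
      case (1 \<alpha> \<beta>)
      show ?case
        by (rule exI[of _ "\<lambda>_. 0"], rule exI[of _ "\<alpha>"], rule exI[of _ "\<lambda>_ _ _. 0"], rule exI[of _ "\<lambda>_. 0"], rule exI[of _ "\<beta>"], rule exI[of _ "\<lambda>_. 0"], rule exI[of _ "\<lambda>_ _. 0"],
            (rule conjI, (fact 1 | rule refl))+, ((rule conjI | (rule disjI1, rule conjI)), fact 1, fact 1 | rule disjI2)+)
    qed
    have pq_cosets_free_code_swap: ?R if "pair_pq_cosets_free_code p r q (swap_qr ` ?A) (swap_qr ` C)"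
      using that unfolding pair_pq_cosets_free_code_def swap_qr_family
    proof (elim exE conjE, goal_cases)
      case (1 \<alpha> \<beta> l)
      show ?case
        by (rule exI[of _ "\<alpha>"], rule exI[of _ "\<lambda>_ _. 0"], rule exI[of _ "\<lambda>_ _ _. 0"], rule exI[of _ "\<beta>"], rule exI[of _ "\<lambda>_ _. 0"], rule exI[of _ "\<lambda>_. 0"], rule exI[of _ "l"],
            (rule conjI, (fact 1 | rule refl))+, ((rule conjI | (rule disjI1, rule conjI)), fact 1, fact 1 | rule disjI2)+)
    qed
    have pq_code_q_free_swap: ?R if "pair_pq_code_q_free p r q (swap_qr ` ?A) (swap_qr ` C)"
      using that unfolding pair_pq_code_q_free_def swap_qr_family
    proof (elim exE conjE, goal_cases)
      case (1 \<alpha> l)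
      show ?case
        by (rule exI[of _ "\<alpha>"], rule exI[of _ "\<lambda>_ _. 0"], rule exI[of _ "\<lambda>_ _ _. 0"], rule exI[of _ "\<lambda>_. 0"], rule exI[of _ "\<lambda>_ _. 0"], rule exI[of _ "\<lambda>_. 0"], rule exI[of _ "l"],
            (rule conjI, (fact 1 | rule refl))+, ((rule conjI | (rule disjI1, rule conjI)), fact 1, fact 1 | rule disjI2)+)
    qed
    have pq_code_cosets_swap: ?R if "pair_pq_code_cosets p r q (swap_qr ` ?A) (swap_qr ` C)"
      using that unfolding pair_pq_code_cosets_def swap_qr_family
    proof (elim exE conjE, goal_cases)
      case (1 \<alpha> \<beta> l)
      show ?case
        by (rule exI[of _ "\<beta>"], rule exI[of _ "\<alpha>"], rule exI[of _ "\<lambda>_ _ _. 0"], rule exI[of _ "\<lambda>_. 0"], rule exI[of _ "\<lambda>_ _. 0"], rule exI[of _ "l"], rule exI[of _ "\<lambda>_ _. 0"],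
            (rule conjI, (fact 1 | rule refl))+, ((rule conjI | (rule disjI1, rule conjI)), fact 1, fact 1 | rule disjI2)+)
    qed
    have pq_code_q_by_r_swap: ?R if "pair_pq_code_q_by_r p r q (swap_qr ` ?A) (swap_qr ` C)"
      using that unfolding pair_pq_code_q_by_r_def swap_qr_family
    proof (elim exE conjE, goal_cases)
      case (1 \<alpha> \<beta> l)
      show ?case
        by (rule exI[of _ "\<beta>"], rule exI[of _ "\<alpha>"], rule exI[of _ "\<lambda>_ _ _. 0"], rule exI[of _ "\<lambda>_. 0"], rule exI[of _ "\<lambda>_ _. 0"], rule exI[of _ "l"], rule exI[of _ "\<lambda>_ _. 0"],
            (rule conjI, (fact 1 | rule refl))+, ((rule conjI | (rule disjI1, rule conjI)), fact 1, fact 1 | rule disjI2)+)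
    qed
    have pq_code_q_by_P_swap: ?R if "pair_pq_code_q_by_P p r q (swap_qr ` ?A) (swap_qr ` C)"
      using that unfolding pair_pq_code_q_by_P_def swap_qr_family
    proof (elim exE conjE, goal_cases)
      case (1 \<alpha> \<beta> l)
      show ?case
        by (rule exI[of _ "\<alpha>"], rule exI[of _ "\<beta>"], rule exI[of _ "\<lambda>_ _ _. 0"], rule exI[of _ "\<lambda>_. 0"], rule exI[of _ "\<lambda>_ _. 0"], rule exI[of _ "l"], rule exI[of _ "\<lambda>_ _. 0"],
            (rule conjI, (fact 1 | rule refl))+, ((rule conjI | (rule disjI1, rule conjI)), fact 1, fact 1 | rule disjI2)+)
    qed
    have pq_cosets_free_set_swap: ?R if "pair_pq_cosets_free_set p r q (swap_qr ` ?A) (swap_qr ` C)"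
      using that unfolding pair_pq_cosets_free_set_def swap_qr_family
    proof (elim exE conjE, goal_cases)
      case (1 \<alpha> \<beta> l)
      show ?case
        by (rule exI[of _ "\<alpha>"], rule exI[of _ "\<beta>"], rule exI[of _ "\<lambda>_ _ _. 0"], rule exI[of _ "\<lambda>_. 0"], rule exI[of _ "\<lambda>_ _. 0"], rule exI[of _ "l"], rule exI[of _ "\<lambda>_ _. 0"],
            (rule conjI, (fact 1 | rule refl))+, ((rule conjI | (rule disjI1, rule conjI)), fact 1, fact 1 | rule disjI2)+)
    qed
    have pq_code_subgroup_swap: ?R if "pair_pq_code_subgroup p r q (swap_qr ` ?A) (swap_qr ` C)"
      using that unfolding pair_pq_code_subgroup_def swap_qr_family
    proof (elim exE conjE, goal_cases)
      case (1 \<alpha> \<beta>)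
      show ?case
        by (rule exI[of _ "\<lambda>_. 0"], rule exI[of _ "\<alpha>"], rule exI[of _ "\<lambda>_ _ _. 0"], rule exI[of _ "\<lambda>_. 0"], rule exI[of _ "\<beta>"], rule exI[of _ "\<lambda>_. 0"], rule exI[of _ "\<lambda>_ _. 0"],
            (rule conjI, (fact 1 | rule refl))+, ((rule conjI | (rule disjI1, rule conjI)), fact 1, fact 1 | rule disjI2)+)
    qed
    have pqr_cosets: ?R if "pair_pqr_cosets p q r ?A C"
      using that unfolding pair_pqr_cosets_def
    proof (elim exE conjE, goal_cases)
      case (1 \<alpha> l)
      show ?case
        by (rule exI[of _ "\<lambda>_. 0"], rule exI[of _ "\<alpha>"], rule exI[of _ "\<lambda>_ _ _. 0"], rule exI[of _ "\<lambda>_. 0"], rule exI[of _ "\<lambda>_ _. 0"], rule exI[of _ "l"], rule exI[of _ "\<lambda>_ _. 0"],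
            (rule conjI, (fact 1 | rule refl))+, ((rule conjI | (rule disjI1, rule conjI)), fact 1, fact 1 | rule disjI2)+)
    qed
    have pqr_code_q: ?R if "pair_pqr_code_q p q r ?A C"
      using that unfolding pair_pqr_code_q_def
    proof (elim exE conjE, goal_cases)
      case (1 \<alpha> l)
      show ?case
        by (rule exI[of _ "\<lambda>_. 0"], rule exI[of _ "\<alpha>"], rule exI[of _ "\<lambda>_ _ _. 0"], rule exI[of _ "\<lambda>_. 0"], rule exI[of _ "\<lambda>_ _. 0"], rule exI[of _ "l"], rule exI[of _ "\<lambda>_ _. 0"],
            (rule conjI, (fact 1 | rule refl))+, ((rule conjI | (rule disjI1, rule conjI)), fact 1, fact 1 | rule disjI2)+)
    qed
    have pqr_code_q_swap: ?R if "pair_pqr_code_q p r q (swap_qr ` ?A) (swap_qr ` C)"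
      using that unfolding pair_pqr_code_q_def swap_qr_family
    proof (elim exE conjE, goal_cases)
      case (1 \<alpha> l)
      show ?case
        by (rule exI[of _ "\<lambda>_. 0"], rule exI[of _ "\<alpha>"], rule exI[of _ "\<lambda>_ _ _. 0"], rule exI[of _ "\<lambda>_. 0"], rule exI[of _ "\<lambda>_ _. 0"], rule exI[of _ "l"], rule exI[of _ "\<lambda>_ _. 0"],
            (rule conjI, (fact 1 | rule refl))+, ((rule conjI | (rule disjI1, rule conjI)), fact 1, fact 1 | rule disjI2)+)
    qed
    have pqr_cosets_code_q: ?R if "pair_pqr_cosets_code_q p q r ?A C"
      using that unfolding pair_pqr_cosets_code_q_def
    proof (elim exE conjE, goal_cases)
      case (1 \<alpha> l)
      show ?case
        by (rule exI[of _ "\<alpha>"], rule exI[of _ "\<lambda>_ _. 0"], rule exI[of _ "\<lambda>_ _ _. 0"], rule exI[of _ "\<lambda>_. 0"], rule exI[of _ "\<lambda>_ _. 0"], rule exI[of _ "l"], rule exI[of _ "\<lambda>_ _. 0"],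
            (rule conjI, (fact 1 | rule refl))+, ((rule conjI | (rule disjI1, rule conjI)), fact 1, fact 1 | rule disjI2)+)
    qed
    have pqr_cosets_code_q_swap: ?R if "pair_pqr_cosets_code_q p r q (swap_qr ` ?A) (swap_qr ` C)"
      using that unfolding pair_pqr_cosets_code_q_def swap_qr_family
    proof (elim exE conjE, goal_cases)
      case (1 \<alpha> l)
      show ?case
        by (rule exI[of _ "\<alpha>"], rule exI[of _ "\<lambda>_ _. 0"], rule exI[of _ "\<lambda>_ _ _. 0"], rule exI[of _ "\<lambda>_. 0"], rule exI[of _ "\<lambda>_ _. 0"], rule exI[of _ "l"], rule exI[of _ "\<lambda>_ _. 0"],
            (rule conjI, (fact 1 | rule refl))+, ((rule conjI | (rule disjI1, rule conjI)), fact 1, fact 1 | rule disjI2)+)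
    qed
    have pqr_code_qr: ?R if "pair_pqr_code_qr p q r ?A C"
      using that unfolding pair_pqr_code_qr_def
    proof (elim exE conjE, goal_cases)
      case (1 \<alpha> l)
      show ?case
        by (rule exI[of _ "\<alpha>"], rule exI[of _ "\<lambda>_ _. 0"], rule exI[of _ "\<lambda>_ _ _. 0"], rule exI[of _ "\<lambda>_. 0"], rule exI[of _ "\<lambda>_ _. 0"], rule exI[of _ "l"], rule exI[of _ "\<lambda>_ _. 0"],
            (rule conjI, (fact 1 | rule refl))+, ((rule conjI | (rule disjI1, rule conjI)), fact 1, fact 1 | rule disjI2)+)
    qed
    have pqr_code_subgroup: ?R if "pair_pqr_code_subgroup p q r ?A C"
      using that unfolding pair_pqr_code_subgroup_def
    proof (elim exE conjE, goal_cases)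
      case (1 \<alpha>)
      show ?case
        by (rule exI[of _ "\<lambda>_. 0"], rule exI[of _ "\<lambda>_ _. 0"], rule exI[of _ "\<alpha>"], rule exI[of _ "\<lambda>_. 0"], rule exI[of _ "\<lambda>_ _. 0"], rule exI[of _ "\<lambda>_. 0"], rule exI[of _ "\<lambda>_ _. 0"],
            (rule conjI, (fact 1 | rule refl))+, ((rule conjI | (rule disjI1, rule conjI)), fact 1, fact 1 | rule disjI2)+)
    qed
    show ?R
      using zf.classification[OF assms(12)]
      by (elim disjE) (erule p | erule pq_cosets_free_code | erule pq_code_q_free | erule pq_code_cosets | erule pq_code_q_by_r | erule pq_code_q_by_P | erule pq_cosets_free_set | erule pq_code_subgroup | erule pq_cosets_free_code_swap | erule pq_code_q_free_swap | erule pq_code_cosets_swap | erule pq_code_q_by_r_swap | erule pq_code_q_by_P_swap | erule pq_cosets_free_set_swap | erule pq_code_subgroup_swap | erule pqr_cosets | erule pqr_code_q | erule pqr_code_q_swap | erule pqr_cosets_code_q | erule pqr_cosets_code_q_swap | erule pqr_code_qr | erule pqr_code_subgroup)+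
  next
    assume ?R
    (* The body is folded so that the quantifiers are eliminated without solving the equations at index 0. *)
    define Q where "Q = ?Q"
    have "\<exists>a1 a2 a3 b1 b2 l1 l2. Q a1 a2 a3 b1 b2 l1 l2" using \<open>?R\<close> unfolding Q_def .
    then obtain a1 a2 a3 b1 b2 l1 l2 where "Q a1 a2 a3 b1 b2 l1 l2" by blast
    then show "factorization (Zppqr p q r) ?A C"
      unfolding Q_def
    proof (elim conjE disjE, goal_cases)
      case 1
      have "pair_p p q r ?A C"
        unfolding pair_p_def by (rule exI[of _ a1], intro conjI) (fact 1)+
      then show ?case by (rule distinct_primes.factorization_pair_p[OF dp(1)])
    next
      case 2
      have "pair_pq_cosets_free_code p q r ?A C"
        unfolding pair_pq_cosets_free_code_def by (rule exI[of _ a1], rule exI[of _ b1], rule exI[of _ l2], intro conjI) (fact 2)+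
      then show ?case by (rule distinct_primes.factorization_pair_pq_cosets_free_code[OF dp(1)])
    next
      case 3
      have "pair_pq_code_q_free p q r ?A C"
        unfolding pair_pq_code_q_free_def by (rule exI[of _ a1], rule exI[of _ l2], intro conjI) (fact 3)+
      then show ?case by (rule distinct_primes.factorization_pair_pq_code_q_free[OF dp(1)])
    next
      case 4
      have "pair_pq_code_cosets p q r ?A C"
        unfolding pair_pq_code_cosets_def by (rule exI[of _ a2], rule exI[of _ a1], rule exI[of _ l1], intro conjI) (fact 4)+
      then show ?case by (rule distinct_primes.factorization_pair_pq_code_cosets[OF dp(1)])
    next
      case 5
      have "pair_pq_code_q_by_r p q r ?A C"
        unfolding pair_pq_code_q_by_r_def by (rule exI[of _ a2], rule exI[of _ a1], rule exI[of _ l1], intro conjI) (fact 5)+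
      then show ?case by (rule distinct_primes.factorization_pair_pq_code_q_by_r[OF dp(1)])
    next
      case 6
      have "pair_pq_code_q_by_P p q r ?A C"
        unfolding pair_pq_code_q_by_P_def by (rule exI[of _ a1], rule exI[of _ a2], rule exI[of _ l1], intro conjI) (fact 6)+
      then show ?case by (rule distinct_primes.factorization_pair_pq_code_q_by_P[OF dp(1)])
    next
      case 7
      have "pair_pq_cosets_free_set p q r ?A C"
        unfolding pair_pq_cosets_free_set_def by (rule exI[of _ a1], rule exI[of _ a2], rule exI[of _ l1], intro conjI) (fact 7)+
      then show ?case by (rule distinct_primes.factorization_pair_pq_cosets_free_set[OF dp(1)])
    next
      case 8
      have "pair_pq_code_subgroup p q r ?A C"
        unfolding pair_pq_code_subgroup_def by (rule exI[of _ a2], rule exI[of _ b2], intro conjI) (fact 8)+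
      then show ?case by (rule distinct_primes.factorization_pair_pq_code_subgroup[OF dp(1)])
    next
      case 9
      have "pair_pq_cosets_free_code p r q (swap_qr ` ?A) (swap_qr ` C)"
        unfolding pair_pq_cosets_free_code_def swap_qr_family by (rule exI[of _ a1], rule exI[of _ b1], rule exI[of _ l2], intro conjI) (fact 9)+
      from distinct_primes.factorization_pair_pq_cosets_free_code[OF dp(2) this]
      show ?case using factorization_swap_qr[OF pos(1,3,2)] by (fastforce simp: image_image)
    next
      case 10
      have "pair_pq_code_q_free p r q (swap_qr ` ?A) (swap_qr ` C)"
        unfolding pair_pq_code_q_free_def swap_qr_family by (rule exI[of _ a1], rule exI[of _ l2], intro conjI) (fact 10)+
      from distinct_primes.factorization_pair_pq_code_q_free[OF dp(2) this]
      show ?case using factorization_swap_qr[OF pos(1,3,2)] by (fastforce simp: image_image)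
    next
      case 11
      have "pair_pq_code_cosets p r q (swap_qr ` ?A) (swap_qr ` C)"
        unfolding pair_pq_code_cosets_def swap_qr_family by (rule exI[of _ a2], rule exI[of _ a1], rule exI[of _ l1], intro conjI) (fact 11)+
      from distinct_primes.factorization_pair_pq_code_cosets[OF dp(2) this]
      show ?case using factorization_swap_qr[OF pos(1,3,2)] by (fastforce simp: image_image)
    next
      case 12
      have "pair_pq_code_q_by_r p r q (swap_qr ` ?A) (swap_qr ` C)"
        unfolding pair_pq_code_q_by_r_def swap_qr_family by (rule exI[of _ a2], rule exI[of _ a1], rule exI[of _ l1], intro conjI) (fact 12)+
      from distinct_primes.factorization_pair_pq_code_q_by_r[OF dp(2) this]
      show ?case using factorization_swap_qr[OF pos(1,3,2)] by (fastforce simp: image_image)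
    next
      case 13
      have "pair_pq_code_q_by_P p r q (swap_qr ` ?A) (swap_qr ` C)"
        unfolding pair_pq_code_q_by_P_def swap_qr_family by (rule exI[of _ a1], rule exI[of _ a2], rule exI[of _ l1], intro conjI) (fact 13)+
      from distinct_primes.factorization_pair_pq_code_q_by_P[OF dp(2) this]
      show ?case using factorization_swap_qr[OF pos(1,3,2)] by (fastforce simp: image_image)
    next
      case 14
      have "pair_pq_cosets_free_set p r q (swap_qr ` ?A) (swap_qr ` C)"
        unfolding pair_pq_cosets_free_set_def swap_qr_family by (rule exI[of _ a1], rule exI[of _ a2], rule exI[of _ l1], intro conjI) (fact 14)+
      from distinct_primes.factorization_pair_pq_cosets_free_set[OF dp(2) this]
      show ?case using factorization_swap_qr[OF pos(1,3,2)] by (fastforce simp: image_image)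
    next
      case 15
      have "pair_pq_code_subgroup p r q (swap_qr ` ?A) (swap_qr ` C)"
        unfolding pair_pq_code_subgroup_def swap_qr_family by (rule exI[of _ a2], rule exI[of _ b2], intro conjI) (fact 15)+
      from distinct_primes.factorization_pair_pq_code_subgroup[OF dp(2) this]
      show ?case using factorization_swap_qr[OF pos(1,3,2)] by (fastforce simp: image_image)
    next
      case 16
      have "pair_pqr_cosets p q r ?A C"
        unfolding pair_pqr_cosets_def by (rule exI[of _ a2], rule exI[of _ l1], intro conjI) (fact 16)+
      then show ?case by (rule distinct_primes.factorization_pair_pqr_cosets[OF dp(1)])
    next
      case 17
      have "pair_pqr_code_q p q r ?A C"
        unfolding pair_pqr_code_q_def by (rule exI[of _ a2], rule exI[of _ l1], intro conjI) (fact 17)+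
      then show ?case by (rule distinct_primes.factorization_pair_pqr_code_q[OF dp(1)])
    next
      case 18
      have "pair_pqr_code_q p r q (swap_qr ` ?A) (swap_qr ` C)"
        unfolding pair_pqr_code_q_def swap_qr_family by (rule exI[of _ a2], rule exI[of _ l1], intro conjI) (fact 18)+
      from distinct_primes.factorization_pair_pqr_code_q[OF dp(2) this]
      show ?case using factorization_swap_qr[OF pos(1,3,2)] by (fastforce simp: image_image)
    next
      case 19
      have "pair_pqr_cosets_code_q p q r ?A C"
        unfolding pair_pqr_cosets_code_q_def by (rule exI[of _ a1], rule exI[of _ l1], intro conjI) (fact 19)+
      then show ?case by (rule distinct_primes.factorization_pair_pqr_cosets_code_q[OF dp(1)])
    next
      case 20
      have "pair_pqr_cosets_code_q p r q (swap_qr ` ?A) (swap_qr ` C)"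
        unfolding pair_pqr_cosets_code_q_def swap_qr_family by (rule exI[of _ a1], rule exI[of _ l1], intro conjI) (fact 20)+
      from distinct_primes.factorization_pair_pqr_cosets_code_q[OF dp(2) this]
      show ?case using factorization_swap_qr[OF pos(1,3,2)] by (fastforce simp: image_image)
    next
      case 21
      have "pair_pqr_code_qr p q r ?A C"
        unfolding pair_pqr_code_qr_def by (rule exI[of _ a1], rule exI[of _ l1], intro conjI) (fact 21)+
      then show ?case by (rule distinct_primes.factorization_pair_pqr_code_qr[OF dp(1)])
    next
      case 22
      have "pair_pqr_code_subgroup p q r ?A C"
        unfolding pair_pqr_code_subgroup_def by (rule exI[of _ a3], intro conjI) (fact 22)+
      then show ?case by (rule distinct_primes.factorization_pair_pqr_code_subgroup[OF dp(1)])
    qed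
  qed
  finally show ?thesis .
qed

end
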